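(* Let $X=\operatorname{Gr}(2,4)$ and consider the truncation $(K^B)_{<2}$ of Dubrovin's operator $K^B$ at energy $\alpha=2$ (i.e. modulo $q^2$), with respect to the basis of Schubert classes. Let $t\in\mathbb{C}^\times$. If $B=t[X_d]$ with $d$ one of the Young diagrams $(2)$, $(1,1)$, $(2,2)$, then $(K^B)_{<2}$ has simple spectrum (all its eigenvalues in the Novikov field $\Lambda$ have multiplicity one). If $B=t[X_{(2,1)}]$, then $(K^B)_{<2}$ does not have simple spectrum.
   Context: **Cohomology.** $X=\operatorname{Gr}(2,4)$ is the Grassmannian of complex planes in $\mathbb{C}^4$. $H(X;\mathbb{C})$ has the basis of Schubert classes $\sigma_d=\operatorname{PD}([X_d])$, with $X_d\subset X$ the Schubert cycle of the Young diagram $d\subset 2\times2$, ordered as $\sigma_0=\sigma_\emptyset$, $\sigma_1=\sigma_{(1)}$, $\sigma_2=\sigma_{(2)}$, $\sigma_3=\sigma_{(1,1)}$, $\sigma_4=\sigma_{(2,1)}$, $\sigma_5=\sigma_{(2,2)}$ (cohomological degrees $0,2,4,4,6,8$). The intersection matrix $g$ has $g_{05}=g_{50}=g_{14}=g_{41}=g_{22}=g_{33}=1$ and zeros elsewhere, so $g^{-1}=g$; also $c_1(X)=4\sigma_1$. **Big quantum cohomology.** Let $t=(t_0,\dots,t_5)$ be the coordinates on $H(X;\mathbb{C})$ in this basis. The genus $0$ Gromov-Witten potential is $\Phi=\Phi_c+\hat\Phi$ with $$\Phi_c=\tfrac12t_1^2t_3+\tfrac12t_1^2t_2+\tfrac12t_0t_3^2+\tfrac12t_0t_2^2+t_0t_1t_4+\tfrac12t_0^2t_5,$$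 $$\hat\Phi=\sum_{d\ge1}\Big(\sum_{|\hat n|=4d+1}N(\hat n)\frac{t_2^{n_2}t_3^{n_3}t_4^{n_4}t_5^{n_5}}{n_2!n_3!n_4!n_5!}\Big)e^{dt_1},$$ where $\hat n=(n_2,n_3,n_4,n_5)\in\mathbb{N}^4$, $|\hat n|=n_2+n_3+2n_4+3n_5$, and $N(\hat n)$ is the genus $0$ Gromov-Witten number of degree $d$ spheres in $X$ ($d$ times the class of a line) with $n_i$ marked points constrained to cycles Poincaré dual to $\sigma_i$, $i=2,\dots,5$. The product is $\sigma_i\star_t\sigma_j=\sum_{e,f}\Phi_{ije}g^{ef}\sigma_f$, with $\Phi_{ije}$ third partial derivatives, after which one sets $e^{t_1}=q$, the formal parameter of the Novikov field $\Lambda$ over $\mathbb{C}$. **Dubrovin's operator.** It is multiplication ($\star_t$) by $K^t=4\sigma_1+t_0\sigma_0-t_2\sigma_2-t_3\sigma_3-2t_4\sigma_4-3t_5\sigma_5$. Here $t_0=0$. For $B=t[X_d]$ with $\sigma_d=\sigma_i$, $i\in\{2,3,4,5\}$, the operator $K^B$ is the one with $t_i=t$ and the other coordinates among $t_2,\dots,t_5$ equal to $0$. **Truncation.** Write the matrix of $K^B\star-$ in the basis $\sigma_0,\dots,\sigma_5$ as $M=\sum_{d\ge0}M_dq^d$ with $M_d$ complex matrices. The truncation at energy $\alpha$ is the $\Lambda$-linear operator $(K^B)_{<\alpha}$ with matrix $\sum_{0\le d<\alpha}M_dq^d$. *)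

theory Defs
  imports "HOL-Analysis.Analysis" "Jordan_Normal_Form.Char_Poly"
begin

no_notation Matrix.vec_index (infixl "$" 100)

section \<open>The Novikov field\<close>

text \<open>An element is a series \<open>\<Sum>x. f x * q^x\<close> with real exponents, finitely many of them below
  any bound.\<close>

typedef (overloaded) 'a novikov =
  "{f :: real \<Rightarrow> 'a::zero. \<forall>C. finite {x. x \<le> C \<and> f x \<noteq> 0}}"
  morphisms nov_coeff Abs_novikov
  by (rule exI[of _ "\<lambda>_. 0"]) simp

setup_lifting type_definition_novikov

lemma finite_nov_coeff: "finite {x. x \<le> C \<and> nov_coeff f x \<noteq> 0}"
  using nov_coeff[of f] by auto

lemma novikov_eqI: "(\<And>x. nov_coeff f x = nov_coeff g x) \<Longrightarrow> f = g"
  by (metis nov_coeff_inject ext)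

lemma nov_coeff_lower_bound: "\<exists>m. \<forall>x. nov_coeff f x \<noteq> 0 \<longrightarrow> m \<le> x"
proof -
  have "finite (insert 0 {x. x \<le> 0 \<and> nov_coeff f x \<noteq> 0})" (is "finite ?S")
    using finite_nov_coeff[of 0 f] by simp
  hence "\<forall>x. nov_coeff f x \<noteq> 0 \<longrightarrow> Min ?S \<le> x"
    by (smt (verit) Min_le insert_iff mem_Collect_eq)
  thus ?thesis by blast
qed

lift_definition nov_monom :: "'a::zero \<Rightarrow> real \<Rightarrow> 'a novikov" is
  "\<lambda>c y x. if x = y then c else 0"
  by (rule finite_subset[of _ "{_}"]) auto

definition nov_conv :: "(real \<Rightarrow> 'a) \<Rightarrow> (real \<Rightarrow> 'a) \<Rightarrow> real \<Rightarrow> 'a::comm_ring_1" where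
  "nov_conv f g x = (\<Sum>a | f a \<noteq> 0 \<and> g (x - a) \<noteq> 0. f a * g (x - a))"

lemma nov_conv_superset:
  assumes "finite A" "\<And>a. f a \<noteq> 0 \<Longrightarrow> g (x - a) \<noteq> 0 \<Longrightarrow> a \<in> A"
  shows "nov_conv f g x = (\<Sum>a\<in>A. f a * g (x - a))"
  unfolding nov_conv_def by (rule sum.mono_neutral_left) (use assms in auto)

lemma nov_conv_commute: "nov_conv f g x = nov_conv g f x"
  unfolding nov_conv_def
  by (rule sum.reindex_bij_witness[of _ "\<lambda>a. x - a" "\<lambda>a. x - a"]) (auto simp: mult.commute)

lemma nov_conv_nonzero:
  assumes "nov_conv f g x \<noteq> 0"
  shows "\<exists>a. f a \<noteq> 0 \<and> g (x - a) \<noteq> 0"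
proof (rule ccontr)
  assume "\<not> ?thesis"
  hence "{a. f a \<noteq> 0 \<and> g (x - a) \<noteq> 0} = {}" by auto
  with assms show False unfolding nov_conv_def by simp
qed

lemma nov_conv_closed:
  "\<forall>C. finite {x. x \<le> C \<and> nov_conv (nov_coeff f) (nov_coeff g) x \<noteq> 0}"
proof
  fix C
  obtain m where m: "\<And>x. nov_coeff f x \<noteq> 0 \<Longrightarrow> m \<le> x"
    using nov_coeff_lower_bound[of f] by auto
  obtain k where k: "\<And>x. nov_coeff g x \<noteq> 0 \<Longrightarrow> k \<le> x"
    using nov_coeff_lower_bound[of g] by auto
  let ?A = "{x. x \<le> C - k \<and> nov_coeff f x \<noteq> 0}"
  let ?B = "{x. x \<le> C - m \<and> nov_coeff g x \<noteq> 0}"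
  have "{x. x \<le> C \<and> nov_conv (nov_coeff f) (nov_coeff g) x \<noteq> 0}
      \<subseteq> (\<lambda>(a, b). a + b) ` (?A \<times> ?B)"
  proof
    fix x assume "x \<in> {x. x \<le> C \<and> nov_conv (nov_coeff f) (nov_coeff g) x \<noteq> 0}"
    then obtain a where a: "x \<le> C" "nov_coeff f a \<noteq> 0" "nov_coeff g (x - a) \<noteq> 0"
      using nov_conv_nonzero[of "nov_coeff f" "nov_coeff g" x] by auto
    have "a \<in> ?A" "x - a \<in> ?B" using a m[of a] k[of "x - a"] by auto
    thus "x \<in> (\<lambda>(a, b). a + b) ` (?A \<times> ?B)"
      by (intro image_eqI[of _ _ "(a, x - a)"]) auto
  qed
  thus "finite {x. x \<le> C \<and> nov_conv (nov_coeff f) (nov_coeff g) x \<noteq> 0}"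
    by (rule finite_subset) (intro finite_imageI finite_cartesian_product finite_nov_coeff)
qed

instantiation novikov :: (comm_ring_1) comm_ring_1
begin

lift_definition zero_novikov :: "'a novikov" is "\<lambda>_. 0" by simp

definition "one_novikov = nov_monom (1::'a) 0"

lift_definition uminus_novikov :: "'a novikov \<Rightarrow> 'a novikov" is "\<lambda>f x. - f x" by simp

lift_definition plus_novikov :: "'a novikov \<Rightarrow> 'a novikov \<Rightarrow> 'a novikov" is
  "\<lambda>f g x. f x + g x"
proof -
  fix f g :: "real \<Rightarrow> 'a" and C
  assume "\<And>C. finite {x. x \<le> C \<and> f x \<noteq> 0}" "\<And>C. finite {x. x \<le> C \<and> g x \<noteq> 0}"
  hence "finite ({x. x \<le> C \<and> f x \<noteq> 0} \<union> {x. x \<le> C \<and> g x \<noteq> 0})" by blast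
  thus "finite {x. x \<le> C \<and> f x + g x \<noteq> 0}" by (rule rev_finite_subset) auto
qed

definition "minus_novikov f g = f + - (g :: 'a novikov)"

definition "times_novikov f g = Abs_novikov (nov_conv (nov_coeff f) (nov_coeff (g :: 'a novikov)))"

lemma nov_coeff_times: "nov_coeff (f * g) = nov_conv (nov_coeff f) (nov_coeff (g :: 'a novikov))"
  unfolding times_novikov_def
  by (rule Abs_novikov_inverse) (use nov_conv_closed in blast)

lemma nov_coeff_one: "nov_coeff (1 :: 'a novikov) x = (if x = 0 then 1 else 0)"
  unfolding one_novikov_def by transfer simp

instance
proof
  fix f g h :: "'a novikov"
  show "f + g + h = f + (g + h)" by transfer (simp add: add.assoc)
  show "f + g = g + f" by transfer (simp add: add.commute)
  show "0 + f = f" by transfer simp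
  show "- f + f = 0" by transfer simp
  show "f - g = f + - g" by (simp add: minus_novikov_def)
  show "f * g = g * f" by (rule novikov_eqI) (simp add: nov_coeff_times nov_conv_commute)
  show "1 * f = f"
  proof (rule novikov_eqI)
    fix x
    have "nov_coeff (1 * f) x = (\<Sum>a\<in>{0}. nov_coeff 1 a * nov_coeff f (x - a))"
      unfolding nov_coeff_times
      by (rule nov_conv_superset) (auto simp: nov_coeff_one split: if_splits)
    thus "nov_coeff (1 * f) x = nov_coeff f x" by (simp add: nov_coeff_one)
  qed
  show "(0 :: 'a novikov) \<noteq> 1"
  proof
    assume "(0 :: 'a novikov) = 1"
    hence "nov_coeff (0 :: 'a novikov) 0 = nov_coeff 1 0" by simp
    thus False by (simp add: nov_coeff_one zero_novikov.rep_eq)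
  qed
  obtain m1 where m1: "\<And>x. nov_coeff f x \<noteq> 0 \<Longrightarrow> m1 \<le> x" using nov_coeff_lower_bound[of f] by auto
  obtain m2 where m2: "\<And>x. nov_coeff g x \<noteq> 0 \<Longrightarrow> m2 \<le> x" using nov_coeff_lower_bound[of g] by auto
  obtain m3 where m3: "\<And>x. nov_coeff h x \<noteq> 0 \<Longrightarrow> m3 \<le> x" using nov_coeff_lower_bound[of h] by auto
  show "(f + g) * h = f * h + g * h"
  proof (rule novikov_eqI)
    fix x
    let ?H = "{c. c \<le> x - min m1 m2 \<and> nov_coeff h c \<noteq> 0}"
    have fin: "finite ?H" by (rule finite_nov_coeff)
    have fg: "nov_coeff (f + g) y = nov_coeff f y + nov_coeff g y" for y
      by (rule plus_novikov.rep_eq[THEN fun_cong])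
    have 1: "c \<in> ?H" if "nov_coeff h c \<noteq> 0" "nov_coeff f (x - c) \<noteq> 0" for c
      using that m1 by force
    have 2: "c \<in> ?H" if "nov_coeff h c \<noteq> 0" "nov_coeff g (x - c) \<noteq> 0" for c
      using that m2 by force
    have 3: "c \<in> ?H" if "nov_coeff h c \<noteq> 0" "nov_coeff (f + g) (x - c) \<noteq> 0" for c
      using that 1 2 fg[of "x - c"] by fastforce
    have "nov_coeff ((f + g) * h) x = (\<Sum>c\<in>?H. nov_coeff h c * nov_coeff (f + g) (x - c))"
      unfolding nov_coeff_times nov_conv_commute[of _ "nov_coeff h"]
      by (rule nov_conv_superset[OF fin 3])
    moreover have "nov_coeff (f * h) x = (\<Sum>c\<in>?H. nov_coeff h c * nov_coeff f (x - c))"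
      unfolding nov_coeff_times nov_conv_commute[of _ "nov_coeff h"]
      by (rule nov_conv_superset[OF fin 1])
    moreover have "nov_coeff (g * h) x = (\<Sum>c\<in>?H. nov_coeff h c * nov_coeff g (x - c))"
      unfolding nov_coeff_times nov_conv_commute[of _ "nov_coeff h"]
      by (rule nov_conv_superset[OF fin 2])
    ultimately show "nov_coeff ((f + g) * h) x = nov_coeff (f * h + g * h) x"
      by (simp add: plus_novikov.rep_eq fg distrib_left sum.distrib del: mem_Collect_eq)
  qed
  show "f * g * h = f * (g * h)"
  proof (rule novikov_eqI)
    fix x
    define F where "F = {a. a \<le> x - m2 - m3 \<and> nov_coeff f a \<noteq> 0}"
    define H where "H = {c. c \<le> x - m1 - m2 \<and> nov_coeff h c \<noteq> 0}"
    have fin: "finite F" "finite H" unfolding F_def H_def by (rule finite_nov_coeff)+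
    have a: "nov_conv (nov_coeff f) (nov_coeff g) (x - c)
        = (\<Sum>a\<in>F. nov_coeff f a * nov_coeff g (x - c - a))" if "c \<in> H" for c
      by (rule nov_conv_superset[OF fin(1)]) (use that m2 m3 in \<open>force simp: F_def H_def\<close>)
    have b: "nov_conv (nov_coeff h) (nov_coeff g) (x - a)
        = (\<Sum>c\<in>H. nov_coeff h c * nov_coeff g (x - a - c))" if "a \<in> F" for a
      by (rule nov_conv_superset[OF fin(2)]) (use that m2 m1 in \<open>force simp: F_def H_def\<close>)
    have "nov_coeff (f * g * h) x
        = (\<Sum>c\<in>H. nov_coeff h c * nov_conv (nov_coeff f) (nov_coeff g) (x - c))"
      unfolding nov_coeff_times nov_conv_commute[of _ "nov_coeff h"]
    proof (rule nov_conv_superset[OF fin(2)])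
      fix c assume c: "nov_coeff h c \<noteq> 0" "nov_conv (nov_coeff f) (nov_coeff g) (x - c) \<noteq> 0"
      then obtain a where "nov_coeff f a \<noteq> 0" "nov_coeff g (x - c - a) \<noteq> 0"
        using nov_conv_nonzero[of "nov_coeff f" "nov_coeff g" "x - c"] by auto
      with c m1 m2 show "c \<in> H" by (force simp: H_def)
    qed
    also have "\<dots> = (\<Sum>c\<in>H. \<Sum>a\<in>F. nov_coeff h c * (nov_coeff f a * nov_coeff g (x - c - a)))"
      by (simp add: a sum_distrib_left)
    also have "\<dots> = (\<Sum>a\<in>F. \<Sum>c\<in>H. nov_coeff h c * (nov_coeff f a * nov_coeff g (x - c - a)))"
      by (rule sum.swap)
    also have "\<dots> = (\<Sum>a\<in>F. nov_coeff f a * nov_conv (nov_coeff h) (nov_coeff g) (x - a))"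
      by (simp add: b sum_distrib_left mult_ac diff_diff_eq add.commute)
    also have "\<dots> = nov_conv (nov_coeff f) (nov_conv (nov_coeff h) (nov_coeff g)) x"
    proof (rule nov_conv_superset[OF fin(1), symmetric])
      fix a assume c: "nov_coeff f a \<noteq> 0" "nov_conv (nov_coeff h) (nov_coeff g) (x - a) \<noteq> 0"
      then obtain c where "nov_coeff h c \<noteq> 0" "nov_coeff g (x - a - c) \<noteq> 0"
        using nov_conv_nonzero[of "nov_coeff h" "nov_coeff g" "x - a"] by auto
      with c m2 m3 show "a \<in> F" by (force simp: F_def)
    qed
    also have "nov_conv (nov_coeff h) (nov_coeff g) = nov_conv (nov_coeff g) (nov_coeff h)"
      by (rule ext) (rule nov_conv_commute)
    finally show "nov_coeff (f * g * h) x = nov_coeff (f * (g * h)) x"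
      by (simp add: nov_coeff_times)
  qed
qed

end

lemma nov_coeff_diff: "nov_coeff (f - g) x = nov_coeff f x - nov_coeff g x"
  unfolding minus_novikov_def plus_novikov.rep_eq uminus_novikov.rep_eq by simp

lemma nov_coeff_sum: "nov_coeff (sum f A) x = (\<Sum>i\<in>A. nov_coeff (f i) x)"
  by (induction A rule: infinite_finite_induct)
    (simp_all add: zero_novikov.rep_eq plus_novikov.rep_eq)

lemma nov_coeff_power_bound:
  assumes "\<And>x. nov_coeff h x \<noteq> 0 \<Longrightarrow> e \<le> x"
  shows "nov_coeff (h ^ n) x \<noteq> 0 \<Longrightarrow> real n * e \<le> x"
proof (induction n arbitrary: x)
  case 0
  thus ?case by (simp add: nov_coeff_one split: if_splits)
next
  case (Suc n)
  then obtain a where "nov_coeff h a \<noteq> 0" "nov_coeff (h ^ n) (x - a) \<noteq> 0"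
    using nov_conv_nonzero[of "nov_coeff h" "nov_coeff (h ^ n)" x]
    by (auto simp: nov_coeff_times)
  with assms[of a] Suc.IH[of "x - a"] show ?case by (simp add: algebra_simps)
qed

lemma novikov_geometric:
  assumes e: "e > 0" and h: "\<And>x. nov_coeff h x \<noteq> 0 \<Longrightarrow> e \<le> x"
  shows "\<exists>g. (1 - h) * g = (1 :: 'a::comm_ring_1 novikov)"
proof -
  define N where "N x = nat \<lceil>x / e\<rceil>" for x
  define G where "G x = (\<Sum>n\<le>N x. nov_coeff (h ^ n) x)" for x
  have N: "x < real n * e" if "N x < n" for n x
  proof -
    have "x / e \<le> real (N x)" unfolding N_def by (simp add: real_nat_ceiling_ge)
    also have "\<dots> < real n" using that by simp
    finally show ?thesis using e by (simp add: field_simps)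
  qed
  have N_mono: "N x \<le> N y" if "x \<le> y" for x y
    unfolding N_def using that e by (intro nat_mono ceiling_mono divide_right_mono) auto
  have G: "G x = (\<Sum>n\<le>M. nov_coeff (h ^ n) x)" if "N x \<le> M" for x M
    unfolding G_def
  proof (rule sum.mono_neutral_left)
    show "\<forall>n\<in>{..M} - {..N x}. nov_coeff (h ^ n) x = 0"
    proof
      fix n assume "n \<in> {..M} - {..N x}"
      hence "x < real n * e" using N[of x n] by auto
      thus "nov_coeff (h ^ n) x = 0" using nov_coeff_power_bound[of h e n x, OF h] by force
    qed
  qed (use that in auto)
  have "\<forall>C. finite {x. x \<le> C \<and> G x \<noteq> 0}"
  proof
    fix C
    have "{x. x \<le> C \<and> G x \<noteq> 0} \<subseteq> (\<Union>n\<le>N C. {x. x \<le> C \<and> nov_coeff (h ^ n) x \<noteq> 0})"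
    proof
      fix x assume "x \<in> {x. x \<le> C \<and> G x \<noteq> 0}"
      hence x: "x \<le> C" and "(\<Sum>n\<le>N C. nov_coeff (h ^ n) x) \<noteq> 0"
        using G[of x "N C"] N_mono[of x C] by auto
      then obtain n where "n \<le> N C" "nov_coeff (h ^ n) x \<noteq> 0"
        by (metis (no_types, lifting) atMost_iff sum.neutral)
      with x show "x \<in> (\<Union>n\<le>N C. {x. x \<le> C \<and> nov_coeff (h ^ n) x \<noteq> 0})" by auto
    qed
    thus "finite {x. x \<le> C \<and> G x \<noteq> 0}"
      by (rule finite_subset) (intro finite_UN_I finite_nov_coeff finite_atMost)
  qed
  hence g: "nov_coeff (Abs_novikov G) = G" by (intro Abs_novikov_inverse) blast
  have "(1 - h) * Abs_novikov G = 1"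
  proof (rule novikov_eqI)
    fix x
    define S where "S = (\<Sum>n\<le>N x. h ^ n)"
    have S: "nov_coeff S y = G y" if "y \<le> x" for y
      unfolding S_def nov_coeff_sum using G[of y "N x"] N_mono[OF that] by simp
    have h0: "0 \<le> a" if "nov_coeff (1 - h) a \<noteq> 0" for a
      using that h[of a] e by (cases "a = 0") (auto simp: nov_coeff_diff nov_coeff_one)
    define A where "A = {a. a \<le> \<bar>x\<bar> + \<bar>x\<bar> \<and> nov_coeff (1 - h) a \<noteq> 0}"
    have "nov_coeff ((1 - h) * Abs_novikov G) x = nov_coeff ((1 - h) * S) x"
      unfolding nov_coeff_times nov_conv_def g
      by (rule sum.cong) (use S h0 in \<open>auto\<close>)
    also have "(1 - h) * S = 1 - h ^ Suc (N x)"
      unfolding S_def by (rule sum_gp_basic)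
    also have "nov_coeff \<dots> x = nov_coeff 1 x"
      using N[of x "Suc (N x)"] nov_coeff_power_bound[of h e "Suc (N x)" x, OF h]
      by (force simp: nov_coeff_diff)
    finally show "nov_coeff ((1 - h) * Abs_novikov G) x = nov_coeff 1 x" .
  qed
  thus ?thesis ..
qed

lemma novikov_inverse_exists:
  fixes f :: "'a::field novikov"
  assumes "f \<noteq> 0"
  shows "\<exists>g. f * g = 1"
proof -
  have "\<exists>y. nov_coeff f y \<noteq> 0"
  proof (rule ccontr)
    assume "\<not> ?thesis"
    hence "f = 0" by (intro novikov_eqI) (simp add: zero_novikov.rep_eq)
    with assms show False ..
  qed
  then obtain y where y: "nov_coeff f y \<noteq> 0" ..
  define A where "A = {x. x \<le> y \<and> nov_coeff f x \<noteq> 0}"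
  have A: "finite A" "y \<in> A" unfolding A_def using finite_nov_coeff[of y f] y by simp_all
  define a where "a = Min A"
  have a: "nov_coeff f a \<noteq> 0" using Min_in[OF A(1)] A(2) unfolding a_def A_def by blast
  have a_le: "a \<le> x" if "nov_coeff f x \<noteq> 0" for x
  proof (cases "x \<le> y")
    case True
    thus ?thesis unfolding a_def using A(1) that True by (intro Min_le) (simp_all add: A_def)
  next
    case False
    have "a \<le> y" unfolding a_def using A by (intro Min_le)
    with False show ?thesis by simp
  qed
  define u where "u = nov_monom (1 / nov_coeff f a) (- a)"
  have u: "nov_coeff (f * u) x = nov_coeff f (x + a) / nov_coeff f a" for x
  proof -
    have "nov_coeff (f * u) x = (\<Sum>b\<in>{x + a}. nov_coeff f b * nov_coeff u (x - b))"
      unfolding nov_coeff_times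
      by (rule nov_conv_superset) (auto simp: u_def nov_monom.rep_eq split: if_splits)
    thus ?thesis by (simp add: u_def nov_monom.rep_eq)
  qed
  define h where "h = 1 - f * u"
  have h: "0 < x" if "nov_coeff h x \<noteq> 0" for x
    using that a_le[of "x + a"] a by (cases "x = 0") (auto simp: h_def nov_coeff_diff nov_coeff_one u)
  define B where "B = insert 1 {x. x \<le> 1 \<and> nov_coeff h x \<noteq> 0}"
  have B: "finite B" unfolding B_def using finite_nov_coeff[of 1 h] by simp
  have "Min B > 0" using B h by (subst Min_gr_iff) (auto simp: B_def)
  moreover have "Min B \<le> x" if "nov_coeff h x \<noteq> 0" for x
  proof (cases "x \<le> 1")
    case True
    thus ?thesis using B that True by (intro Min_le) (simp_all add: B_def)
  next
    case False
    have "Min B \<le> 1" using B by (intro Min_le) (auto simp: B_def)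
    with False show ?thesis by simp
  qed
  ultimately obtain g where "(1 - h) * g = 1" using novikov_geometric[of "Min B" h] by auto
  hence "f * (u * g) = 1" by (simp add: h_def mult.assoc)
  thus ?thesis ..
qed

instantiation novikov :: (field) field
begin

definition "inverse_novikov f = (if f = 0 then 0 else SOME g. f * g = (1 :: 'a novikov))"

definition "divide_novikov f g = f * inverse (g :: 'a novikov)"

instance
proof
  fix f g :: "'a novikov"
  show "inverse f * f = 1" if "f \<noteq> 0"
  proof -
    have "f * (SOME g. f * g = 1) = 1" by (rule someI_ex) (rule novikov_inverse_exists[OF that])
    moreover have "inverse f = (SOME g. f * g = 1)" using that by (simp only: inverse_novikov_def if_False)
    ultimately show ?thesis by (metis mult.commute)
  qed
  show "f div g = f * inverse g" by (simp add: divide_novikov_def)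
  show "inverse (0 :: 'a novikov) = 0" by (simp add: inverse_novikov_def)
qed

end

section \<open>Grassmannians and Schubert varieties\<close>

definition grassmannian :: "nat \<Rightarrow> (complex ^ 'n) set set" where
  "grassmannian k = {W. vec.subspace W \<and> vec.dim W = k}"

definition coord_subspace :: "nat \<Rightarrow> (complex ^ 4) set" where
  "coord_subspace m = vec.span ((\<lambda>j. axis (of_nat j) 1) ` {1..m})"

text \<open>The Schubert variety of a partition \<open>(l1, l2)\<close> with \<open>l2 \<le> l1 \<le> 2\<close>, of codimension
  \<open>l1 + l2\<close>, for the standard flag.\<close>

definition schubert_variety :: "nat \<times> nat \<Rightarrow> (complex ^ 4) set set" where
  "schubert_variety = (\<lambda>(l1, l2). {W \<in> grassmannian 2.
     vec.dim (W \<inter> coord_subspace (3 - l1)) \<ge> 1 \<and> vec.dim (W \<inter> coord_subspace (4 - l2)) \<ge> 2})"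

definition young_diagram :: "nat \<Rightarrow> nat \<times> nat" where
  "young_diagram i = [(0, 0), (1, 0), (2, 0), (1, 1), (2, 1), (2, 2)] ! i"

section \<open>Genus 0 Gromov-Witten numbers\<close>

text \<open>Holomorphic maps from the projective line (the lines in \<open>complex ^ 2\<close>) to \<open>Gr(2,4)\<close> of degree
  \<open>d\<close>, i.e. representing \<open>d\<close> times the class of a line: maps whose Plucker coordinates are given by
  binary forms of degree \<open>d\<close>. These have no common zero because \<open>x\<close>, \<open>y\<close> is a basis of a plane.\<close>

definition sphere_maps :: "nat \<Rightarrow> ((complex ^ 2) set \<Rightarrow> (complex ^ 4) set) set" where
  "sphere_maps d = {u \<in> grassmannian 1 \<rightarrow>\<^sub>E grassmannian 2.
     \<exists>a :: 4 \<Rightarrow> 4 \<Rightarrow> nat \<Rightarrow> complex. \<forall>v x y.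
       v \<noteq> 0 \<longrightarrow> vec.span {x, y} = u (vec.span {v}) \<longrightarrow>
       (\<exists>c. c \<noteq> 0 \<and> (\<forall>i j. x $ i * y $ j - x $ j * y $ i
          = c * (\<Sum>k\<le>d. a i j k * (v $ 1) ^ k * (v $ 2) ^ (d - k))))}"

text \<open>Spheres of degree \<open>d\<close> with distinct marked points, the \<open>i\<close>-th one constrained to the translate
  by \<open>g i\<close> of the Schubert variety with index \<open>cs ! i\<close>.\<close>

definition constrained_spheres ::
  "nat \<Rightarrow> nat list \<Rightarrow> (nat \<Rightarrow> complex ^ 4 ^ 4) \<Rightarrow>
   (((complex ^ 2) set \<Rightarrow> (complex ^ 4) set) \<times> (nat \<Rightarrow> (complex ^ 2) set)) set" where
  "constrained_spheres d cs g = {(u, z). u \<in> sphere_maps d \<and>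
     z \<in> {..<length cs} \<rightarrow>\<^sub>E grassmannian 1 \<and> inj_on z {..<length cs} \<and>
     (\<forall>i<length cs. u (z i) \<in> (\<lambda>W. (*v) (g i) ` W) ` schubert_variety (young_diagram (cs ! i)))}"

definition reparametrization ::
  "nat \<Rightarrow> ((((complex ^ 2) set \<Rightarrow> (complex ^ 4) set) \<times> (nat \<Rightarrow> (complex ^ 2) set)) \<times>
           (((complex ^ 2) set \<Rightarrow> (complex ^ 4) set) \<times> (nat \<Rightarrow> (complex ^ 2) set))) set" where
  "reparametrization n = {((u, z), (u', z')). \<exists>A :: complex ^ 2 ^ 2. invertible A \<and>
     (\<forall>L\<in>grassmannian 1. u' ((*v) A ` L) = u L) \<and> (\<forall>i<n. z' i = (*v) A ` z i)}"

definition sphere_classes where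
  "sphere_classes d cs g = constrained_spheres d cs g //
     (reparametrization (length cs) \<inter> constrained_spheres d cs g \<times> constrained_spheres d cs g)"

text \<open>A property of \<open>n\<close>-tuples in \<open>GL(4)\<close> that holds on a dense open subset.\<close>

definition generically :: "nat \<Rightarrow> ((nat \<Rightarrow> complex ^ 4 ^ 4) \<Rightarrow> bool) \<Rightarrow> bool" where
  "generically n P = (\<exists>U.
     openin (product_topology (\<lambda>_. top_of_set {A. invertible A}) {..<n}) U \<and>
     Abstract_Topology.closure_of (product_topology (\<lambda>_. top_of_set {A. invertible A}) {..<n}) U
       = {..<n} \<rightarrow>\<^sub>E {A. invertible A} \<and>
     (\<forall>g\<in>U. P g))"

text \<open>The genus 0 Gromov-Witten number of degree \<open>d\<close> with constraints \<open>cs\<close>: the number of constrained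
  spheres modulo reparametrization for generic translates of the Schubert cycles by elements of
  \<open>GL(4)\<close>. As \<open>Gr(2,4)\<close> is homogeneous, its complex structure is regular, generic translates are
  transverse to evaluation, and every sphere counts with sign \<open>+1\<close>.\<close>

definition gw_number :: "nat \<Rightarrow> nat list \<Rightarrow> nat" where
  "gw_number d cs = (THE N. generically (length cs)
     (\<lambda>g. finite (sphere_classes d cs g) \<and> card (sphere_classes d cs g) = N))"

section \<open>Big quantum cohomology\<close>

text \<open>Points of \<open>H(X)\<close> are functions \<open>t :: nat \<Rightarrow> complex\<close>, of which the coordinates \<open>t 0, \<dots>, t 5\<close>
  with respect to the Schubert classes are used.\<close>

definition gw_potential_classical :: "(nat \<Rightarrow> complex) \<Rightarrow> complex" where
  "gw_potential_classical t =
     (t 1)\<^sup>2 * t 3 / 2 + (t 1)\<^sup>2 * t 2 / 2 + t 0 * (t 3)\<^sup>2 / 2 + t 0 * (t 2)\<^sup>2 / 2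
     + t 0 * t 1 * t 4 + (t 0)\<^sup>2 * t 5 / 2"

definition gw_potential_quantum :: "nat \<Rightarrow> (nat \<Rightarrow> complex) \<Rightarrow> complex" where
  "gw_potential_quantum d t =
     (\<Sum>(n2, n3, n4, n5) | n2 + n3 + 2 * n4 + 3 * n5 = 4 * d + 1.
        of_nat (gw_number d (replicate n2 2 @ replicate n3 3 @ replicate n4 4 @ replicate n5 5))
        * (t 2 ^ n2 * t 3 ^ n3 * t 4 ^ n4 * t 5 ^ n5) / (fact n2 * fact n3 * fact n4 * fact n5))"

text \<open>The potential is the formal sum over \<open>d\<close> of these terms, the term for \<open>d\<close> being the part of
  energy \<open>d\<close>.\<close>

definition gw_potential_term :: "nat \<Rightarrow> (nat \<Rightarrow> complex) \<Rightarrow> complex" where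
  "gw_potential_term d t =
     (if d = 0 then gw_potential_classical t
      else gw_potential_quantum d t * exp (of_nat d * t 1))"

definition partial_deriv :: "nat \<Rightarrow> ((nat \<Rightarrow> complex) \<Rightarrow> complex) \<Rightarrow> (nat \<Rightarrow> complex) \<Rightarrow> complex" where
  "partial_deriv i f t = deriv (\<lambda>z. f (t(i := z))) (t i)"

text \<open>The coefficient of \<open>q ^ d\<close> in the third derivative of the potential after the substitution
  \<open>e ^ t 1 = q\<close>. The third derivatives of the term of energy \<open>d\<close> are \<open>e ^ (d * t 1)\<close> times a
  function independent of \<open>t 1\<close>, which is recovered at \<open>t 1 = 0\<close>.\<close>

definition gw_third_deriv :: "nat \<Rightarrow> nat \<Rightarrow> nat \<Rightarrow> nat \<Rightarrow> (nat \<Rightarrow> complex) \<Rightarrow> complex" where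
  "gw_third_deriv d i j e t =
     partial_deriv i (partial_deriv j (partial_deriv e (gw_potential_term d))) (t(1 := 0))"

text \<open>The intersection matrix, which is its own inverse.\<close>

definition intersection_form :: "nat \<Rightarrow> nat \<Rightarrow> complex" where
  "intersection_form e f =
     (if (e, f) \<in> {(0, 5), (5, 0), (1, 4), (4, 1), (2, 2), (3, 3)} then 1 else 0)"

text \<open>The coefficient of \<open>q ^ d\<close> in the coordinate \<open>f\<close> of the product of the classes \<open>i\<close> and \<open>j\<close>.\<close>

definition quantum_product :: "(nat \<Rightarrow> complex) \<Rightarrow> nat \<Rightarrow> nat \<Rightarrow> nat \<Rightarrow> nat \<Rightarrow> complex" where
  "quantum_product t d i j f = (\<Sum>e<6. gw_third_deriv d i j e t * intersection_form e f)"

section \<open>Dubrovin's operator\<close>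

definition dubrovin_class :: "(nat \<Rightarrow> complex) \<Rightarrow> nat \<Rightarrow> complex" where
  "dubrovin_class t i = [t 0, 4, - t 2, - t 3, - 2 * t 4, - 3 * t 5] ! i"

text \<open>The coefficient of \<open>q ^ d\<close> in the matrix of quantum multiplication by \<^const>\<open>dubrovin_class\<close>.\<close>

definition dubrovin_matrix :: "(nat \<Rightarrow> complex) \<Rightarrow> nat \<Rightarrow> complex mat" where
  "dubrovin_matrix t d =
     Matrix.mat 6 6 (\<lambda>(f, j). \<Sum>i<6. dubrovin_class t i * quantum_product t d i j f)"

definition truncated_dubrovin :: "real \<Rightarrow> (nat \<Rightarrow> complex) \<Rightarrow> complex novikov mat" where
  "truncated_dubrovin \<alpha> t =
     Matrix.mat 6 6 (\<lambda>(f, j). \<Sum>d | real d < \<alpha>. nov_monom (dubrovin_matrix t d $$ (f, j)) (real d))"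

text \<open>The coordinates of the bulk class \<open>t[X_l]\<close>.\<close>

definition bulk_class :: "complex \<Rightarrow> nat \<times> nat \<Rightarrow> nat \<Rightarrow> complex" where
  "bulk_class t l i = (if i < 6 \<and> young_diagram i = l then t else 0)"

text \<open>Algebraic multiplicity is meant. Over the Novikov field with complex coefficients, which is
  algebraically closed, this says that there are as many distinct eigenvalues as rows.\<close>

definition simple_spectrum :: "'a::field mat \<Rightarrow> bool" where
  "simple_spectrum A \<longleftrightarrow> (\<forall>x. eigenvalue A x \<longrightarrow> order x (char_poly A) = 1)"

end

theory Submission
  imports Defs "Subresultants.Subresultant_Gcd" "HOL-Computational_Algebra.Field_as_Ring"
begin

text \<open>
  Modulo \<open>q\<^sup>2\<close> only the Gromov-Witten numbers of degree 1 enter. A sphere of degree 1 in \<open>Gr(2,4)\<close> is a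
  line, i.e. a flag of a line and a hyperplane in \<open>\<complex>\<^sup>4\<close>, and incidence with a translate of a Schubert
  variety imposes linear conditions on the flag: the hyperplane has to contain points, the line has
  to lie in hyperplanes. For generic translates these conditions have no solution or exactly one, so
  all numbers are 0 or 1; genericity means that finitely many polynomials in the translating
  matrices do not vanish, and each of them is nonzero at some matrix of basis vectors.

  With these numbers the truncated operators are explicit matrices. For \<open>B = t[X\<^bsub>(2,1)\<^esub>]\<close> the
  characteristic polynomial is divisible by the square of the variable. In the other cases its
  coefficients are polynomials in \<open>q\<close>; its discriminant does not vanish for one complex value of \<open>q\<close>,
  hence is a nonzero polynomial in \<open>q\<close>, hence nonzero in the Novikov field.
\<close>

text \<open>The flags of a line in a hyperplane form a variety of dimension 5. A constraint
  \<open>2\<close> puts one condition on the hyperplane, \<open>3\<close> one on the line,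
  \<open>4\<close> one on each, and \<open>5\<close> two on each, one of which is shared through the
  incidence of the flag; so the exponents in degree 1 sum to exactly this dimension. The number is 0
  precisely when more than three conditions fall on the line or on the hyperplane alone. Marked
  points are distinct, so the planes at them must be shown to be distinct: general position is part
  of the count. As \<open>gw_number\<close> is a definite description, uniqueness of the generic
  value is needed as well; it rests on two dense open sets meeting. The discriminant avoids the
  eigenvalues, which are series in real powers of \<open>q\<close>: it only involves the
  coefficients of the characteristic polynomial, and it commutes with setting \<open>q\<close> to a
  number as long as degrees are kept.\<close>

no_notation Matrix.vec_index (infixl "$" 100)

section \<open>Linear algebra in dimension four\<close>

notation scalar_product (infixl "\<diamondop>" 75)

lemma scalar_product_add_right: "(x::'a::comm_semiring_1^'n) \<diamondop> (y + z) = x \<diamondop> y + x \<diamondop> z"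
  by (simp add: scalar_product_def distrib_left sum.distrib)

lemma scalar_product_scale_right: "(x::'a::comm_semiring_1^'n) \<diamondop> (c *s y) = c * (x \<diamondop> y)"
  by (simp add: scalar_product_def sum_distrib_left mult_ac)

text \<open>The pairing is bilinear, without complex conjugation. Its symmetry lets the same vectors
  serve as points and as equations, which is what projective duality amounts to below.\<close>

lemma scalar_product_commute: "(x::'a::comm_semiring_1^'n) \<diamondop> y = y \<diamondop> x"
  by (simp add: scalar_product_def mult.commute)

lemma scalar_product_zero_right [simp]: "(x::'a::comm_semiring_1^'n) \<diamondop> 0 = 0"
  by (simp add: scalar_product_def)

lemma scalar_product_zero_left [simp]: "0 \<diamondop> (x::'a::comm_semiring_1^'n) = 0"
  by (simp add: scalar_product_def)

lemma scalar_product_diff_right: "(x::'a::comm_ring_1^'n) \<diamondop> (y - z) = x \<diamondop> y - x \<diamondop> z"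
  by (simp add: scalar_product_def right_diff_distrib sum_subtractf)

lemma scalar_product_add_left: "((x::'a::comm_semiring_1^'n) + y) \<diamondop> z = x \<diamondop> z + y \<diamondop> z"
  by (simp add: scalar_product_def distrib_right sum.distrib)

lemma scalar_product_scale_left: "(c *s (x::'a::comm_semiring_1^'n)) \<diamondop> y = c * (x \<diamondop> y)"
  by (simp add: scalar_product_def sum_distrib_left mult_ac)

lemma scalar_product_diff_left: "((x::'a::comm_ring_1^'n) - y) \<diamondop> z = x \<diamondop> z - y \<diamondop> z"
  by (simp add: scalar_product_def left_diff_distrib sum_subtractf)

lemmas scalar_product_simps = scalar_product_diff_left scalar_product_add_right scalar_product_scale_right
  scalar_product_diff_right scalar_product_add_left scalar_product_scale_left

lemma scalar_product_nonzero:
  assumes "(x::'a::comm_semiring_1^'n) \<noteq> 0"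
  obtains y where "x \<diamondop> y \<noteq> 0"
proof -
  obtain i where "x $ i \<noteq> 0" using assms by (metis Finite_Cartesian_Product.vec_eq_iff Finite_Cartesian_Product.zero_index)
  moreover have "x \<diamondop> axis i 1 = x $ i"
    by (simp add: scalar_product_def axis_def if_distrib[of "(*) _"] cong: if_cong)
  ultimately show thesis using that by metis
qed

text \<open>Stated for tuples rather than as independence of a set: \<open>{x, x}\<close> collapses
  to a singleton, whereas a repeated vector has to count as dependent here.\<close>

definition indep2 :: "'a::field^'n \<Rightarrow> 'a^'n \<Rightarrow> bool" where
  "indep2 x y \<longleftrightarrow> (\<forall>a b. a *s x + b *s y = 0 \<longrightarrow> a = 0 \<and> b = 0)"

definition indep3 :: "'a::field^'n \<Rightarrow> 'a^'n \<Rightarrow> 'a^'n \<Rightarrow> bool" where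
  "indep3 x y z \<longleftrightarrow> (\<forall>a b c. a *s x + b *s y + c *s z = 0 \<longrightarrow> a = 0 \<and> b = 0 \<and> c = 0)"

lemma in_span2: "x \<in> vec.span {y, z} \<longleftrightarrow> (\<exists>a b. x = a *s y + b *s (z::'a::field^'n))"
  by (auto simp: vec.span_breakdown_eq algebra_simps diff_eq_eq)

lemma in_span1: "x \<in> vec.span {y} \<longleftrightarrow> (\<exists>a. x = a *s (y::'a::field^'n))"
  by (auto simp: vec.span_breakdown_eq)

lemma in_span3: "x \<in> vec.span {y, z, w} \<longleftrightarrow> (\<exists>a b c. x = a *s y + b *s z + c *s (w::'a::field^'n))"
  by (auto simp: vec.span_breakdown_eq algebra_simps diff_eq_eq)

lemma indep2_nonzero: assumes "indep2 x y" shows "x \<noteq> 0" "y \<noteq> 0"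
  using assms[unfolded indep2_def, rule_format, of 1 0] assms[unfolded indep2_def, rule_format, of 0 1] by auto

lemma indep2I:
  assumes "x \<noteq> 0" "y \<notin> vec.span {x}"
  shows "indep2 x y"
  unfolding indep2_def
proof (intro allI impI)
  fix a b assume ab: "a *s x + b *s y = 0"
  have b: "b = 0"
  proof (rule ccontr)
    assume b: "b \<noteq> 0"
    have "b *s y = (- a) *s x" using ab by (simp add: eq_neg_iff_add_eq_0 add.commute)
    hence "(1/b) *s (b *s y) = (1/b) *s ((- a) *s x)" by simp
    hence "y = (- a / b) *s x" using b by simp
    hence "y \<in> vec.span {x}" unfolding in_span1 by blast
    with assms(2) show False ..
  qed
  with ab assms(1) show "a = 0 \<and> b = 0" by simp
qed

lemma dim_indep2:
  assumes "indep2 x (y::'a::field^'n)" shows "vec.dim {x, y} = 2"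
proof -
  have "x \<notin> vec.span {y}"
  proof
    assume "x \<in> vec.span {y}"
    then obtain a where "x = a *s y" by (auto simp: in_span1)
    hence "1 *s x + (- a) *s y = 0" by simp
    with assms show False unfolding indep2_def by (metis one_neq_zero)
  qed
  thus ?thesis using indep2_nonzero[OF assms] by (simp add: vec.dim_insert)
qed

lemma indep3D:
  assumes "indep3 x y z"
  shows "indep2 x y" "indep2 x z" "indep2 y z" "x \<notin> vec.span {y, z}"
proof -
  have *: "a = 0 \<and> b = 0 \<and> c = 0" if "a *s x + b *s y + c *s z = 0" for a b c
    using assms that unfolding indep3_def by blast
  show "indep2 x y" using *[of _ _ 0] by (simp add: indep2_def)
  show "indep2 x z" using *[of _ 0 _] by (simp add: indep2_def)
  show "indep2 y z" using *[of 0] by (simp add: indep2_def)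
  show "x \<notin> vec.span {y, z}"
  proof
    assume "x \<in> vec.span {y, z}"
    then obtain a b where "x = a *s y + b *s z" by (auto simp: in_span2)
    hence "1 *s x + (- a) *s y + (- b) *s z = 0" by simp
    from *[OF this] show False by simp
  qed
qed

lemma dim_indep3:
  assumes "indep3 x y (z::'a::field^'n)" shows "vec.dim {x, y, z} = 3"
  using indep3D[OF assms] dim_indep2[of y z] by (simp add: vec.dim_insert)

section \<open>Planes and lines as points of the Grassmannian\<close>

lemma grassmannian_span2: "indep2 x y \<Longrightarrow> vec.span {x, y} \<in> grassmannian 2"
  by (simp add: grassmannian_def dim_indep2)

lemma grassmannian_subspace: "W \<in> grassmannian k \<Longrightarrow> vec.subspace W"
  by (simp add: grassmannian_def)

lemma grassmannian_lincomb:
  assumes "W \<in> grassmannian k" "x \<in> W" "y \<in> W"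
  shows "a *s x \<in> W" "a *s x + b *s y \<in> W"
  using assms by (auto simp: grassmannian_def vec.subspace_scale vec.subspace_add)

lemma grassmannian_eq_span2:
  assumes "W \<in> grassmannian 2" "x \<in> W" "y \<in> W" "indep2 x y"
  shows "W = vec.span {x, y}"
  by (rule sym, rule vec.subspace_dim_equal)
    (use assms in \<open>auto simp: grassmannian_def dim_indep2 vec.span_minimal\<close>)

lemma grassmannian_eqI:
  assumes "W \<in> grassmannian k" "W' \<in> grassmannian k" "W \<subseteq> W'"
  shows "W = W'"
  by (rule vec.subspace_dim_equal) (use assms in \<open>auto simp: grassmannian_def\<close>)

lemma grassmannian_not_indep3:
  assumes "W \<in> grassmannian 2" "x \<in> W" "y \<in> W" "z \<in> W"
  shows "\<not> indep3 x y z"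
proof
  assume i: "indep3 x y z"
  have "W = vec.span {y, z}"
    by (rule grassmannian_eq_span2) (use assms indep3D[OF i] in auto)
  thus False using indep3D(4)[OF i] assms by simp
qed

lemma grassmannian_extend:
  assumes "W \<in> grassmannian 2" "x \<in> W" "x \<noteq> 0"
  obtains y where "y \<in> W" "indep2 x y" "W = vec.span {x, y}"
proof -
  have "\<exists>y\<in>W. y \<notin> vec.span {x}"
  proof (rule ccontr)
    assume "\<not> ?thesis"
    hence "W \<subseteq> vec.span {x}" by blast
    hence "vec.dim W \<le> vec.dim (vec.span {x})" by (rule vec.dim_subset)
    also have "\<dots> = 1" using assms(3) by (simp add: vec.dim_insert)
    finally show False using assms(1) by (simp add: grassmannian_def)
  qed
  then obtain y where "y \<in> W" "y \<notin> vec.span {x}" by blast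
  with that[of y] indep2I[OF assms(3)] grassmannian_eq_span2[OF assms(1,2)] show thesis by blast
qed

lemma grassmannian_basis:
  assumes "W \<in> grassmannian 2"
  obtains x y where "indep2 x y" "W = vec.span {x, y}"
proof -
  have "\<exists>x\<in>W. x \<noteq> 0"
  proof (rule ccontr)
    assume "\<not> ?thesis"
    hence "vec.dim W = 0" unfolding vec.dim_eq_0 by blast
    moreover have "vec.dim W = 2" using assms by (simp add: grassmannian_def)
    ultimately show False by linarith
  qed
  thus thesis using grassmannian_extend[OF assms] that by blast
qed

lemma grassmannian_1: "L \<in> grassmannian 1 \<longleftrightarrow> (\<exists>w. w \<noteq> 0 \<and> L = vec.span {w})"
proof
  assume L: "L \<in> grassmannian 1"
  have "\<exists>w\<in>L. w \<noteq> 0"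
  proof (rule ccontr)
    assume "\<not> ?thesis"
    hence "vec.dim L = 0" unfolding vec.dim_eq_0 by blast
    moreover have "vec.dim L = 1" using L by (simp add: grassmannian_def)
    ultimately show False by linarith
  qed
  then obtain w where w: "w \<in> L" "w \<noteq> 0" by blast
  have "vec.span {w} = L"
    by (rule vec.subspace_dim_equal) (use L w in \<open>auto simp: grassmannian_def vec.dim_insert vec.span_minimal\<close>)
  thus "\<exists>w. w \<noteq> 0 \<and> L = vec.span {w}" using w by blast
qed (auto simp: grassmannian_def vec.dim_insert)

text \<open>Subtracting from \<open>x\<close> the multiple of \<open>s\<close> with the same value
  under \<open>\<phi>\<close> lands in the kernel, so \<open>s\<close> completes the kernel part to
  a generating set of \<open>S\<close>, and \<open>s\<close> itself lies outside it. Iterated, this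
  gives the dimensions of all intersections of kernels below.\<close>

lemma dim_inter_kernel:
  assumes S: "vec.subspace S" and s: "s \<in> S" "\<phi> \<diamondop> s \<noteq> 0"
  shows "vec.dim (S \<inter> {x. \<phi> \<diamondop> x = 0}) + 1 = vec.dim (S :: ('a::field^'n) set)"
proof -
  let ?K = "S \<inter> {x. \<phi> \<diamondop> x = 0}"
  have K: "vec.subspace ?K"
    using S by (auto simp: vec.subspace_def scalar_product_simps)
  have "S \<subseteq> vec.span (insert s ?K)"
  proof
    fix x assume x: "x \<in> S"
    have "\<phi> \<diamondop> (x - (\<phi> \<diamondop> x / \<phi> \<diamondop> s) *s s) = 0"
      using s(2) by (simp add: scalar_product_diff_right scalar_product_scale_right)
    moreover have "x - (\<phi> \<diamondop> x / \<phi> \<diamondop> s) *s s \<in> S"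
      by (intro vec.subspace_diff vec.subspace_scale S x s)
    ultimately have "x - (\<phi> \<diamondop> x / \<phi> \<diamondop> s) *s s \<in> ?K" by blast
    hence "x - (\<phi> \<diamondop> x / \<phi> \<diamondop> s) *s s \<in> vec.span ?K" by (rule vec.span_base)
    thus "x \<in> vec.span (insert s ?K)" unfolding vec.span_breakdown_eq ..
  qed
  moreover have "vec.span (insert s ?K) \<subseteq> S" using S s by (intro vec.span_minimal) auto
  ultimately have "S = vec.span (insert s ?K)" by (rule subset_antisym)
  hence "vec.dim S = vec.dim (insert s ?K)" using vec.dim_span by metis
  moreover have "vec.span ?K = ?K" using K by (rule vec.span_eq_iff[THEN iffD2])
  hence "s \<notin> vec.span ?K" using s(2) by blast
  hence "vec.dim (insert s ?K) = vec.dim ?K + 1" unfolding vec.dim_insert by (rule if_not_P)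
  ultimately show ?thesis by linarith
qed

lemma dim_kernel1:
  assumes "(\<psi>::'a::field^'n) \<noteq> 0" shows "vec.dim {x. \<psi> \<diamondop> x = 0} + 1 = CARD('n)"
proof -
  obtain s where "\<psi> \<diamondop> s \<noteq> 0" using scalar_product_nonzero[OF assms] .
  hence "vec.dim (UNIV \<inter> {x. \<psi> \<diamondop> x = 0}) + 1 = vec.dim (UNIV :: ('a^'n) set)"
    by (rule dim_inter_kernel[OF vec.subspace_UNIV UNIV_I])
  thus ?thesis unfolding vec_dim_card Int_UNIV_left .
qed

lemma subspace_kernel1: "vec.subspace {x. \<psi> \<diamondop> (x::'a::field^'n) = 0}"
  by (auto simp: vec.subspace_def scalar_product_simps)

lemma subspace_kernel2: "vec.subspace {x. \<psi> \<diamondop> x = 0 \<and> \<phi> \<diamondop> (x::'a::field^'n) = 0}"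
  by (auto simp: vec.subspace_def scalar_product_simps)

lemma kernel_multiple:
  assumes "(\<psi>::'a::field^'n) \<noteq> 0" and "\<And>t. \<psi> \<diamondop> t = 0 \<Longrightarrow> \<phi> \<diamondop> t = 0"
  obtains c where "\<phi> = c *s \<psi>"
proof -
  obtain s where s: "\<psi> \<diamondop> s \<noteq> 0" using scalar_product_nonzero[OF assms(1)] .
  define c where "c = \<phi> \<diamondop> s / \<psi> \<diamondop> s"
  have "(\<phi> - c *s \<psi>) \<diamondop> y = 0" for y
  proof -
    have "\<psi> \<diamondop> (y - (\<psi> \<diamondop> y / \<psi> \<diamondop> s) *s s) = 0"
      using s by (simp add: scalar_product_diff_right scalar_product_scale_right)
    hence "\<phi> \<diamondop> (y - (\<psi> \<diamondop> y / \<psi> \<diamondop> s) *s s) = 0" by (rule assms(2))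
    thus ?thesis
      by (simp add: c_def scalar_product_diff_right scalar_product_scale_right
          scalar_product_diff_left scalar_product_scale_left)
  qed
  hence "\<phi> - c *s \<psi> = 0" using scalar_product_nonzero by blast
  thus thesis using that[of c] by simp
qed

lemma indep2_separate:
  assumes "indep2 \<psi> (\<phi>::'a::field^'n)"
  obtains t where "\<psi> \<diamondop> t = 0" "\<phi> \<diamondop> t \<noteq> 0"
proof -
  have "\<exists>t. \<psi> \<diamondop> t = 0 \<and> \<phi> \<diamondop> t \<noteq> 0"
  proof (rule ccontr)
    assume "\<not> ?thesis"
    then obtain c where "\<phi> = c *s \<psi>" using kernel_multiple[OF indep2_nonzero(1)[OF assms]] by blast
    hence "(- c) *s \<psi> + 1 *s \<phi> = 0" by simp
    with assms show False unfolding indep2_def by (metis one_neq_zero)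
  qed
  thus thesis using that by blast
qed

text \<open>Otherwise, correcting by a vector \<open>r\<close> on which only \<open>\<theta>\<close>
  is nonzero shows that \<open>\<psi> - b *s \<theta>\<close> vanishes wherever
  \<open>\<phi>\<close> does, hence is a multiple of \<open>\<phi>\<close>.\<close>

lemma indep3_separate:
  assumes "indep3 \<psi> \<phi> (\<theta>::'a::field^'n)"
  obtains t where "\<phi> \<diamondop> t = 0" "\<theta> \<diamondop> t = 0" "\<psi> \<diamondop> t \<noteq> 0"
proof -
  have "\<exists>t. \<phi> \<diamondop> t = 0 \<and> \<theta> \<diamondop> t = 0 \<and> \<psi> \<diamondop> t \<noteq> 0"
  proof (rule ccontr)
    assume no: "\<not> ?thesis"
    obtain r where r: "\<phi> \<diamondop> r = 0" "\<theta> \<diamondop> r \<noteq> 0" using indep2_separate[OF indep3D(3)[OF assms]] .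
    define b where "b = \<psi> \<diamondop> r / \<theta> \<diamondop> r"
    have "(\<psi> - b *s \<theta>) \<diamondop> t = 0" if t: "\<phi> \<diamondop> t = 0" for t
    proof -
      let ?z = "t - (\<theta> \<diamondop> t / \<theta> \<diamondop> r) *s r"
      have "\<phi> \<diamondop> ?z = 0" using t r by (simp add: scalar_product_diff_right scalar_product_scale_right)
      moreover have "\<theta> \<diamondop> ?z = 0" using r by (simp add: scalar_product_diff_right scalar_product_scale_right)
      ultimately have "\<psi> \<diamondop> ?z = 0" using no by blast
      thus ?thesis
        by (simp add: b_def scalar_product_diff_right scalar_product_scale_right
            scalar_product_diff_left scalar_product_scale_left)
    qed
    then obtain a where "\<psi> - b *s \<theta> = a *s \<phi>"
      using kernel_multiple[OF indep2_nonzero(1)[OF indep3D(3)[OF assms]]] by blast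
    hence "1 *s \<psi> + (- a) *s \<phi> + (- b) *s \<theta> = 0" by (simp add: algebra_simps)
    with assms show False unfolding indep3_def by (metis one_neq_zero)
  qed
  thus thesis using that by blast
qed

lemma dim_kernel2:
  assumes "indep2 \<psi> (\<phi>::'a::field^'n)"
  shows "vec.dim {x. \<psi> \<diamondop> x = 0 \<and> \<phi> \<diamondop> x = 0} + 2 = CARD('n)"
proof -
  obtain t where t: "\<psi> \<diamondop> t = 0" "\<phi> \<diamondop> t \<noteq> 0" using indep2_separate[OF assms] .
  have "vec.dim ({x. \<psi> \<diamondop> x = 0} \<inter> {x. \<phi> \<diamondop> x = 0}) + 1 = vec.dim {x. \<psi> \<diamondop> x = 0}"
    by (rule dim_inter_kernel[OF subspace_kernel1 CollectI]) (fact t)+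
  hence "vec.dim {x. \<psi> \<diamondop> x = 0 \<and> \<phi> \<diamondop> x = 0} + 1 = vec.dim {x. \<psi> \<diamondop> x = 0}"
    unfolding Collect_conj_eq .
  thus ?thesis using dim_kernel1[OF indep2_nonzero(1)[OF assms]] by linarith
qed

lemma dim_kernel3:
  assumes "indep3 \<psi> \<phi> (\<theta>::'a::field^'n)"
  shows "vec.dim {x. \<psi> \<diamondop> x = 0 \<and> \<phi> \<diamondop> x = 0 \<and> \<theta> \<diamondop> x = 0} + 3 = CARD('n)"
proof -
  obtain t where t: "\<phi> \<diamondop> t = 0" "\<theta> \<diamondop> t = 0" "\<psi> \<diamondop> t \<noteq> 0" using indep3_separate[OF assms] .
  have "vec.dim ({x. \<phi> \<diamondop> x = 0 \<and> \<theta> \<diamondop> x = 0} \<inter> {x. \<psi> \<diamondop> x = 0}) + 1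
      = vec.dim {x. \<phi> \<diamondop> x = 0 \<and> \<theta> \<diamondop> x = 0}"
    by (rule dim_inter_kernel[OF subspace_kernel2, of t]) (use t in auto)
  moreover have "{x. \<phi> \<diamondop> x = 0 \<and> \<theta> \<diamondop> x = 0} \<inter> {x. \<psi> \<diamondop> x = 0}
      = {x. \<psi> \<diamondop> x = 0 \<and> \<phi> \<diamondop> x = 0 \<and> \<theta> \<diamondop> x = 0}" by blast
  ultimately have "vec.dim {x. \<psi> \<diamondop> x = 0 \<and> \<phi> \<diamondop> x = 0 \<and> \<theta> \<diamondop> x = 0} + 1
      = vec.dim {x. \<phi> \<diamondop> x = 0 \<and> \<theta> \<diamondop> x = 0}" by (simp only:)
  thus ?thesis using dim_kernel2[OF indep3D(3)[OF assms]] by linarith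
qed

lemma kernel3_line:
  assumes "indep3 \<psi> \<phi> (\<theta>::'a::field^4)"
  obtains v where "v \<noteq> 0" "\<psi> \<diamondop> v = 0" "\<phi> \<diamondop> v = 0" "\<theta> \<diamondop> v = 0"
    "\<And>x. \<psi> \<diamondop> x = 0 \<Longrightarrow> \<phi> \<diamondop> x = 0 \<Longrightarrow> \<theta> \<diamondop> x = 0 \<Longrightarrow> x \<in> vec.span {v}"
proof -
  let ?K = "{x. \<psi> \<diamondop> x = 0 \<and> \<phi> \<diamondop> x = 0 \<and> \<theta> \<diamondop> x = 0}"
  have K: "vec.subspace ?K" by (auto simp: vec.subspace_def scalar_product_simps)
  have d: "vec.dim ?K = 1" using dim_kernel3[OF assms] by simp
  have "\<exists>v\<in>?K. v \<noteq> 0"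
  proof (rule ccontr)
    assume "\<not> ?thesis"
    hence "vec.dim ?K = 0" unfolding vec.dim_eq_0 by blast
    with d show False by linarith
  qed
  then obtain v where v: "v \<in> ?K" "v \<noteq> 0" by blast
  have "vec.span {v} = ?K"
    by (rule vec.subspace_dim_equal) (use K d v in \<open>auto simp: vec.dim_insert vec.span_minimal simp del: mem_Collect_eq\<close>)
  thus thesis using that[of v] v by blast
qed

lemma kernel2_grassmannian:
  assumes "indep2 \<psi> (\<phi>::complex^4)"
  shows "{x. \<psi> \<diamondop> x = 0 \<and> \<phi> \<diamondop> x = 0} \<in> grassmannian 2"
  using dim_kernel2[OF assms] subspace_kernel2 by (auto simp: grassmannian_def)

lemma grassmannian_eq_kernel2:
  assumes "W \<in> grassmannian 2" "indep2 \<psi> (\<phi>::complex^4)" "\<forall>w\<in>W. \<psi> \<diamondop> w = 0" "\<forall>w\<in>W. \<phi> \<diamondop> w = 0"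
  shows "W = {x. \<psi> \<diamondop> x = 0 \<and> \<phi> \<diamondop> x = 0}"
  by (rule grassmannian_eqI[OF assms(1) kernel2_grassmannian]) (use assms in auto)

lemma grassmannian_not_annihilated3:
  assumes "W \<in> grassmannian 2" "\<forall>w\<in>W. (\<psi>::complex^4) \<diamondop> w = 0" "\<forall>w\<in>W. \<phi> \<diamondop> w = 0" "\<forall>w\<in>W. \<theta> \<diamondop> w = 0"
  shows "\<not> indep3 \<psi> \<phi> \<theta>"
proof
  assume "indep3 \<psi> \<phi> \<theta>"
  from dim_kernel3[OF this] have "vec.dim {x. \<psi> \<diamondop> x = 0 \<and> \<phi> \<diamondop> x = 0 \<and> \<theta> \<diamondop> x = 0} = 1" by simp
  moreover have "vec.dim W \<le> vec.dim {x. \<psi> \<diamondop> x = 0 \<and> \<phi> \<diamondop> x = 0 \<and> \<theta> \<diamondop> x = 0}"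
    using assms by (intro vec.dim_subset) auto
  ultimately show False using assms(1) by (simp add: grassmannian_def)
qed

text \<open>The determinant in its Laplace expansion by 2 x 2 minors. In this form it visibly
  depends on the planes of \<open>x\<close>, \<open>y\<close> and of \<open>z\<close>,
  \<open>w\<close> only through their Pluecker coordinates.\<close>

definition det4 :: "'a::comm_ring_1^4 \<Rightarrow> 'a^4 \<Rightarrow> 'a^4 \<Rightarrow> 'a^4 \<Rightarrow> 'a" where
  "det4 x y z w =
     (x$1 * y$2 - x$2 * y$1) * (z$3 * w$4 - z$4 * w$3) - (x$1 * y$3 - x$3 * y$1) * (z$2 * w$4 - z$4 * w$2)
   + (x$1 * y$4 - x$4 * y$1) * (z$2 * w$3 - z$3 * w$2) + (x$2 * y$3 - x$3 * y$2) * (z$1 * w$4 - z$4 * w$1)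
   - (x$2 * y$4 - x$4 * y$2) * (z$1 * w$3 - z$3 * w$1) + (x$3 * y$4 - x$4 * y$3) * (z$1 * w$2 - z$2 * w$1)"

text \<open>The coefficients of \<open>det4 x y z\<close> as a linear form: the equation of the
  hyperplane through three vectors, polynomial in their coordinates.\<close>

definition cross4 :: "'a::comm_ring_1^4 \<Rightarrow> 'a^4 \<Rightarrow> 'a^4 \<Rightarrow> 'a^4" where
  "cross4 x y z = (\<chi> i. det4 x y z (axis i 1))"

lemma axis_4_components:
  "axis i (1::'a::comm_ring_1) $ j = (if i = j then 1 else 0)" for i j :: 4
  by (simp add: axis_def)

lemma scalar_product_4: "x \<diamondop> y = x$1*y$1 + x$2*y$2 + x$3*y$3 + x$4*(y::'a::comm_ring_1^4)$4"
  by (simp add: scalar_product_def sum_4)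

lemma cross4_scalar_product: "cross4 x y z \<diamondop> w = det4 x y z w"
  by (simp add: cross4_def det4_def scalar_product_4 axis_4_components algebra_simps)

lemma cross4_orthogonal [simp]:
  "cross4 x y z \<diamondop> x = 0" "cross4 x y z \<diamondop> y = 0" "cross4 x y z \<diamondop> z = 0"
  by (simp_all add: cross4_scalar_product det4_def algebra_simps)

text \<open>Cramer's rule for the matrix with rows \<open>a\<close>, \<open>b\<close>,
  \<open>c\<close>, \<open>d\<close>: replacing a row by the \<open>i\<close>-th unit vector gives
  its cofactor.\<close>

lemma det4_cramer:
  "det4 a b c d * x $ i = (a \<diamondop> x) * det4 (axis i 1) b c d + (b \<diamondop> x) * det4 a (axis i 1) c d
     + (c \<diamondop> x) * det4 a b (axis i 1) d + (d \<diamondop> x) * det4 a b c (axis i 1)"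
  using exhaust_4[of i] unfolding det4_def scalar_product_4
  by (elim disjE) (simp_all add: axis_4_components algebra_simps)

lemma det4_nonzero_kernel:
  assumes "det4 a b c d \<noteq> 0" "a \<diamondop> x = 0" "b \<diamondop> x = 0" "c \<diamondop> x = 0" "d \<diamondop> x = 0"
  shows "x = (0::'a::field^4)"
proof -
  have "det4 a b c d * x $ i = 0" for i using assms by (simp add: det4_cramer)
  with assms(1) show ?thesis by (simp add: Finite_Cartesian_Product.vec_eq_iff)
qed

lemma det4_nonzero_indep3:
  assumes "det4 a b c d \<noteq> 0" shows "indep3 a b (c::'a::field^4)"
  unfolding indep3_def
proof (intro allI impI)
  fix \<alpha> \<beta> \<gamma> assume 0: "\<alpha> *s a + \<beta> *s b + \<gamma> *s c = 0"
  have "\<alpha> * det4 a b c d = det4 (\<alpha> *s a + \<beta> *s b + \<gamma> *s c) b c d"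
    "\<beta> * det4 a b c d = det4 a (\<alpha> *s a + \<beta> *s b + \<gamma> *s c) c d"
    "\<gamma> * det4 a b c d = det4 a b (\<alpha> *s a + \<beta> *s b + \<gamma> *s c) d"
    by (simp_all add: det4_def algebra_simps)
  hence "\<alpha> * det4 a b c d = 0" "\<beta> * det4 a b c d = 0" "\<gamma> * det4 a b c d = 0"
    unfolding 0 by (simp_all add: det4_def)
  with assms show "\<alpha> = 0 \<and> \<beta> = 0 \<and> \<gamma> = 0" by simp
qed

lemma indep2_wedge:
  assumes "indep2 x (y::'a::field^'n)"
  obtains i j where "x $ i * y $ j - x $ j * y $ i \<noteq> 0"
proof -
  have "\<exists>i j. x $ i * y $ j - x $ j * y $ i \<noteq> 0"
  proof (rule ccontr)
    assume no: "\<not> ?thesis"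
    obtain i where i: "x $ i \<noteq> 0" using indep2_nonzero(1)[OF assms] by (auto simp: Finite_Cartesian_Product.vec_eq_iff)
    have "(- y $ i) *s x + x $ i *s y = 0" using no by (auto simp: Finite_Cartesian_Product.vec_eq_iff algebra_simps)
    with assms i show False unfolding indep2_def by blast
  qed
  thus thesis using that by blast
qed

text \<open>If all 3 x 3 minors vanish, expanding those in the coordinates \<open>i\<close>,
  \<open>j\<close> and a varying \<open>k\<close> yields a linear relation in which \<open>z\<close>
  has a nonzero 2 x 2 minor of \<open>x\<close>, \<open>y\<close> as coefficient.\<close>

lemma indep3_cross4:
  assumes "indep3 x y (z::'a::field^4)" shows "cross4 x y z \<noteq> 0"
proof
  assume 0: "cross4 x y z = 0"
  have "det4 x y z (axis i 1) = 0" for i using arg_cong[OF 0, of "\<lambda>v. v $ i"] by (simp add: cross4_def)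
  note m = this[of 1] this[of 2] this[of 3] this[of 4]
  have m: "x$i * (y$j * z$k - y$k * z$j) - x$j * (y$i * z$k - y$k * z$i) + x$k * (y$i * z$j - y$j * z$i) = 0"
    for i j k
    using exhaust_4[of i] exhaust_4[of j] exhaust_4[of k] m unfolding det4_def
    by (elim disjE; simp add: axis_4_components algebra_simps)
  obtain i j where ij: "x $ i * y $ j - x $ j * y $ i \<noteq> 0" using indep2_wedge[OF indep3D(1)[OF assms]] .
  have "(y$i * z$j - y$j * z$i) *s x + (- (x$i * z$j - x$j * z$i)) *s y + (x $ i * y $ j - x $ j * y $ i) *s z = 0"
    unfolding Finite_Cartesian_Product.vec_eq_iff
  proof
    fix k show "((y$i * z$j - y$j * z$i) *s x + (- (x$i * z$j - x$j * z$i)) *s y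
        + (x $ i * y $ j - x $ j * y $ i) *s z) $ k = 0 $ k"
      using m[of i j k] by (simp add: algebra_simps)
  qed
  with assms ij show False unfolding indep3_def by blast
qed

lemma span3_eq_kernel:
  assumes "indep3 x y z" "\<psi> \<noteq> 0" "\<psi> \<diamondop> x = 0" "\<psi> \<diamondop> y = 0" "\<psi> \<diamondop> z = 0"
  shows "vec.span {x, y, z} = {w. (\<psi>::'a::field^4) \<diamondop> w = 0}"
proof (rule vec.subspace_dim_equal)
  have "{x, y, z} \<subseteq> {w. \<psi> \<diamondop> w = 0}"
    by (intro insert_subsetI empty_subsetI CollectI assms)
  thus "vec.span {x, y, z} \<subseteq> {w. \<psi> \<diamondop> w = 0}"
    by (rule vec.span_minimal[OF _ subspace_kernel1])
  have "vec.dim {w. \<psi> \<diamondop> w = 0} + 1 = 4" using dim_kernel1[OF assms(2)] by simp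
  thus "vec.dim {w. \<psi> \<diamondop> w = 0} \<le> vec.dim (vec.span {x, y, z})"
    unfolding vec.dim_span dim_indep3[OF assms(1)] by linarith
qed (rule vec.subspace_span subspace_kernel1)+

text \<open>Proportional Pluecker coordinates belong to equal planes. Cramer's rule in two
  coordinates with a nonzero minor suggests the combination of \<open>x\<close> and
  \<open>y\<close>; it is correct in every coordinate \<open>k\<close> because, after replacing the
  minors by those of \<open>x'\<close>, \<open>y'\<close>, the difference is a 3 x 3 determinant
  with a repeated row.\<close>

lemma wedge_span:
  assumes "indep2 x (y::'a::field^'n)"
    and w: "\<And>i j. x $ i * y $ j - x $ j * y $ i = c * (x' $ i * y' $ j - x' $ j * y' $ i)"
  shows "x' \<in> vec.span {x, y}" "y' \<in> vec.span {x, y}"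
proof -
  obtain i j where ij: "x $ i * y $ j - x $ j * y $ i \<noteq> 0" using indep2_wedge[OF assms(1)] .
  have *: "r \<in> vec.span {x, y}"
    if r: "\<And>k. r $ k * (x $ i * y $ j - x $ j * y $ i)
          = (r $ i * y $ j - r $ j * y $ i) * x $ k + (r $ j * x $ i - r $ i * x $ j) * y $ k" for r
  proof -
    have "r = ((r $ i * y $ j - r $ j * y $ i) / (x $ i * y $ j - x $ j * y $ i)) *s x
        + ((r $ j * x $ i - r $ i * x $ j) / (x $ i * y $ j - x $ j * y $ i)) *s y"
      unfolding Finite_Cartesian_Product.vec_eq_iff
    proof
      fix k
      show "r $ k = (((r $ i * y $ j - r $ j * y $ i) / (x $ i * y $ j - x $ j * y $ i)) *s x
        + ((r $ j * x $ i - r $ i * x $ j) / (x $ i * y $ j - x $ j * y $ i)) *s y) $ k"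
        using r[of k] ij by (simp add: divide_simps)
    qed
    thus ?thesis unfolding in_span2 by blast
  qed
  show "x' \<in> vec.span {x, y}"
  proof (rule *)
    fix k
    have "(x' $ i * y $ j - x' $ j * y $ i) * x $ k + (x' $ j * x $ i - x' $ i * x $ j) * y $ k
        = x' $ i * (x $ k * y $ j - x $ j * y $ k) + x' $ j * (x $ i * y $ k - x $ k * y $ i)"
      by (simp add: algebra_simps)
    also have "\<dots> = x' $ k * (x $ i * y $ j - x $ j * y $ i)"
      unfolding w by (simp add: algebra_simps)
    finally show "x' $ k * (x $ i * y $ j - x $ j * y $ i)
          = (x' $ i * y $ j - x' $ j * y $ i) * x $ k + (x' $ j * x $ i - x' $ i * x $ j) * y $ k" ..
  qed
  show "y' \<in> vec.span {x, y}"
  proof (rule *)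
    fix k
    have "(y' $ i * y $ j - y' $ j * y $ i) * x $ k + (y' $ j * x $ i - y' $ i * x $ j) * y $ k
        = y' $ i * (x $ k * y $ j - x $ j * y $ k) + y' $ j * (x $ i * y $ k - x $ k * y $ i)"
      by (simp add: algebra_simps)
    also have "\<dots> = y' $ k * (x $ i * y $ j - x $ j * y $ i)"
      unfolding w by (simp add: algebra_simps)
    finally show "y' $ k * (x $ i * y $ j - x $ j * y $ i)
          = (y' $ i * y $ j - y' $ j * y $ i) * x $ k + (y' $ j * x $ i - y' $ i * x $ j) * y $ k" ..
  qed
qed

section \<open>Spheres of degree one are lines in the Grassmannian\<close>

lemma indep3I:
  assumes "indep2 x (y::'a::field^'n)" "z \<notin> vec.span {x, y}"
  shows "indep3 x y z"
  unfolding indep3_def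
proof (intro allI impI)
  fix a b c assume 0: "a *s x + b *s y + c *s z = 0"
  have c: "c = 0"
  proof (rule ccontr)
    assume c: "c \<noteq> 0"
    have "c *s z = (- a) *s x + (- b) *s y" using 0 by (simp add: eq_neg_iff_add_eq_0 algebra_simps)
    hence "(1/c) *s (c *s z) = (1/c) *s ((- a) *s x + (- b) *s y)" by simp
    hence "z = (- a / c) *s x + (- b / c) *s y" using c by (simp add: vec.scale_right_diff_distrib)
    hence "z \<in> vec.span {x, y}" unfolding in_span2 by blast
    with assms(2) show False ..
  qed
  with 0 assms(1) show "a = 0 \<and> b = 0 \<and> c = 0" unfolding indep2_def by simp
qed

text \<open>Either \<open>x'\<close> already lies in the first plane, or \<open>y'\<close> lies in
  the hyperplane through \<open>x\<close>, \<open>y\<close>, \<open>x'\<close>. In the latter case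
  moving the term in \<open>x'\<close> to the other side gives a common vector, nonzero since
  \<open>y'\<close> enters with coefficient 1.\<close>

lemma planes_meet:
  assumes "det4 x y x' y' = 0" "indep2 x y" "indep2 x' (y'::'a::field^4)"
  obtains e where "e \<noteq> 0" "e \<in> vec.span {x, y}" "e \<in> vec.span {x', y'}"
proof (cases "indep3 x y x'")
  case True
  have "vec.span {x, y, x'} = {w. cross4 x y x' \<diamondop> w = 0}"
    by (rule span3_eq_kernel[OF True indep3_cross4[OF True]]) simp_all
  moreover have "cross4 x y x' \<diamondop> y' = 0" using assms(1) by (simp add: cross4_scalar_product)
  ultimately have "y' \<in> vec.span {x, y, x'}" by blast
  then obtain a b c where y': "y' = a *s x + b *s y + c *s x'" unfolding in_span3 by blast
  show thesis
  proof (rule that)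
    show "a *s x + b *s y \<in> vec.span {x, y}" unfolding in_span2 by blast
    have e: "a *s x + b *s y = (- c) *s x' + 1 *s y'" by (simp add: y')
    show "a *s x + b *s y \<in> vec.span {x', y'}" unfolding e in_span2 by blast
    show "a *s x + b *s y \<noteq> 0" unfolding e using assms(3) unfolding indep2_def by (metis one_neq_zero)
  qed
next
  case False
  hence "x' \<in> vec.span {x, y}" using indep3I[OF assms(2)] by blast
  moreover have "x' \<in> vec.span {x', y'}" by (simp add: vec.span_base)
  ultimately show thesis using that indep2_nonzero(1)[OF assms(3)] by blast
qed

text \<open>The pencil of planes between the line of \<open>e\<close> and the hyperplane of
  \<open>e\<close>, \<open>f\<close>, \<open>g\<close>, parametrized by the projective line. It is
  the normal form of a sphere of degree 1.\<close>

definition line_map :: "complex^4 \<Rightarrow> complex^4 \<Rightarrow> complex^4 \<Rightarrow> complex^2 \<Rightarrow> (complex^4) set" where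
  "line_map e f g w = vec.span {e, w$1 *s f + w$2 *s g}"

lemma vec2_nonzero: "(w::'a::zero^2) \<noteq> 0 \<longleftrightarrow> w$1 \<noteq> 0 \<or> w$2 \<noteq> 0"
  by (simp add: Finite_Cartesian_Product.vec_eq_iff forall_2)

lemma indep2_line_map:
  assumes "indep3 e f (g::complex^4)" "(w::complex^2) \<noteq> 0"
  shows "indep2 e (w$1 *s f + w$2 *s g)"
  unfolding indep2_def
proof (intro allI impI)
  fix a b assume "a *s e + b *s (w$1 *s f + w$2 *s g) = 0"
  hence "a *s e + (b * w$1) *s f + (b * w$2) *s g = 0"
    by (simp add: vec.scale_right_distrib add.assoc)
  hence "a = 0 \<and> b * w$1 = 0 \<and> b * w$2 = 0" using assms(1) unfolding indep3_def by blast
  thus "a = 0 \<and> b = 0" using assms(2) by (auto simp: vec2_nonzero)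
qed

lemma line_map_grassmannian:
  "indep3 e f g \<Longrightarrow> w \<noteq> 0 \<Longrightarrow> line_map e f g w \<in> grassmannian 2"
  unfolding line_map_def by (rule grassmannian_span2) (rule indep2_line_map)

lemma line_map_contains: "e \<in> line_map e f g w" "w$1 *s f + w$2 *s g \<in> line_map e f g w"
  by (simp_all add: line_map_def vec.span_base)

lemma line_map_annihilated:
  assumes "\<psi> \<diamondop> e = 0" "\<psi> \<diamondop> f = 0" "\<psi> \<diamondop> g = 0" "x \<in> line_map e f g w"
  shows "\<psi> \<diamondop> x = 0"
  using assms unfolding line_map_def in_span2 by (auto simp: scalar_product_simps)

lemma line_map_eq:
  assumes "W \<in> grassmannian 2" "e \<in> W" "w$1 *s f + w$2 *s g \<in> W" "indep3 e f g" "w \<noteq> 0"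
  shows "W = line_map e f g w"
  unfolding line_map_def by (rule grassmannian_eq_span2) (use assms indep2_line_map in auto)

lemma line_map_onto:
  assumes "indep3 e f g" "\<psi> \<noteq> 0" "\<psi> \<diamondop> e = 0" "\<psi> \<diamondop> f = 0" "\<psi> \<diamondop> g = 0"
    and W: "W \<in> grassmannian 2" "e \<in> W" "\<forall>w\<in>W. \<psi> \<diamondop> w = 0"
  obtains w where "w \<noteq> 0" "W = line_map e f g w"
proof -
  have e: "e \<noteq> 0" using indep2_nonzero indep3D(1)[OF assms(1)] by blast
  obtain y where y: "y \<in> W" "indep2 e y" using grassmannian_extend[OF W(1,2) e] by blast
  have "y \<in> vec.span {e, f, g}" using span3_eq_kernel[OF assms(1-5)] y(1) W(3) by blast
  then obtain a b c where abc: "y = a *s e + b *s f + c *s g" unfolding in_span3 by blast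
  define w :: "complex^2" where "w = (\<chi> i. if i = 1 then b else c)"
  have w: "w$1 = b" "w$2 = c" by (simp_all add: w_def)
  have "w \<noteq> 0"
  proof
    assume "w = 0"
    hence "b = 0" "c = 0" using w by simp_all
    hence "(- a) *s e + 1 *s y = 0" using abc by simp
    thus False using y(2) unfolding indep2_def by (metis one_neq_zero)
  qed
  moreover have "w$1 *s f + w$2 *s g = (- a) *s e + 1 *s y" by (simp add: w abc)
  hence "w$1 *s f + w$2 *s g \<in> W" using grassmannian_lincomb(2)[OF W(1,2) y(1)] by metis
  ultimately show thesis using that line_map_eq[OF W(1,2) _ assms(1)] by blast
qed

lemma span_singleton_eq:
  assumes "k \<noteq> 0" shows "vec.span {k *s w} = vec.span {w :: 'a::field^'n}"
proof -
  have "x \<in> vec.span {k *s w} \<longleftrightarrow> x \<in> vec.span {w}" for x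
  proof
    assume "x \<in> vec.span {w}"
    then obtain a where "x = a *s w" unfolding in_span1 by blast
    hence "x = (a / k) *s (k *s w)" using assms by simp
    thus "x \<in> vec.span {k *s w}" unfolding in_span1 by blast
  qed (auto simp: in_span1)
  thus ?thesis by blast
qed

lemma line_map_inj:
  assumes "indep3 e f g" "w \<noteq> 0" "w' \<noteq> 0" "line_map e f g w = line_map e f g w'"
  shows "vec.span {w} = vec.span {w'}"
proof -
  have "w'$1 *s f + w'$2 *s g \<in> line_map e f g w" using assms(4) line_map_contains by blast
  then obtain a k where ak: "w'$1 *s f + w'$2 *s g = a *s e + k *s (w$1 *s f + w$2 *s g)"
    unfolding line_map_def in_span2 by blast
  have "(- a) *s e + (w'$1 - k * w$1) *s f + (w'$2 - k * w$2) *s g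
      = (w'$1 *s f + w'$2 *s g) - (a *s e + k *s (w$1 *s f + w$2 *s g))"
    by (simp add: vec.scale_left_diff_distrib vec.scale_right_distrib)
  hence "(- a) *s e + (w'$1 - k * w$1) *s f + (w'$2 - k * w$2) *s g = 0" unfolding ak by simp
  hence "w'$1 = k * w$1" "w'$2 = k * w$2" using assms(1) unfolding indep3_def by fastforce+
  hence w': "w' = k *s w" by (simp add: Finite_Cartesian_Product.vec_eq_iff forall_2)
  with assms(3) have "k \<noteq> 0" by auto
  thus ?thesis using w' span_singleton_eq by metis
qed

lemma span_singleton_multiple:
  assumes "vec.span {w} = vec.span {w' :: 'a::field^'n}"
  obtains k where "w' = k *s w"
proof -
  have "w' \<in> vec.span {w}" unfolding assms by (simp add: vec.span_base)
  thus thesis using that unfolding in_span1 by blast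
qed

lemma line_map_cong:
  assumes "indep3 e f g" "w \<noteq> 0" "w' \<noteq> 0" "vec.span {w} = vec.span {w'}"
  shows "line_map e f g w = line_map e f g w'"
proof (rule line_map_eq[OF line_map_grassmannian[OF assms(1,2)] line_map_contains(1) _ assms(1,3)])
  obtain k where "w' = k *s w" using span_singleton_multiple[OF assms(4)] .
  hence "w'$1 *s f + w'$2 *s g = 0 *s e + k *s (w$1 *s f + w$2 *s g)"
    by (simp add: vec.scale_right_distrib)
  thus "w'$1 *s f + w'$2 *s g \<in> line_map e f g w" unfolding line_map_def in_span2 by blast
qed

lemma sphere_maps_1_line:
  assumes efg: "indep3 e f g"
  obtains u where "u \<in> sphere_maps 1" "\<And>w. w \<noteq> 0 \<Longrightarrow> u (vec.span {w}) = line_map e f g w"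
proof -
  \<comment> \<open>A representative of \<open>L\<close> is chosen; by \<open>line_map_cong\<close>
    the plane does not depend on the choice.\<close>
  define u where "u = (\<lambda>L\<in>grassmannian 1. line_map e f g (SOME w. w \<noteq> 0 \<and> L = vec.span {w}))"
  have u: "u (vec.span {w}) = line_map e f g w" if w: "w \<noteq> 0" for w
  proof -
    define w' where "w' = (SOME w'. w' \<noteq> 0 \<and> vec.span {w} = vec.span {w'})"
    have "w' \<noteq> 0 \<and> vec.span {w} = vec.span {w'}"
      unfolding w'_def by (rule someI[of _ w]) (use w in simp)
    moreover have "u (vec.span {w}) = line_map e f g w'"
    proof -
      have "vec.span {w} \<in> grassmannian 1" unfolding grassmannian_1 using w by blast
      thus ?thesis unfolding u_def w'_def by (rule restrict_apply')
    qed
    ultimately show ?thesis using line_map_cong[OF efg w] by metis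
  qed
  have "u \<in> sphere_maps 1"
    unfolding sphere_maps_def
  proof (intro CollectI conjI PiE_I)
    fix L :: "(complex^2) set" assume "L \<in> grassmannian 1"
    then obtain w where "w \<noteq> 0" "L = vec.span {w}" unfolding grassmannian_1 by blast
    thus "u L \<in> grassmannian 2" using u line_map_grassmannian[OF efg] by simp
  next
    \<comment> \<open>The coefficient with \<open>k = 0\<close> multiplies \<open>v $ 2\<close> and
      so belongs to \<open>g\<close>; the one with \<open>k = 1\<close> multiplies
      \<open>v $ 1\<close> and belongs to \<open>f\<close>.\<close>
    define a where "a i j k = (if k = 0 then e$i * g$j - e$j * g$i else e$i * f$j - e$j * f$i)"
      for i j :: 4 and k :: nat
    show "\<exists>a :: 4 \<Rightarrow> 4 \<Rightarrow> nat \<Rightarrow> complex. \<forall>v x y. v \<noteq> 0 \<longrightarrow> vec.span {x, y} = u (vec.span {v}) \<longrightarrow>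
       (\<exists>c. c \<noteq> 0 \<and> (\<forall>i j. x $ i * y $ j - x $ j * y $ i
          = c * (\<Sum>k\<le>1. a i j k * (v $ 1) ^ k * (v $ 2) ^ (1 - k))))"
    proof (intro exI[of _ a] allI impI)
      fix v :: "complex^2" and x y
      assume v: "v \<noteq> 0" and "vec.span {x, y} = u (vec.span {v})"
      define h where "h = v$1 *s f + v$2 *s g"
      have xy: "vec.span {x, y} = vec.span {e, h}"
        using \<open>vec.span {x, y} = _\<close> u[OF v] by (simp add: line_map_def h_def)
      obtain i0 j0 where ij: "e $ i0 * h $ j0 - e $ j0 * h $ i0 \<noteq> 0"
        using indep2_wedge[OF indep2_line_map[OF efg v]] unfolding h_def by blast
      have "x \<in> vec.span {e, h}" "y \<in> vec.span {e, h}"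
        unfolding xy[symmetric] by (simp_all add: vec.span_base)
      then obtain \<alpha> \<beta> \<gamma> \<delta> where xyeh: "x = \<alpha> *s e + \<beta> *s h" "y = \<gamma> *s e + \<delta> *s h"
        unfolding in_span2 by blast
      have "e \<in> vec.span {x, y}" "h \<in> vec.span {x, y}"
        unfolding xy by (simp_all add: vec.span_base)
      then obtain \<alpha>' \<beta>' \<gamma>' \<delta>' where ehxy: "e = \<alpha>' *s x + \<beta>' *s y" "h = \<gamma>' *s x + \<delta>' *s y"
        unfolding in_span2 by blast
      \<comment> \<open>Two bases of one plane have Pluecker coordinates that differ by the
        determinant of the base change. This holds in both directions and some coordinate is
        nonzero, so the factor is nonzero.\<close>
      have 1: "x $ i * y $ j - x $ j * y $ i = (\<alpha> * \<delta> - \<beta> * \<gamma>) * (e $ i * h $ j - e $ j * h $ i)" for i j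
        by (simp add: xyeh algebra_simps)
      have "e $ i * h $ j - e $ j * h $ i = (\<alpha>' * \<delta>' - \<beta>' * \<gamma>') * (x $ i * y $ j - x $ j * y $ i)" for i j
        by (subst (1 2) ehxy(1), subst (1 2) ehxy(2)) (simp add: algebra_simps)
      with 1 ij have c: "\<alpha> * \<delta> - \<beta> * \<gamma> \<noteq> 0" by (metis mult_zero_left mult_zero_right)
      have "x $ i * y $ j - x $ j * y $ i
          = (\<alpha> * \<delta> - \<beta> * \<gamma>) * (\<Sum>k\<le>1. a i j k * (v $ 1) ^ k * (v $ 2) ^ (1 - k))" for i j
        unfolding 1 by (simp add: a_def h_def algebra_simps)
      with c show "\<exists>c. c \<noteq> 0 \<and> (\<forall>i j. x $ i * y $ j - x $ j * y $ i
          = c * (\<Sum>k\<le>1. a i j k * (v $ 1) ^ k * (v $ 2) ^ (1 - k)))" by blast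
    qed
  qed (simp add: u_def)
  with u that show thesis by blast
qed

text \<open>The Pluecker coordinates are linear in \<open>w\<close>, with coefficients
  \<open>A\<close> and \<open>B\<close>, and the whole line lies on the Pluecker quadric. Three
  values of \<open>w\<close> suffice to make the polar form of the quadric vanish on
  \<open>A\<close> and \<open>B\<close>, so the planes at the two coordinate points share a vector
  \<open>e\<close>; this vector then lies in all planes.\<close>

lemma sphere_maps_1D:
  assumes "u \<in> sphere_maps 1"
  obtains e f g where "indep3 e f g" "\<And>w. w \<noteq> 0 \<Longrightarrow> u (vec.span {w}) = line_map e f g w"
proof -
  have G: "u (vec.span {w}) \<in> grassmannian 2" if "w \<noteq> 0" for w
  proof -
    have u: "u \<in> grassmannian 1 \<rightarrow>\<^sub>E grassmannian 2" using assms unfolding sphere_maps_def by blast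
    have "vec.span {w} \<in> grassmannian 1" unfolding grassmannian_1 using that by blast
    with u show ?thesis by (rule PiE_mem)
  qed
  obtain a :: "4 \<Rightarrow> 4 \<Rightarrow> nat \<Rightarrow> complex" where a: "\<And>v x y. v \<noteq> 0 \<Longrightarrow> vec.span {x, y} = u (vec.span {v}) \<Longrightarrow>
       (\<exists>c. c \<noteq> 0 \<and> (\<forall>i j. x $ i * y $ j - x $ j * y $ i
          = c * (\<Sum>k\<le>1. a i j k * (v $ 1) ^ k * (v $ 2) ^ (1 - k))))"
    using assms unfolding sphere_maps_def by blast
  define A where "A i j = a i j 1" for i j
  define B where "B i j = a i j 0" for i j
  have H: "\<exists>c. c \<noteq> 0 \<and> (\<forall>i j. x $ i * y $ j - x $ j * y $ i = c * (A i j * v$1 + B i j * v$2))"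
    if "v \<noteq> 0" "u (vec.span {v}) = vec.span {x, y}" for v x y
    using a[OF that(1) that(2)[symmetric]] by (simp add: A_def B_def add.commute)
  \<comment> \<open>The polar form of the Pluecker quadric, read off from the shape of
    \<open>det4\<close>.\<close>
  define q where "q P R = P 1 2 * R 3 4 - P 1 3 * R 2 4 + P 1 4 * R 2 3 + P 2 3 * R 1 4 - P 2 4 * R 1 3
      + P 3 4 * R (1::4) (2::4)" for P R :: "4 \<Rightarrow> 4 \<Rightarrow> complex"
  have det_q: "det4 x y z w = c * d * q P R"
    if "\<And>i j. x $ i * y $ j - x $ j * y $ i = c * P i j" "\<And>i j. z $ i * w $ j - z $ j * w $ i = d * R i j"
    for x y z w c d P R
    unfolding det4_def q_def that by (simp add: algebra_simps)
  have qq: "q P P = 0" if "c \<noteq> 0" "\<And>i j. x $ i * y $ j - x $ j * y $ i = c * P i j" for x y c P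
  proof -
    have "c * c * q P P = det4 x y x y" using det_q[OF that(2) that(2)] by simp
    also have "\<dots> = 0" by (simp add: det4_def algebra_simps)
    finally show ?thesis using that(1) by simp
  qed
  define v1 v2 v3 :: "complex^2" where "v1 = axis 1 1" and "v2 = axis 2 1" and "v3 = (\<chi> i. 1)"
  have v: "v1$1 = 1" "v1$2 = 0" "v2$1 = 0" "v2$2 = 1" "v3$1 = 1" "v3$2 = 1"
    by (simp_all add: v1_def v2_def v3_def axis_def)
  have v0: "v1 \<noteq> 0" "v2 \<noteq> 0" "v3 \<noteq> 0" by (simp_all add: vec2_nonzero v)
  obtain x1 y1 where xy1: "indep2 x1 y1" "u (vec.span {v1}) = vec.span {x1, y1}"
    using grassmannian_basis[OF G[OF v0(1)]] .
  obtain x2 y2 where xy2: "indep2 x2 y2" "u (vec.span {v2}) = vec.span {x2, y2}"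
    using grassmannian_basis[OF G[OF v0(2)]] .
  obtain x3 y3 where xy3: "indep2 x3 y3" "u (vec.span {v3}) = vec.span {x3, y3}"
    using grassmannian_basis[OF G[OF v0(3)]] .
  obtain c1 where c1: "c1 \<noteq> 0" "\<And>i j. x1 $ i * y1 $ j - x1 $ j * y1 $ i = c1 * A i j"
    using H[OF v0(1) xy1(2)] v by auto
  obtain c2 where c2: "c2 \<noteq> 0" "\<And>i j. x2 $ i * y2 $ j - x2 $ j * y2 $ i = c2 * B i j"
    using H[OF v0(2) xy2(2)] v by auto
  obtain c3 where c3: "c3 \<noteq> 0" "\<And>i j. x3 $ i * y3 $ j - x3 $ j * y3 $ i = c3 * (A i j + B i j)"
    using H[OF v0(3) xy3(2)] v by auto
  have "q (\<lambda>i j. A i j + B i j) (\<lambda>i j. A i j + B i j) = q A A + q B B + 2 * q A B"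
    by (simp add: q_def algebra_simps)
  with qq[OF c1] qq[OF c2] qq[OF c3] have "q A B = 0" by simp
  hence "det4 x1 y1 x2 y2 = 0" using det_q[OF c1(2) c2(2)] by simp
  then obtain e where e: "e \<noteq> 0" "e \<in> u (vec.span {v1})" "e \<in> u (vec.span {v2})"
    using planes_meet xy1 xy2 by metis
  obtain f0 where f0: "u (vec.span {v1}) = vec.span {e, f0}"
    using grassmannian_extend[OF G[OF v0(1)] e(2,1)] by blast
  obtain g0 where g0: "u (vec.span {v2}) = vec.span {e, g0}"
    using grassmannian_extend[OF G[OF v0(2)] e(3,1)] by blast
  obtain d1 where d1: "d1 \<noteq> 0" "\<And>i j. e $ i * f0 $ j - e $ j * f0 $ i = d1 * A i j"
    using H[OF v0(1) f0] v by auto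
  obtain d2 where d2: "d2 \<noteq> 0" "\<And>i j. e $ i * g0 $ j - e $ j * g0 $ i = d2 * B i j"
    using H[OF v0(2) g0] v by auto
  \<comment> \<open>Rescaling absorbs the free scalars: the coordinates of \<open>e\<close>,
    \<open>f\<close> become exactly \<open>A\<close> and those of \<open>e\<close>, \<open>g\<close>
    exactly \<open>B\<close>, so that \<open>e\<close> and \<open>w$1 *s f + w$2 *s g\<close> have
    the coordinates prescribed at \<open>w\<close>.\<close>
  define f where "f = (1 / d1) *s f0"
  define g where "g = (1 / d2) *s g0"
  have A: "A i j = e $ i * f $ j - e $ j * f $ i" for i j
  proof -
    have "f0 = d1 *s f" using d1(1) by (simp add: f_def)
    hence "d1 * A i j = d1 * (e $ i * f $ j - e $ j * f $ i)"
      unfolding d1(2)[symmetric] by (simp add: algebra_simps)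
    thus ?thesis using d1(1) by simp
  qed
  have B: "B i j = e $ i * g $ j - e $ j * g $ i" for i j
  proof -
    have "g0 = d2 *s g" using d2(1) by (simp add: g_def)
    hence "d2 * B i j = d2 * (e $ i * g $ j - e $ j * g $ i)"
      unfolding d2(2)[symmetric] by (simp add: algebra_simps)
    thus ?thesis using d2(1) by simp
  qed
  have AB: "A i j * w$1 + B i j * w$2 = e $ i * (w$1 *s f + w$2 *s g) $ j - e $ j * (w$1 *s f + w$2 *s g) $ i"
    for i j and w :: "complex^2"
    by (simp add: A B algebra_simps)
  have efg: "indep3 e f g"
    unfolding indep3_def
  proof (intro allI impI)
    fix a b c assume 0: "a *s e + b *s f + c *s g = 0"
    define w :: "complex^2" where "w = (\<chi> i. if i = 1 then b else c)"
    have w: "w$1 = b" "w$2 = c" by (simp_all add: w_def)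
    have h: "w$1 *s f + w$2 *s g = (- a) *s e" using 0 by (simp add: w eq_neg_iff_add_eq_0 add_ac)
    \<comment> \<open>If \<open>w$1 *s f + w$2 *s g\<close> were a multiple of \<open>e\<close> for
      some \<open>w \<noteq> 0\<close>, all Pluecker coordinates of the plane at \<open>w\<close>
      would be zero.\<close>
    have "w = 0"
    proof (rule ccontr)
      assume w0: "w \<noteq> 0"
      obtain x y where xy: "indep2 x y" "u (vec.span {w}) = vec.span {x, y}"
        using grassmannian_basis[OF G[OF w0]] .
      obtain k where k: "\<And>i j. x $ i * y $ j - x $ j * y $ i = k * (A i j * w$1 + B i j * w$2)"
        using H[OF w0 xy(2)] by auto
      have "x $ i * y $ j - x $ j * y $ i = 0" for i j
        unfolding k AB h by simp
      thus False using indep2_wedge[OF xy(1)] by blast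
    qed
    hence "b = 0" "c = 0" using w by simp_all
    thus "a = 0 \<and> b = 0 \<and> c = 0" using 0 e(1) by simp
  qed
  show thesis
  proof (rule that[OF efg])
    fix w :: "complex^2" assume w: "w \<noteq> 0"
    obtain x y where xy: "indep2 x y" "u (vec.span {w}) = vec.span {x, y}"
      using grassmannian_basis[OF G[OF w]] .
    obtain k where k: "\<And>i j. x $ i * y $ j - x $ j * y $ i = k * (A i j * w$1 + B i j * w$2)"
      using H[OF w xy(2)] by auto
    from wedge_span[OF xy(1) k[unfolded AB]]
    show "u (vec.span {w}) = line_map e f g w"
      unfolding xy(2) by (intro line_map_eq grassmannian_span2 xy(1) efg w)
  qed
qed

lemma flag_basis:
  fixes v \<psi> :: "'a::field^4"
  assumes "v \<noteq> 0" "\<psi> \<noteq> 0" "\<psi> \<diamondop> v = 0"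
  obtains f g where "indep3 v f g" "\<psi> \<diamondop> f = 0" "\<psi> \<diamondop> g = 0"
proof -
  have d: "vec.dim {x. \<psi> \<diamondop> x = 0} = 3" using dim_kernel1[OF assms(2)] by simp
  have "\<exists>f. \<psi> \<diamondop> f = 0 \<and> f \<notin> vec.span {v}"
  proof (rule ccontr)
    assume "\<not> ?thesis"
    hence "{x. \<psi> \<diamondop> x = 0} \<subseteq> vec.span {v}" by blast
    from vec.dim_subset[OF this] show False using d assms(1) by (simp add: vec.dim_insert)
  qed
  then obtain f where f: "\<psi> \<diamondop> f = 0" "f \<notin> vec.span {v}" by blast
  have vf: "indep2 v f" using indep2I assms(1) f(2) by blast
  have "\<exists>g. \<psi> \<diamondop> g = 0 \<and> g \<notin> vec.span {v, f}"
  proof (rule ccontr)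
    assume "\<not> ?thesis"
    hence "{x. \<psi> \<diamondop> x = 0} \<subseteq> vec.span {v, f}" by blast
    from vec.dim_subset[OF this] show False using d dim_indep2[OF vf] by simp
  qed
  then obtain g where "\<psi> \<diamondop> g = 0" "g \<notin> vec.span {v, f}" by blast
  with that f indep3I[OF vf] show thesis by blast
qed

section \<open>Counting spheres through their flags\<close>

definition schubert_translate :: "complex^4^4 \<Rightarrow> nat \<Rightarrow> (complex^4) set set" where
  "schubert_translate A c = (\<lambda>W. (*v) A ` W) ` schubert_variety (young_diagram c)"

text \<open>A line in the Grassmannian is the set of planes between a line and a hyperplane, here spanned
  by \<open>v\<close> and given by the equation \<open>\<psi>\<close>.\<close>

definition in_line :: "complex^4 \<Rightarrow> complex^4 \<Rightarrow> (complex^4) set \<Rightarrow> bool" where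
  "in_line v \<psi> W \<longleftrightarrow> W \<in> grassmannian 2 \<and> v \<in> W \<and> (\<forall>w\<in>W. \<psi> \<diamondop> w = 0)"

text \<open>What remains of a constrained sphere when parametrization and marked points are
  forgotten: its flag, with some plane of the pencil meeting each constraint.\<close>

definition incident :: "nat list \<Rightarrow> (nat \<Rightarrow> complex^4^4) \<Rightarrow> complex^4 \<Rightarrow> complex^4 \<Rightarrow> bool" where
  "incident cs g v \<psi> \<longleftrightarrow> v \<noteq> 0 \<and> \<psi> \<noteq> 0 \<and> \<psi> \<diamondop> v = 0 \<and>
     (\<forall>i<length cs. \<exists>W. in_line v \<psi> W \<and> W \<in> schubert_translate (g i) (cs ! i))"

lemma constrained_sphereD:
  assumes "(u, z) \<in> constrained_spheres 1 cs g"
  obtains e f h where "indep3 e f h" "\<And>w. w \<noteq> 0 \<Longrightarrow> u (vec.span {w}) = line_map e f h w"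
    "incident cs g e (cross4 e f h)"
    "\<And>i. i < length cs \<Longrightarrow> in_line e (cross4 e f h) (u (z i)) \<and> u (z i) \<in> schubert_translate (g i) (cs ! i)"
proof -
  have uz: "u \<in> sphere_maps 1" "z \<in> {..<length cs} \<rightarrow>\<^sub>E grassmannian 1"
    "\<And>i. i < length cs \<Longrightarrow> u (z i) \<in> schubert_translate (g i) (cs ! i)"
    using assms unfolding constrained_spheres_def schubert_translate_def by auto
  obtain e f h where efh: "indep3 e f h" "\<And>w. w \<noteq> 0 \<Longrightarrow> u (vec.span {w}) = line_map e f h w"
    using sphere_maps_1D[OF uz(1)] by blast
  have il: "in_line e (cross4 e f h) (u (z i))" if i: "i < length cs" for i
  proof -
    have "z i \<in> grassmannian 1" using uz(2) i by (auto simp: PiE_iff)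
    then obtain w where w: "w \<noteq> 0" "z i = vec.span {w}" unfolding grassmannian_1 by blast
    have u: "u (z i) = line_map e f h w" using w efh(2) by simp
    show ?thesis unfolding in_line_def u
      using line_map_grassmannian[OF efh(1) w(1)] line_map_contains(1)
        line_map_annihilated[of "cross4 e f h" e f h _ w] by simp
  qed
  have "incident cs g e (cross4 e f h)"
    unfolding incident_def using il uz(3) indep3_cross4[OF efh(1)]
      indep2_nonzero(1)[OF indep3D(1)[OF efh(1)]] by auto
  with that efh il uz(3) show thesis by blast
qed

lemma sphere_classes_empty:
  assumes "\<And>v \<psi>. \<not> incident cs g v \<psi>"
  shows "finite (sphere_classes 1 cs g) \<and> card (sphere_classes 1 cs g) = 0"
proof -
  have "constrained_spheres 1 cs g = {}"
    using constrained_sphereD assms by (metis ex_in_conv surj_pair)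
  thus ?thesis by (simp add: sphere_classes_def)
qed

text \<open>\<open>A\<close> is the base change on the quotient of the hyperplane by the line of
  \<open>v\<close>. The components \<open>a0\<close>, \<open>c0\<close> along \<open>v\<close> are
  absorbed by the planes, all of which contain \<open>v\<close>.\<close>

lemma reparametrize:
  assumes "indep3 v f g" "indep3 v f' g'" "f \<in> vec.span {v, f', g'}" "g \<in> vec.span {v, f', g'}"
  obtains A :: "complex^2^2" where "invertible A"
    "\<And>w. w \<noteq> 0 \<Longrightarrow> A *v w \<noteq> 0" "\<And>w. w \<noteq> 0 \<Longrightarrow> line_map v f' g' (A *v w) = line_map v f g w"
proof -
  obtain a0 a b where f: "f = a0 *s v + a *s f' + b *s g'" using assms(3) unfolding in_span3 by blast
  obtain c0 c d where g: "g = c0 *s v + c *s f' + d *s g'" using assms(4) unfolding in_span3 by blast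
  define A :: "complex^2^2" where
    "A = (\<chi> i j. if i = 1 then (if j = 1 then a else c) else (if j = 1 then b else d))"
  have A: "(A *v w)$1 = a * w$1 + c * w$2" "(A *v w)$2 = b * w$1 + d * w$2" for w
    by (simp_all add: A_def matrix_vector_mult_def sum_2)
  have h: "w$1 *s f + w$2 *s g = (a0 * w$1 + c0 * w$2) *s v + 1 *s ((A *v w)$1 *s f' + (A *v w)$2 *s g')" for w
    unfolding A f g by (simp add: Finite_Cartesian_Product.vec_eq_iff algebra_simps)
  have A0: "A *v w \<noteq> 0" if w: "w \<noteq> 0" for w
  proof
    assume "A *v w = 0"
    hence "(- (a0 * w$1 + c0 * w$2)) *s v + w$1 *s f + w$2 *s g = 0"
      using h[of w] by (simp add: add.assoc)
    hence "w$1 = 0" "w$2 = 0" using assms(1) unfolding indep3_def by blast+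
    with w show False by (simp add: vec2_nonzero)
  qed
  hence "invertible A"
    unfolding invertible_left_inverse matrix_left_invertible_ker by blast
  moreover have "line_map v f' g' (A *v w) = line_map v f g w" if w: "w \<noteq> 0" for w
  proof (rule line_map_eq[OF _ line_map_contains(1) _ assms(1) w])
    show "line_map v f' g' (A *v w) \<in> grassmannian 2" by (rule line_map_grassmannian[OF assms(2) A0[OF w]])
    show "w$1 *s f + w$2 *s g \<in> line_map v f' g' (A *v w)" unfolding h line_map_def in_span2 by blast
  qed
  ultimately show thesis using that A0 by blast
qed

text \<open>Reduces the count to linear algebra. A unique flag leaves only the choice of
  parametrization of its pencil, which \<open>reparametrize\<close> identifies; unique planes fix
  the marked points, because a pencil is injective; and distinct planes are what makes distinct
  marked points possible, hence the class nonempty.\<close>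

lemma sphere_classes_singleton:
  fixes v \<psi> :: "complex^4"
  assumes inc: "incident cs g v \<psi>"
    and uniq: "\<And>v' \<psi>'. incident cs g v' \<psi>' \<Longrightarrow> v' \<in> vec.span {v} \<and> \<psi>' \<in> vec.span {\<psi>}"
    and W: "\<And>i. i < length cs \<Longrightarrow> in_line v \<psi> (W i) \<and> W i \<in> schubert_translate (g i) (cs ! i)"
    and W_uniq: "\<And>i W'. i < length cs \<Longrightarrow> in_line v \<psi> W' \<Longrightarrow> W' \<in> schubert_translate (g i) (cs ! i) \<Longrightarrow> W' = W i"
    and W_inj: "inj_on W {..<length cs}"
  shows "finite (sphere_classes 1 cs g) \<and> card (sphere_classes 1 cs g) = 1"
proof -
  let ?C = "constrained_spheres 1 cs g" and ?n = "length cs"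
  have v: "v \<noteq> 0" "\<psi> \<noteq> 0" "\<psi> \<diamondop> v = 0" using inc by (simp_all add: incident_def)
  have normal: "\<exists>f h. indep3 v f h \<and> vec.span {v, f, h} = {w. \<psi> \<diamondop> w = 0} \<and>
      (\<forall>w. w \<noteq> 0 \<longrightarrow> u (vec.span {w}) = line_map v f h w) \<and> (\<forall>i<?n. u (z i) = W i)"
    if uz: "(u, z) \<in> ?C" for u z
  proof -
    obtain e f h where efh: "indep3 e f h" "\<And>w. w \<noteq> 0 \<Longrightarrow> u (vec.span {w}) = line_map e f h w"
      "incident cs g e (cross4 e f h)"
      "\<And>i. i < ?n \<Longrightarrow> in_line e (cross4 e f h) (u (z i)) \<and> u (z i) \<in> schubert_translate (g i) (cs ! i)"
      using constrained_sphereD[OF uz] by blast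
    obtain k l where k: "e = k *s v" and l: "cross4 e f h = l *s \<psi>"
      using uniq[OF efh(3)] unfolding in_span1 by blast
    have k0: "k \<noteq> 0" and l0: "l \<noteq> 0"
      using efh(3) k l by (auto simp: incident_def)
    have orth: "\<psi> \<diamondop> x = 0" if "cross4 e f h \<diamondop> x = 0" for x
      using that l0 unfolding l by (simp add: scalar_product_scale_left)
    have i: "indep3 v f h"
      unfolding indep3_def
    proof (intro allI impI)
      fix a b c assume "a *s v + b *s f + c *s h = 0"
      hence "(a / k) *s e + b *s f + c *s h = 0" using k0 by (simp add: k)
      hence "a / k = 0 \<and> b = 0 \<and> c = 0" using efh(1) unfolding indep3_def by blast
      thus "a = 0 \<and> b = 0 \<and> c = 0" using k0 by simp
    qed
    moreover have "vec.span {v, f, h} = {w. \<psi> \<diamondop> w = 0}"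
      by (rule span3_eq_kernel[OF i v(2,3)]) (simp_all add: orth)
    moreover have "u (vec.span {w}) = line_map v f h w" if w: "w \<noteq> 0" for w
      unfolding efh(2)[OF w]
    proof (rule line_map_eq[OF line_map_grassmannian[OF efh(1) w] _ line_map_contains(2) i w])
      have "v = (1 / k) *s e" using k0 by (simp add: k)
      thus "v \<in> line_map e f h w"
        using grassmannian_lincomb(1)[OF line_map_grassmannian[OF efh(1) w] line_map_contains(1) line_map_contains(1)]
        by metis
    qed
    moreover have "u (z i) = W i" if i: "i < ?n" for i
    proof (rule W_uniq[OF i])
      have a: "in_line e (cross4 e f h) (u (z i))" using efh(4)[OF i] by blast
      have "v = (1 / k) *s e" using k0 by (simp add: k)
      hence "v \<in> u (z i)" using a grassmannian_lincomb(1)[of "u (z i)" 2 e e] unfolding in_line_def by metis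
      thus "in_line v \<psi> (u (z i))" using a orth unfolding in_line_def by blast
      show "u (z i) \<in> schubert_translate (g i) (cs ! i)" using efh(4)[OF i] by blast
    qed
    ultimately show ?thesis by blast
  qed
  have rel: "((u, z), (u', z')) \<in> reparametrization ?n" if uz: "(u, z) \<in> ?C" and uz': "(u', z') \<in> ?C" for u z u' z'
  proof -
    obtain f h where fh: "indep3 v f h" "vec.span {v, f, h} = {w. \<psi> \<diamondop> w = 0}"
      "\<And>w. w \<noteq> 0 \<Longrightarrow> u (vec.span {w}) = line_map v f h w" "\<And>i. i < ?n \<Longrightarrow> u (z i) = W i"
      using normal[OF uz] by blast
    obtain f' h' where fh': "indep3 v f' h'" "vec.span {v, f', h'} = {w. \<psi> \<diamondop> w = 0}"
      "\<And>w. w \<noteq> 0 \<Longrightarrow> u' (vec.span {w}) = line_map v f' h' w" "\<And>i. i < ?n \<Longrightarrow> u' (z' i) = W i"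
      using normal[OF uz'] by blast
    have "f \<in> vec.span {v, f, h}" "h \<in> vec.span {v, f, h}" by (simp_all add: vec.span_base)
    hence "f \<in> vec.span {v, f', h'}" "h \<in> vec.span {v, f', h'}" using fh(2) fh'(2) by blast+
    then obtain A :: "complex^2^2" where A: "invertible A" "\<And>w. w \<noteq> 0 \<Longrightarrow> A *v w \<noteq> 0"
      "\<And>w. w \<noteq> 0 \<Longrightarrow> line_map v f' h' (A *v w) = line_map v f h w"
      using reparametrize[OF fh(1) fh'(1)] by blast
    have im: "(*v) A ` vec.span {w} = vec.span {A *v w}" for w
      using linear_matrix_vector_mul_eq vec.linear_span_image[of "(*v) A" "{w}"]
        matrix_vector_mul_linear_gen[of A] by simp
    have uu: "u' ((*v) A ` L) = u L" if L: "L \<in> grassmannian 1" for L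
    proof -
      obtain w where w: "w \<noteq> 0" "L = vec.span {w}" using L unfolding grassmannian_1 by blast
      thus ?thesis unfolding w(2) im using fh(3) fh'(3) A by simp
    qed
    have zz: "z' i = (*v) A ` z i" if i: "i < ?n" for i
    proof -
      have "z i \<in> grassmannian 1" "z' i \<in> grassmannian 1"
        using uz uz' i by (auto simp: constrained_spheres_def PiE_iff)
      then obtain w w' where w: "w \<noteq> 0" "z i = vec.span {w}" "w' \<noteq> 0" "z' i = vec.span {w'}"
        unfolding grassmannian_1 by blast
      have "line_map v f' h' w' = line_map v f' h' (A *v w)"
        using fh(3,4) fh'(3,4) i w A(3) by metis
      from line_map_inj[OF fh'(1) w(3) A(2)[OF w(1)] this] show ?thesis by (simp add: w im)
    qed
    show ?thesis unfolding reparametrization_def using A(1) uu zz by blast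
  qed
  have "\<exists>x. x \<in> ?C"
  proof -
    obtain f h where fh: "indep3 v f h" "\<psi> \<diamondop> f = 0" "\<psi> \<diamondop> h = 0" using flag_basis[OF v] .
    obtain u where u: "u \<in> sphere_maps 1" "\<And>w. w \<noteq> 0 \<Longrightarrow> u (vec.span {w}) = line_map v f h w"
      using sphere_maps_1_line[OF fh(1)] by blast
    have "\<forall>i. \<exists>L. i < ?n \<longrightarrow> L \<in> grassmannian 1 \<and> u L = W i"
    proof
      fix i
      show "\<exists>L. i < ?n \<longrightarrow> L \<in> grassmannian 1 \<and> u L = W i"
      proof (cases "i < ?n")
        case True
        have "W i \<in> grassmannian 2" "v \<in> W i" "\<forall>w\<in>W i. \<psi> \<diamondop> w = 0"
          using W[OF True] by (simp_all add: in_line_def)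
        then obtain w where "w \<noteq> 0" "W i = line_map v f h w"
          using line_map_onto[OF fh(1) v(2,3) fh(2,3)] by blast
        thus ?thesis using u(2) grassmannian_1 by metis
      qed simp
    qed
    then obtain L where L: "\<And>i. i < ?n \<Longrightarrow> L i \<in> grassmannian 1 \<and> u (L i) = W i" by metis
    have "inj_on (restrict L {..<?n}) {..<?n}"
    proof (rule inj_onI)
      fix i j assume "i \<in> {..<?n}" "j \<in> {..<?n}" "restrict L {..<?n} i = restrict L {..<?n} j"
      hence "W i = W j" using L[of i] L[of j] by auto
      thus "i = j" using W_inj \<open>i \<in> _\<close> \<open>j \<in> _\<close> by (auto dest: inj_onD)
    qed
    hence "(u, restrict L {..<?n}) \<in> ?C"
      using u(1) L W unfolding constrained_spheres_def schubert_translate_def by auto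
    thus ?thesis ..
  qed
  then obtain x where x: "x \<in> ?C" ..
  \<comment> \<open>All constrained spheres are related, so the only class is the whole set.\<close>
  have "(reparametrization ?n \<inter> ?C \<times> ?C) `` {y} = ?C" if "y \<in> ?C" for y
    using rel that by (cases y) auto
  hence "sphere_classes 1 cs g = {?C}"
    unfolding sphere_classes_def quotient_def using x by blast
  thus ?thesis by simp
qed

section \<open>Generic translates\<close>

text \<open>Polynomials in the entries of the first \<open>n\<close> matrices, given by closure
  rules: only continuity and the restriction to a line are ever used of them, and both follow by
  induction.\<close>

inductive poly_fun :: "nat \<Rightarrow> ((nat \<Rightarrow> complex^4^4) \<Rightarrow> complex) \<Rightarrow> bool" for n where
  const: "poly_fun n (\<lambda>_. c)"
| entry: "i < n \<Longrightarrow> poly_fun n (\<lambda>g. g i $ a $ b)"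
| add: "poly_fun n P \<Longrightarrow> poly_fun n Q \<Longrightarrow> poly_fun n (\<lambda>g. P g + Q g)"
| mult: "poly_fun n P \<Longrightarrow> poly_fun n Q \<Longrightarrow> poly_fun n (\<lambda>g. P g * Q g)"

lemma poly_fun_diff:
  assumes "poly_fun n P" "poly_fun n Q" shows "poly_fun n (\<lambda>g. P g - Q g)"
proof -
  have "poly_fun n (\<lambda>g. P g + (- 1) * Q g)" by (intro poly_fun.intros assms)
  thus ?thesis by simp
qed

lemma poly_fun_cong: "poly_fun n Q \<Longrightarrow> (\<And>i. i < n \<Longrightarrow> g i = h i) \<Longrightarrow> Q g = Q h"
  by (induction rule: poly_fun.induct) auto

text \<open>The affine line through two tuples of matrices, on which a polynomial function becomes a
  polynomial in one variable.\<close>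

definition interpolate :: "(nat \<Rightarrow> complex^4^4) \<Rightarrow> (nat \<Rightarrow> complex^4^4) \<Rightarrow> complex \<Rightarrow> nat \<Rightarrow> complex^4^4" where
  "interpolate g h s i = (\<chi> a b. g i $ a $ b + s * (h i $ a $ b - g i $ a $ b))"

lemma interpolate_0: "interpolate g h 0 i = g i" and interpolate_1: "interpolate g h 1 i = h i"
  by (simp_all add: interpolate_def)

lemma poly_fun_interpolate:
  "poly_fun n Q \<Longrightarrow> \<exists>p. \<forall>s. Q (interpolate g h s) = poly p s"
proof (induction rule: poly_fun.induct)
  case (const c)
  show ?case by (rule exI[of _ "[:c:]"]) simp
next
  case (entry i a b)
  show ?case
    by (rule exI[of _ "[:g i $ a $ b, h i $ a $ b - g i $ a $ b:]"]) (simp add: interpolate_def)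
next
  case (add P Q)
  then obtain p q where "\<forall>s. P (interpolate g h s) = poly p s" "\<forall>s. Q (interpolate g h s) = poly q s" by blast
  thus ?case by (intro exI[of _ "p + q"]) simp
next
  case (mult P Q)
  then obtain p q where "\<forall>s. P (interpolate g h s) = poly p s" "\<forall>s. Q (interpolate g h s) = poly q s" by blast
  thus ?case by (intro exI[of _ "p * q"]) simp
qed

definition nonzero_poly :: "nat \<Rightarrow> ((nat \<Rightarrow> complex^4^4) \<Rightarrow> complex) \<Rightarrow> bool" where
  "nonzero_poly n Q \<longleftrightarrow> poly_fun n Q \<and> (\<exists>g. Q g \<noteq> 0)"

lemma nonzero_polyI: "poly_fun n Q \<Longrightarrow> Q g \<noteq> 0 \<Longrightarrow> nonzero_poly n Q"
  by (auto simp: nonzero_poly_def)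

text \<open>On the line joining a point where \<open>P\<close> is nonzero to one where
  \<open>Q\<close> is, both restrict to nonzero polynomials in one variable, whose product has a
  nonzero value. Thus finitely many genericity conditions amount to one.\<close>

lemma nonzero_poly_mult:
  assumes "nonzero_poly n P" "nonzero_poly n Q"
  shows "nonzero_poly n (\<lambda>g. P g * Q g)"
proof -
  obtain g h where gh: "P g \<noteq> 0" "Q h \<noteq> 0" and PQ: "poly_fun n P" "poly_fun n Q"
    using assms unfolding nonzero_poly_def by blast
  obtain p where p: "\<And>s. P (interpolate g h s) = poly p s" using poly_fun_interpolate[OF PQ(1)] by blast
  obtain q where q: "\<And>s. Q (interpolate g h s) = poly q s" using poly_fun_interpolate[OF PQ(2)] by blast
  have "poly p 0 = P g" "poly q 1 = Q h"
    unfolding p[symmetric] q[symmetric] using PQ by (auto intro: poly_fun_cong simp: interpolate_0 interpolate_1)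
  with gh have "p * q \<noteq> 0" by auto
  then obtain s where "poly (p * q) s \<noteq> 0" using poly_all_0_iff_0 by blast
  hence "P (interpolate g h s) * Q (interpolate g h s) \<noteq> 0" by (simp add: p q)
  with poly_fun.mult[OF PQ] show ?thesis by (rule nonzero_polyI)
qed

lemma nonzero_poly_prod:
  assumes "finite I" "\<And>i. i \<in> I \<Longrightarrow> nonzero_poly n (Q i)"
  shows "nonzero_poly n (\<lambda>g. \<Prod>i\<in>I. Q i g)"
  using assms
proof (induction I)
  case empty
  show ?case by (rule nonzero_polyI[of _ _ undefined]) (simp_all add: poly_fun.const)
next
  case (insert i I)
  hence "nonzero_poly n (\<lambda>g. Q i g * (\<Prod>i\<in>I. Q i g))" by (intro nonzero_poly_mult) auto
  thus ?case using insert.hyps by simp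
qed

abbreviation GL_topology :: "nat \<Rightarrow> (nat \<Rightarrow> complex^4^4) topology" where
  "GL_topology n \<equiv> product_topology (\<lambda>_. top_of_set {A. invertible A}) {..<n}"

lemma poly_fun_continuous: "poly_fun n Q \<Longrightarrow> continuous_map (GL_topology n) euclidean Q"
proof (induction rule: poly_fun.induct)
  case (entry i a b)
  have "continuous_map (GL_topology n) (top_of_set {A :: complex^4^4. invertible A}) (\<lambda>g. g i)"
    using entry by (intro continuous_map_product_projection) simp
  moreover have "continuous_map (top_of_set {A :: complex^4^4. invertible A}) euclidean (\<lambda>A. A $ a $ b)"
    unfolding continuous_map_iff_continuous by (intro continuous_intros)
  ultimately have "continuous_map (GL_topology n) euclidean ((\<lambda>A. A $ a $ b) \<circ> (\<lambda>g. g i))"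
    by (rule continuous_map_compose)
  thus ?case by (simp add: o_def)
qed (simp_all add: continuous_map_atin tendsto_mult tendsto_add)

lemma continuous_on_det:
  fixes f :: "complex \<Rightarrow> complex^'n^'n"
  assumes "\<And>a b. continuous_on S (\<lambda>s. f s $ a $ b)"
  shows "continuous_on S (\<lambda>s. Determinants.det (f s))"
  unfolding Determinants.det_def by (intro continuous_intros assms)

text \<open>Density is checked on a complex line: from a point \<open>x\<close> of an open set, move
  towards some \<open>h\<close> with \<open>Q h \<noteq> 0\<close>. The parameters that stay in the
  open set form a nonempty open, hence infinite, set, while \<open>Q\<close> restricts to a nonzero
  polynomial with finitely many roots.\<close>

lemma generically_nonzero_poly:
  assumes Q: "nonzero_poly n Q"
    and P: "\<And>g. (\<And>i. i < n \<Longrightarrow> invertible (g i)) \<Longrightarrow> Q g \<noteq> 0 \<Longrightarrow> P g"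
  shows "generically n P"
proof -
  let ?T = "GL_topology n"
  define U where "U = {g \<in> topspace ?T. Q g \<in> - {0}}"
  have Qp: "poly_fun n Q" using Q by (simp add: nonzero_poly_def)
  have "openin ?T U"
    unfolding U_def by (rule openin_continuous_map_preimage[OF poly_fun_continuous[OF Qp]]) auto
  moreover have "?T closure_of U = topspace ?T"
    unfolding dense_intersects_open
  proof (intro allI impI)
    fix T assume T: "openin ?T T \<and> T \<noteq> {}"
    then obtain x where x: "x \<in> T" by blast
    with T have xT: "x \<in> topspace ?T" using openin_subset by blast
    obtain h where h: "Q h \<noteq> 0" using Q by (auto simp: nonzero_poly_def)
    define \<gamma> where "\<gamma> s = restrict (interpolate x h s) {..<n}" for s
    \<comment> \<open>The endpoint \<open>h\<close> may consist of singular matrices;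
      \<open>E\<close> keeps the parameters at which the line runs through invertible ones, among
      them 0.\<close>
    define E where "E = (\<Inter>i\<in>{..<n}. {s. Determinants.det (interpolate x h s i) \<noteq> 0})"
    have cont: "continuous_on S (\<lambda>s. interpolate x h s i $ a $ b)" for S i a b
      unfolding interpolate_def by (simp, intro continuous_intros)
    have "open E"
      unfolding E_def by (intro open_INT ballI finite_lessThan open_Collect_neq continuous_on_det cont continuous_on_const)
    have \<gamma>: "continuous_map (top_of_set E) ?T \<gamma>"
      unfolding continuous_map_componentwise
    proof (intro conjI ballI)
      show "\<gamma> ` topspace (top_of_set E) \<subseteq> extensional {..<n}" by (auto simp: \<gamma>_def)
      fix k assume k: "k \<in> {..<n}"
      have "continuous_on E (\<lambda>s. interpolate x h s k)"
        unfolding interpolate_def by (intro continuous_intros)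
      moreover have "invertible (interpolate x h s k)" if "s \<in> E" for s
        using that k by (auto simp: E_def invertible_det_nz)
      ultimately show "continuous_map (top_of_set E) (top_of_set {A. invertible A}) (\<lambda>s. \<gamma> s k)"
        using k by (auto simp: continuous_map_in_subtopology \<gamma>_def)
    qed
    define V where "V = {s \<in> topspace (top_of_set E). \<gamma> s \<in> T}"
    have "openin (top_of_set E) V" unfolding V_def by (rule openin_continuous_map_preimage[OF \<gamma>]) (use T in blast)
    with \<open>open E\<close> have "open V" using openin_open_trans by blast
    have "\<gamma> 0 = x" using xT by (auto simp: \<gamma>_def interpolate_0 PiE_iff extensional_def)
    moreover have "0 \<in> E" using xT by (auto simp: E_def interpolate_0 PiE_iff invertible_det_nz)
    ultimately have "0 \<in> V" using x by (simp add: V_def)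
    with \<open>open V\<close> have "infinite V" using finite_imp_not_open by blast
    obtain p where p: "\<And>s. Q (interpolate x h s) = poly p s" using poly_fun_interpolate[OF Qp] by blast
    have "poly p 1 = Q h" unfolding p[symmetric] by (rule poly_fun_cong[OF Qp]) (rule interpolate_1)
    with h have "p \<noteq> 0" by auto
    with \<open>infinite V\<close> obtain s where s: "s \<in> V" "poly p s \<noteq> 0"
      using poly_roots_finite finite_subset by (metis (mono_tags, lifting) mem_Collect_eq subsetI)
    have "Q (\<gamma> s) = Q (interpolate x h s)" by (rule poly_fun_cong[OF Qp]) (simp add: \<gamma>_def)
    hence "Q (\<gamma> s) \<noteq> 0" using s p by simp
    moreover have "\<gamma> s \<in> T" using s by (simp add: V_def)
    ultimately have "\<gamma> s \<in> U" using T openin_subset unfolding U_def by blast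
    with \<open>\<gamma> s \<in> T\<close> show "U \<inter> T \<noteq> {}" by blast
  qed
  moreover have "P g" if "g \<in> U" for g
    by (rule P) (use that in \<open>auto simp: U_def PiE_iff\<close>)
  ultimately show ?thesis
    unfolding generically_def by (intro exI[of _ U]) simp
qed

lemma generically_mono:
  assumes "generically n P" "\<And>g. P g \<Longrightarrow> Q g" shows "generically n Q"
proof -
  obtain U where U: "openin (GL_topology n) U"
    "(GL_topology n) closure_of U = {..<n} \<rightarrow>\<^sub>E {A. invertible A}" "\<forall>g\<in>U. P g"
    using assms(1) unfolding generically_def by (elim exE conjE)
  show ?thesis
    unfolding generically_def by (intro exI[of _ U] conjI U(1,2) ballI assms(2)) (rule bspec[OF U(3)])
qed

text \<open>The description is unique because dense open sets for two candidate values intersect,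
  the space of tuples being nonempty.\<close>

lemma gw_number_eqI:
  assumes "generically (length cs) (\<lambda>g. finite (sphere_classes d cs g) \<and> card (sphere_classes d cs g) = N)"
  shows "gw_number d cs = N"
  unfolding gw_number_def
proof (rule the_equality)
  show "generically (length cs) (\<lambda>g. finite (sphere_classes d cs g) \<and> card (sphere_classes d cs g) = N)"
    by (rule assms)
next
  fix N' let ?T = "GL_topology (length cs)"
  assume "generically (length cs) (\<lambda>g. finite (sphere_classes d cs g) \<and> card (sphere_classes d cs g) = N')"
  then obtain U' where U': "openin ?T U'" "?T closure_of U' = topspace ?T"
    "\<And>g. g \<in> U' \<Longrightarrow> card (sphere_classes d cs g) = N'"
    unfolding generically_def by auto
  obtain U where U: "openin ?T U" "?T closure_of U = topspace ?T"
    "\<And>g. g \<in> U \<Longrightarrow> card (sphere_classes d cs g) = N"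
    using assms unfolding generically_def by auto
  have "restrict (\<lambda>_. Finite_Cartesian_Product.mat 1) {..<length cs} \<in> topspace ?T" by (auto simp: invertible_def intro!: exI[of _ "Finite_Cartesian_Product.mat 1"])
  hence "topspace ?T \<noteq> {}" by blast
  hence "U \<noteq> {}" using U(2) closure_of_empty by metis
  hence "U' \<inter> U \<noteq> {}" using U'(2) U(1) unfolding dense_intersects_open by blast
  thus "N' = N" using U(3) U'(3) by blast
qed

definition poly_vec :: "nat \<Rightarrow> ((nat \<Rightarrow> complex^4^4) \<Rightarrow> complex^4) \<Rightarrow> bool" where
  "poly_vec n F \<longleftrightarrow> (\<forall>k. poly_fun n (\<lambda>g. F g $ k))"

lemma poly_vec_const: "poly_vec n (\<lambda>_. v)"
  by (simp add: poly_vec_def poly_fun.const)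

lemma poly_vec_column: "i < n \<Longrightarrow> poly_vec n (\<lambda>g. column j (g i))"
  by (simp add: poly_vec_def column_def poly_fun.entry)

lemma poly_fun_det4:
  assumes "poly_vec n A" "poly_vec n B" "poly_vec n C" "poly_vec n D"
  shows "poly_fun n (\<lambda>g. det4 (A g) (B g) (C g) (D g))"
  unfolding det4_def
  by (intro poly_fun_diff poly_fun.add poly_fun.mult; use assms in \<open>simp add: poly_vec_def\<close>)

lemma poly_vec_cross4:
  assumes "poly_vec n A" "poly_vec n B" "poly_vec n C"
  shows "poly_vec n (\<lambda>g. cross4 (A g) (B g) (C g))"
  using poly_fun_det4[OF assms poly_vec_const] by (simp add: poly_vec_def cross4_def)

lemma poly_fun_scalar_product:
  assumes "poly_vec n A" "poly_vec n B"
  shows "poly_fun n (\<lambda>g. A g \<diamondop> B g)"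
  unfolding scalar_product_4
  by (intro poly_fun.add poly_fun.mult; use assms in \<open>simp add: poly_vec_def\<close>)

section \<open>Translates of Schubert varieties\<close>

lemma coord_subspace_components:
  "coord_subspace 1 = {x. x$2 = 0 \<and> x$3 = 0 \<and> x$4 = 0}"
  "coord_subspace 2 = {x. x$3 = 0 \<and> x$4 = 0}"
  "coord_subspace 3 = {x. x$4 = 0}"
  "coord_subspace 4 = UNIV"
proof -
  have I: "{1..1::nat} = {1}" "{1..2::nat} = {1, 2}" "{1..3::nat} = {1, 2, 3}" "{1..4::nat} = {1, 2, 3, 4}"
    by auto
  have "x \<in> coord_subspace 1 \<longleftrightarrow> x$2 = 0 \<and> x$3 = 0 \<and> x$4 = 0" "x \<in> coord_subspace 2 \<longleftrightarrow> x$3 = 0 \<and> x$4 = 0"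
    "x \<in> coord_subspace 3 \<longleftrightarrow> x$4 = 0" "x \<in> coord_subspace 4" for x
    unfolding coord_subspace_def I
    by (simp_all add: in_span1 in_span2 in_span3 vec.span_breakdown_eq[of _ "axis 1 1" "{_, _, _}"]
        Finite_Cartesian_Product.vec_eq_iff forall_4 axis_4_components)
  thus "coord_subspace 1 = {x. x$2 = 0 \<and> x$3 = 0 \<and> x$4 = 0}" "coord_subspace 2 = {x. x$3 = 0 \<and> x$4 = 0}"
    "coord_subspace 3 = {x. x$4 = 0}" "coord_subspace 4 = UNIV" by blast+
qed

lemma coord_subspace_2: "coord_subspace 2 = vec.span {axis 1 1, axis 2 1}"
proof -
  have "{1..2::nat} = {1, 2}" by auto
  thus ?thesis by (simp add: coord_subspace_def)
qed

lemma subspace_coord_subspace: "vec.subspace (coord_subspace m)"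
  by (simp add: coord_subspace_def)

lemma dim_inter_ge_grassmannian:
  assumes "P \<in> grassmannian 2"
  shows "vec.dim (P \<inter> coord_subspace m) \<ge> 2 \<longleftrightarrow> P \<subseteq> coord_subspace m"
proof
  assume "vec.dim (P \<inter> coord_subspace m) \<ge> 2"
  hence "P \<inter> coord_subspace m = P"
    using assms subspace_coord_subspace
    by (intro vec.subspace_dim_equal) (auto simp: grassmannian_def intro: vec.subspace_inter)
  thus "P \<subseteq> coord_subspace m" by blast
next
  assume "P \<subseteq> coord_subspace m"
  hence "P \<inter> coord_subspace m = P" by blast
  thus "vec.dim (P \<inter> coord_subspace m) \<ge> 2" using assms by (simp add: grassmannian_def)
qed

lemma dim_ge_1_iff: "vec.dim S \<ge> 1 \<longleftrightarrow> (\<exists>x\<in>S. x \<noteq> (0::'a::field^'n))"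
proof -
  have "vec.dim S \<ge> 1 \<longleftrightarrow> \<not> vec.dim S = 0" by linarith
  also have "\<dots> \<longleftrightarrow> (\<exists>x\<in>S. x \<noteq> 0)" unfolding vec.dim_eq_0 by blast
  finally show ?thesis .
qed

lemma dim_inter_coord_1:
  assumes "P \<in> grassmannian 2"
  shows "vec.dim (P \<inter> coord_subspace 1) \<ge> 1 \<longleftrightarrow> axis 1 1 \<in> P"
  unfolding dim_ge_1_iff
proof
  assume "\<exists>x\<in>P \<inter> coord_subspace 1. x \<noteq> 0"
  then obtain x where x: "x \<in> P" "x \<noteq> 0" "x$2 = 0" "x$3 = 0" "x$4 = 0"
    unfolding coord_subspace_components by blast
  hence "x$1 \<noteq> 0" by (auto simp: Finite_Cartesian_Product.vec_eq_iff forall_4)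
  hence "axis 1 1 = (1 / x$1) *s x"
    using x by (simp add: Finite_Cartesian_Product.vec_eq_iff forall_4 axis_4_components)
  thus "axis 1 1 \<in> P" using grassmannian_lincomb(1)[OF assms x(1) x(1)] by metis
next
  assume "axis 1 1 \<in> P"
  moreover have "axis 1 1 \<in> coord_subspace 1" unfolding coord_subspace_components by (simp add: axis_4_components)
  moreover have "axis 1 1 \<noteq> (0 :: complex^4)"
    by (simp add: Finite_Cartesian_Product.vec_eq_iff forall_4 axis_4_components)
  ultimately show "\<exists>x\<in>P \<inter> coord_subspace 1. x \<noteq> 0" by blast
qed

text \<open>Inside \<open>coord_subspace 3\<close> a single equation cuts out
  \<open>coord_subspace 2\<close>, and one equation lowers the dimension of a plane by at most
  one.\<close>

lemma dim_inter_coord_2: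
  assumes "P \<in> grassmannian 2" "P \<subseteq> coord_subspace 3"
  shows "vec.dim (P \<inter> coord_subspace 2) \<ge> 1"
proof -
  have P: "vec.subspace P" "vec.dim P = 2" using assms(1) by (simp_all add: grassmannian_def)
  have e: "axis 3 1 \<diamondop> x = x$3" for x :: "complex^4"
    by (simp add: scalar_product_4 axis_4_components)
  have eq: "P \<inter> coord_subspace 2 = P \<inter> {x. axis 3 1 \<diamondop> x = 0}"
    using assms(2) unfolding coord_subspace_components e by blast
  show ?thesis
  proof (cases "\<exists>s\<in>P. axis 3 1 \<diamondop> s \<noteq> 0")
    case True
    then obtain s where "s \<in> P" "axis 3 1 \<diamondop> s \<noteq> 0" by blast
    from dim_inter_kernel[OF P(1) this] show ?thesis using P(2) unfolding eq by linarith
  next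
    case False
    hence "P \<inter> {x. axis 3 1 \<diamondop> x = 0} = P" by blast
    thus ?thesis using P(2) unfolding eq by simp
  qed
qed

text \<open>In projective 3-space the members of the Grassmannian are lines: index 2 means through a
  point, 3 in a plane, 4 both, and 5 one fixed line, expressed by two of its points. So
  \<open>c \<noteq> 3\<close> reads as a point condition and \<open>c \<in> {3, 4}\<close> as an
  equation.\<close>

lemma schubert_variety_iff:
  assumes "c \<in> {2, 3, 4, 5}"
  shows "P \<in> schubert_variety (young_diagram c) \<longleftrightarrow> P \<in> grassmannian 2 \<and>
    (c \<noteq> 3 \<longrightarrow> axis 1 1 \<in> P) \<and> (c = 5 \<longrightarrow> axis 2 1 \<in> P) \<and>
    (c \<in> {3, 4} \<longrightarrow> (\<forall>x\<in>P. x$4 = 0))"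
proof (cases "P \<in> grassmannian 2")
  case True
  note d = dim_inter_ge_grassmannian[OF True] dim_inter_coord_1[OF True]
  from assms consider "c = 2" | "c = 3" | "c = 4" | "c = 5" by blast
  thus ?thesis
  proof cases
    case 1
    have "P \<in> schubert_variety (2, 0) \<longleftrightarrow> vec.dim (P \<inter> coord_subspace 1) \<ge> 1 \<and> vec.dim (P \<inter> coord_subspace 4) \<ge> 2"
      using True by (simp add: schubert_variety_def)
    also have "\<dots> \<longleftrightarrow> axis 1 1 \<in> P" unfolding d unfolding coord_subspace_components by simp
    finally show ?thesis using 1 True by (simp add: young_diagram_def)
  next
    case 2
    have "P \<in> schubert_variety (1, 1) \<longleftrightarrow> vec.dim (P \<inter> coord_subspace 2) \<ge> 1 \<and> vec.dim (P \<inter> coord_subspace 3) \<ge> 2"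
      using True by (simp add: schubert_variety_def)
    also have "\<dots> \<longleftrightarrow> P \<subseteq> coord_subspace 3" unfolding d using dim_inter_coord_2[OF True] by blast
    finally show ?thesis using 2 True unfolding coord_subspace_components by (auto simp: young_diagram_def)
  next
    case 3
    have "P \<in> schubert_variety (2, 1) \<longleftrightarrow> vec.dim (P \<inter> coord_subspace 1) \<ge> 1 \<and> vec.dim (P \<inter> coord_subspace 3) \<ge> 2"
      using True by (simp add: schubert_variety_def)
    also have "\<dots> \<longleftrightarrow> axis 1 1 \<in> P \<and> P \<subseteq> coord_subspace 3" unfolding d ..
    finally show ?thesis using 3 True unfolding coord_subspace_components by (auto simp: young_diagram_def)
  next
    case 4
    have "P \<in> schubert_variety (2, 2) \<longleftrightarrow> vec.dim (P \<inter> coord_subspace 1) \<ge> 1 \<and> vec.dim (P \<inter> coord_subspace 2) \<ge> 2"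
      using True by (simp add: schubert_variety_def)
    hence e: "P \<in> schubert_variety (2, 2) \<longleftrightarrow> axis 1 1 \<in> P \<and> P \<subseteq> coord_subspace 2" unfolding d .
    have i: "indep2 (axis 1 1) (axis 2 (1::complex) :: complex^4)"
      unfolding indep2_def by (simp add: Finite_Cartesian_Product.vec_eq_iff forall_4 axis_4_components)
    have "axis 1 1 \<in> P \<and> P \<subseteq> coord_subspace 2 \<longleftrightarrow> axis 1 1 \<in> P \<and> axis 2 1 \<in> P"
    proof (intro iffI conjI; elim conjE)
      assume P: "P \<subseteq> coord_subspace 2"
      hence "P = vec.span {axis 1 1, axis 2 1}"
        unfolding coord_subspace_2 by (rule grassmannian_eqI[OF True grassmannian_span2[OF i]])
      thus "axis 2 1 \<in> P" by (simp add: vec.span_base)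
    next
      assume a: "axis 1 1 \<in> P" "axis 2 1 \<in> P"
      show "P \<subseteq> coord_subspace 2"
        unfolding coord_subspace_2 grassmannian_eq_span2[OF True a i] by (rule subset_refl)
    qed
    with e show ?thesis using 4 True by (simp add: young_diagram_def)
  qed
next
  case False
  thus ?thesis by (auto simp: schubert_variety_def)
qed

text \<open>The equation of the image under \<open>A\<close> of the hyperplane
  \<open>x$4 = 0\<close>. It is the last row of the adjugate of \<open>A\<close>: a multiple of that
  row of the inverse, but polynomial in the entries.\<close>

definition covector :: "'a::field^4^4 \<Rightarrow> 'a^4" where
  "covector A = cross4 (column 1 A) (column 2 A) (column 3 A)"

lemma matrix_vector_mult_columns:
  "A *v x = x$1 *s column 1 A + x$2 *s column 2 A + x$3 *s column 3 A + x$4 *s column 4 (A::'a::field^4^'n)"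
  by (simp add: matrix_mult_sum sum_4)

lemma invertible_kernel:
  assumes "invertible (A::'a::field^'n^'n)" "A *v x = 0" shows "x = 0"
  using assms unfolding invertible_left_inverse matrix_left_invertible_ker by blast

lemma invertible_columns:
  assumes "invertible (A::'a::field^4^4)"
  shows "indep3 (column 1 A) (column 2 A) (column 3 A)" "covector A \<diamondop> column 4 A \<noteq> 0"
proof -
  show i: "indep3 (column 1 A) (column 2 A) (column 3 A)"
    unfolding indep3_def
  proof (intro allI impI)
    fix a b c assume 0: "a *s column 1 A + b *s column 2 A + c *s column 3 A = 0"
    define x :: "'a^4" where "x = a *s axis 1 1 + b *s axis 2 1 + c *s axis 3 1"
    have x: "x$1 = a" "x$2 = b" "x$3 = c" "x$4 = 0" by (simp_all add: x_def axis_4_components)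
    have "A *v x = 0" using 0 by (simp add: matrix_vector_mult_columns x)
    hence "x = 0" using invertible_kernel[OF assms] by blast
    thus "a = 0 \<and> b = 0 \<and> c = 0" using x by simp
  qed
  show "covector A \<diamondop> column 4 A \<noteq> 0"
  proof
    assume "covector A \<diamondop> column 4 A = 0"
    hence *: "covector A \<diamondop> (A *v x) = 0" for x
      by (simp add: matrix_vector_mult_columns covector_def scalar_product_add_right scalar_product_scale_right)
    obtain B where B: "A ** B = Finite_Cartesian_Product.mat 1" using assms unfolding invertible_def by blast
    have "covector A \<diamondop> y = 0" for y
      using *[of "B *v y"] by (simp add: matrix_vector_mul_assoc B)
    hence "covector A = 0" using scalar_product_nonzero by metis
    thus False using indep3_cross4[OF i] by (simp add: covector_def)
  qed
qed

lemma covector_image: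
  assumes "invertible (A::'a::field^4^4)"
  shows "covector A \<diamondop> (A *v x) = 0 \<longleftrightarrow> x$4 = 0"
  using invertible_columns(2)[OF assms]
  by (simp add: matrix_vector_mult_columns covector_def scalar_product_add_right scalar_product_scale_right)

lemma dim_image_invertible:
  assumes "invertible (A::'a::field^'n^'n)"
  shows "vec.dim ((*v) A ` W) = vec.dim W"
proof (rule vec.dim_image_eq[OF matrix_vector_mul_linear_gen])
  show "inj_on ((*v) A) (vec.span W)"
  proof (rule inj_onI)
    fix x y assume "A *v x = A *v y"
    hence "A *v (x - y) = 0" by (simp add: matrix_vector_mult_diff_distrib)
    thus "x = y" using invertible_kernel[OF assms] by fastforce
  qed
qed

lemma grassmannian_image_invertible:
  assumes "invertible (A::complex^'n^'n)"
  shows "(*v) A ` W \<in> grassmannian k \<longleftrightarrow> W \<in> grassmannian k"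
proof
  assume W: "W \<in> grassmannian k"
  have "vec.subspace ((*v) A ` W)"
    by (rule vec.linear_subspace_image[OF matrix_vector_mul_linear_gen grassmannian_subspace[OF W]])
  thus "(*v) A ` W \<in> grassmannian k"
    using W dim_image_invertible[OF assms, of W] by (simp add: grassmannian_def)
next
  assume a: "(*v) A ` W \<in> grassmannian k"
  obtain B where B: "B ** A = Finite_Cartesian_Product.mat 1" using assms unfolding invertible_def by blast
  have "vec.subspace ((*v) B ` ((*v) A ` W))"
    by (rule vec.linear_subspace_image[OF matrix_vector_mul_linear_gen grassmannian_subspace[OF a]])
  moreover have "B *v (A *v x) = x" for x unfolding matrix_vector_mul_assoc B by simp
  ultimately have "vec.subspace W" by (simp add: image_image)
  thus "W \<in> grassmannian k"
    using a dim_image_invertible[OF assms, of W] by (simp add: grassmannian_def)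
qed

lemma schubert_translate_iff:
  assumes A: "invertible A" and c: "c \<in> {2, 3, 4, 5}"
  shows "W \<in> schubert_translate A c \<longleftrightarrow> W \<in> grassmannian 2 \<and>
    (c \<noteq> 3 \<longrightarrow> column 1 A \<in> W) \<and> (c = 5 \<longrightarrow> column 2 A \<in> W) \<and>
    (c \<in> {3, 4} \<longrightarrow> (\<forall>x\<in>W. covector A \<diamondop> x = 0))"
proof -
  obtain B where B: "B ** A = Finite_Cartesian_Product.mat 1" "A ** B = Finite_Cartesian_Product.mat 1"
    using A unfolding invertible_def by blast
  define P where "P = (*v) B ` W"
  have AB: "A *v (B *v x) = x" "B *v (A *v x) = x" for x by (simp_all add: matrix_vector_mul_assoc B)
  have W: "W = (*v) A ` P" by (simp add: P_def image_image AB)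
  have "W \<in> schubert_translate A c \<longleftrightarrow> P \<in> schubert_variety (young_diagram c)"
  proof
    assume "W \<in> schubert_translate A c"
    then obtain P' where "P' \<in> schubert_variety (young_diagram c)" "W = (*v) A ` P'"
      unfolding schubert_translate_def by blast
    moreover from this have "P = P'" by (simp add: P_def image_image AB)
    ultimately show "P \<in> schubert_variety (young_diagram c)" by simp
  next
    assume "P \<in> schubert_variety (young_diagram c)"
    thus "W \<in> schubert_translate A c" unfolding schubert_translate_def W by blast
  qed
  moreover have "column j A \<in> W \<longleftrightarrow> axis j 1 \<in> P" for j
  proof -
    have "column j A = A *v axis j 1" 
      using exhaust_4[of j] by (elim disjE) (simp_all add: matrix_vector_mult_columns axis_4_components)
    moreover have "A *v a \<in> (*v) A ` P \<longleftrightarrow> a \<in> P" for a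
    proof
      assume "A *v a \<in> (*v) A ` P"
      then obtain p where p: "p \<in> P" "A *v a = A *v p" by blast
      have "a = B *v (A *v a)" by (rule AB(2)[symmetric])
      also have "\<dots> = p" unfolding p(2) by (rule AB(2))
      finally show "a \<in> P" using p(1) by simp
    qed blast
    ultimately show ?thesis unfolding W by (simp only:)
  qed
  moreover have "(\<forall>x\<in>W. covector A \<diamondop> x = 0) \<longleftrightarrow> (\<forall>x\<in>P. x$4 = 0)"
    unfolding W by (simp add: covector_image[OF A])
  moreover have "W \<in> grassmannian 2 \<longleftrightarrow> P \<in> grassmannian 2"
    unfolding W by (rule grassmannian_image_invertible[OF A])
  ultimately show ?thesis using schubert_variety_iff[OF c] by simp
qed

section \<open>The Gromov-Witten numbers of degree one\<close>

text \<open>The planes on the sought line have to contain the points \<open>p i\<close> for \<open>i \<in> A\<close> and to satisfy the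
  equations \<open>\<phi> j\<close> for \<open>j \<in> B\<close>; an index in both sets imposes both conditions on the same plane. The
  notion is symmetric under projective duality, which exchanges points and equations.\<close>

definition flag_config :: "nat set \<Rightarrow> nat set \<Rightarrow> (nat \<Rightarrow> complex^4) \<Rightarrow> (nat \<Rightarrow> complex^4) \<Rightarrow> complex^4 \<Rightarrow> complex^4 \<Rightarrow> bool" where
  "flag_config A B p \<phi> v \<psi> \<longleftrightarrow> v \<noteq> 0 \<and> \<psi> \<noteq> 0 \<and> \<psi> \<diamondop> v = 0
     \<and> (\<forall>i\<in>A. \<psi> \<diamondop> p i = 0) \<and> (\<forall>j\<in>B. \<phi> j \<diamondop> v = 0)
     \<and> (\<forall>i\<in>A. indep2 v (p i)) \<and> (\<forall>j\<in>B. indep2 \<psi> (\<phi> j))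
     \<and> (\<forall>i\<in>A. \<forall>j\<in>A. i \<noteq> j \<longrightarrow> indep3 v (p i) (p j))
     \<and> (\<forall>i\<in>B. \<forall>j\<in>B. i \<noteq> j \<longrightarrow> indep3 \<psi> (\<phi> i) (\<phi> j))
     \<and> (\<forall>i\<in>A. \<forall>j\<in>B. i \<noteq> j \<longrightarrow> \<phi> j \<diamondop> p i \<noteq> 0) \<and> (\<forall>i\<in>A \<inter> B. \<phi> i \<diamondop> p i = 0)
     \<and> (\<forall>v' \<psi>'. v' \<noteq> 0 \<longrightarrow> \<psi>' \<noteq> 0 \<longrightarrow> \<psi>' \<diamondop> v' = 0 \<longrightarrow> (\<forall>i\<in>A. \<psi>' \<diamondop> p i = 0) \<longrightarrow>
          (\<forall>j\<in>B. \<phi> j \<diamondop> v' = 0) \<longrightarrow> v' \<in> vec.span {v} \<and> \<psi>' \<in> vec.span {\<psi>})"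

lemma flag_configD:
  assumes "flag_config A B p \<phi> v \<psi>"
  shows "v \<noteq> 0" "\<psi> \<noteq> 0" "\<psi> \<diamondop> v = 0" "\<And>i. i \<in> A \<Longrightarrow> \<psi> \<diamondop> p i = 0" "\<And>j. j \<in> B \<Longrightarrow> \<phi> j \<diamondop> v = 0"
    "\<And>i. i \<in> A \<Longrightarrow> indep2 v (p i)" "\<And>j. j \<in> B \<Longrightarrow> indep2 \<psi> (\<phi> j)"
    "\<And>i j. i \<in> A \<Longrightarrow> j \<in> A \<Longrightarrow> i \<noteq> j \<Longrightarrow> indep3 v (p i) (p j)"
    "\<And>i j. i \<in> B \<Longrightarrow> j \<in> B \<Longrightarrow> i \<noteq> j \<Longrightarrow> indep3 \<psi> (\<phi> i) (\<phi> j)"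
    "\<And>i j. i \<in> A \<Longrightarrow> j \<in> B \<Longrightarrow> i \<noteq> j \<Longrightarrow> \<phi> j \<diamondop> p i \<noteq> 0"
    "\<And>i. i \<in> A \<Longrightarrow> i \<in> B \<Longrightarrow> \<phi> i \<diamondop> p i = 0"
    "\<And>v' \<psi>'. v' \<noteq> 0 \<Longrightarrow> \<psi>' \<noteq> 0 \<Longrightarrow> \<psi>' \<diamondop> v' = 0 \<Longrightarrow> \<forall>i\<in>A. \<psi>' \<diamondop> p i = 0 \<Longrightarrow>
          \<forall>j\<in>B. \<phi> j \<diamondop> v' = 0 \<Longrightarrow> v' \<in> vec.span {v} \<and> \<psi>' \<in> vec.span {\<psi>}"
  using assms by (simp_all add: flag_config_def)

lemma flag_config_dual:
  assumes "flag_config A B p \<phi> v \<psi>" shows "flag_config B A \<phi> p \<psi> v"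
  unfolding flag_config_def
proof (intro conjI)
  show "\<forall>v' \<psi>'. v' \<noteq> 0 \<longrightarrow> \<psi>' \<noteq> 0 \<longrightarrow> \<psi>' \<diamondop> v' = 0 \<longrightarrow> (\<forall>i\<in>B. \<psi>' \<diamondop> \<phi> i = 0) \<longrightarrow>
          (\<forall>j\<in>A. p j \<diamondop> v' = 0) \<longrightarrow> v' \<in> vec.span {\<psi>} \<and> \<psi>' \<in> vec.span {v}"
    using assms unfolding flag_config_def by (metis scalar_product_commute)
  show "v \<diamondop> \<psi> = 0" "\<forall>i\<in>B. v \<diamondop> \<phi> i = 0" "\<forall>j\<in>A. p j \<diamondop> \<psi> = 0"
    "\<forall>i\<in>B. \<forall>j\<in>A. i \<noteq> j \<longrightarrow> p j \<diamondop> \<phi> i \<noteq> 0" "\<forall>i\<in>B \<inter> A. p i \<diamondop> \<phi> i = 0"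
    using assms unfolding flag_config_def by (metis scalar_product_commute Int_commute)+
qed (use assms in \<open>simp_all add: flag_config_def\<close>)

text \<open>A 2 x 2 minor of the matrix of all values of equations at points. Its nonvanishing
  serves both ways: it excludes relations between two equations modulo \<open>\<psi>\<close> and
  between two points modulo \<open>v\<close>.\<close>

definition pairing_minor :: "(nat \<Rightarrow> complex^4) \<Rightarrow> (nat \<Rightarrow> complex^4) \<Rightarrow> nat \<Rightarrow> nat \<Rightarrow> nat \<Rightarrow> nat \<Rightarrow> complex" where
  "pairing_minor p \<phi> k l i j = (\<phi> k \<diamondop> p i) * (\<phi> l \<diamondop> p j) - (\<phi> k \<diamondop> p j) * (\<phi> l \<diamondop> p i)"

lemma minor_nonzero_kernel:
  fixes a b c d x y :: "'a::field"
  assumes "a * d - b * c \<noteq> 0" "a * x + b * y = 0" "c * x + d * y = 0"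
  shows "x = 0 \<and> y = 0"
proof -
  have "(a * d - b * c) * x = d * (a * x + b * y) - b * (c * x + d * y)"
    "(a * d - b * c) * y = a * (c * x + d * y) - c * (a * x + b * y)"
    by (simp_all add: algebra_simps)
  hence "(a * d - b * c) * x = 0" "(a * d - b * c) * y = 0" unfolding assms(2,3) by simp_all
  thus ?thesis using assms(1) by simp
qed

text \<open>Three points determine \<open>\<psi>\<close>, and \<open>\<psi>\<close> with the two
  equations determines \<open>v\<close>. Pairing a relation among \<open>\<psi>\<close>,
  \<open>\<phi> k\<close>, \<open>\<phi> l\<close> with two of the points removes
  \<open>\<psi>\<close> and leaves a 2 x 2 system with nonzero minor; for \<open>v\<close> and two
  points the two equations take that part.\<close>

lemma flag_config_exists:
  assumes A: "A = {i1, i2, i3}" "i1 \<noteq> i2" "i1 \<noteq> i3" "i2 \<noteq> i3" and B: "B = {k, l}" "k \<noteq> l"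
    and p: "indep3 (p i1) (p i2) (p i3)"
    and ne: "\<And>i j. i \<in> A \<Longrightarrow> j \<in> B \<Longrightarrow> i \<noteq> j \<Longrightarrow> \<phi> j \<diamondop> p i \<noteq> 0"
    and eq: "\<And>i. i \<in> A \<Longrightarrow> i \<in> B \<Longrightarrow> \<phi> i \<diamondop> p i = 0"
    and minor: "\<And>i j. i \<in> A \<Longrightarrow> j \<in> A \<Longrightarrow> i \<noteq> j \<Longrightarrow> pairing_minor p \<phi> k l i j \<noteq> 0"
  obtains v \<psi> where "flag_config A B p \<phi> v \<psi>"
proof -
  obtain \<psi> where \<psi>: "\<psi> \<noteq> 0" "p i1 \<diamondop> \<psi> = 0" "p i2 \<diamondop> \<psi> = 0" "p i3 \<diamondop> \<psi> = 0"
    "\<And>x. p i1 \<diamondop> x = 0 \<Longrightarrow> p i2 \<diamondop> x = 0 \<Longrightarrow> p i3 \<diamondop> x = 0 \<Longrightarrow> x \<in> vec.span {\<psi>}"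
    using kernel3_line[OF p] by blast
  have \<psi>p: "\<psi> \<diamondop> p i = 0" if "i \<in> A" for i
    using that \<psi>(2-4) unfolding A(1) by (auto simp: scalar_product_commute[of \<psi>])
  have i\<psi>: "indep3 \<psi> (\<phi> k) (\<phi> l)"
    unfolding indep3_def
  proof (intro allI impI)
    fix a b c assume 0: "a *s \<psi> + b *s \<phi> k + c *s \<phi> l = 0"
    have z: "(\<phi> k \<diamondop> p i) * b + (\<phi> l \<diamondop> p i) * c = 0" if "i \<in> A" for i
      using arg_cong[OF 0, of "\<lambda>x. x \<diamondop> p i"] \<psi>p[OF that]
      by (simp add: scalar_product_add_left scalar_product_scale_left mult.commute)
    have "b = 0 \<and> c = 0"
      by (rule minor_nonzero_kernel[OF _ z[of i1] z[of i2]])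
        (use minor[of i1 i2] A in \<open>auto simp: pairing_minor_def algebra_simps\<close>)
    with 0 \<psi>(1) show "a = 0 \<and> b = 0 \<and> c = 0" by simp
  qed
  hence i\<psi>': "indep3 \<psi> (\<phi> l) (\<phi> k)"
    unfolding indep3_def by (metis (no_types, lifting) add.assoc add.commute)
  obtain v where v: "v \<noteq> 0" "\<psi> \<diamondop> v = 0" "\<phi> k \<diamondop> v = 0" "\<phi> l \<diamondop> v = 0"
    "\<And>x. \<psi> \<diamondop> x = 0 \<Longrightarrow> \<phi> k \<diamondop> x = 0 \<Longrightarrow> \<phi> l \<diamondop> x = 0 \<Longrightarrow> x \<in> vec.span {v}"
    using kernel3_line[OF i\<psi>] by blast
  have iv: "indep3 v (p i) (p j)" if ij: "i \<in> A" "j \<in> A" "i \<noteq> j" for i j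
    unfolding indep3_def
  proof (intro allI impI)
    fix a b c assume 0: "a *s v + b *s p i + c *s p j = 0"
    have z: "(\<phi> k \<diamondop> p i) * b + (\<phi> k \<diamondop> p j) * c = 0" "(\<phi> l \<diamondop> p i) * b + (\<phi> l \<diamondop> p j) * c = 0"
      using arg_cong[OF 0, of "\<lambda>x. \<phi> k \<diamondop> x"] arg_cong[OF 0, of "\<lambda>x. \<phi> l \<diamondop> x"] v
      by (simp_all add: scalar_product_add_right scalar_product_scale_right mult.commute)
    have "b = 0 \<and> c = 0"
      by (rule minor_nonzero_kernel[OF _ z]) (use minor[OF ij] in \<open>auto simp: pairing_minor_def algebra_simps\<close>)
    with 0 v(1) show "a = 0 \<and> b = 0 \<and> c = 0" by simp
  qed
  have iv2: "indep2 v (p i)" if "i \<in> A" for i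
  proof -
    have "\<exists>j\<in>A. i \<noteq> j" using that A(2) unfolding A(1) by (cases "i = i1") auto
    thus ?thesis using iv[OF that] indep3D(1) by blast
  qed
  have uniq: "v' \<in> vec.span {v} \<and> \<psi>' \<in> vec.span {\<psi>}"
    if h: "v' \<noteq> 0" "\<psi>' \<noteq> 0" "\<psi>' \<diamondop> v' = 0" "\<forall>i\<in>A. \<psi>' \<diamondop> p i = 0" "\<forall>j\<in>B. \<phi> j \<diamondop> v' = 0" for v' \<psi>'
  proof
    show s: "\<psi>' \<in> vec.span {\<psi>}"
      by (rule \<psi>(5)) (use h(4) A in \<open>auto simp: scalar_product_commute[of _ \<psi>']\<close>)
    then obtain c where c: "\<psi>' = c *s \<psi>" unfolding in_span1 by blast
    with h(2,3) have "\<psi> \<diamondop> v' = 0" by (auto simp: scalar_product_scale_left)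
    thus "v' \<in> vec.span {v}" using v(5) h(5) B by blast
  qed
  have "flag_config A B p \<phi> v \<psi>"
    unfolding flag_config_def
    using v(1-4) \<psi>(1) \<psi>p iv iv2 uniq i\<psi> i\<psi>' indep3D(1)[OF i\<psi>] indep3D(1)[OF i\<psi>'] ne eq B
    by (intro conjI ballI allI impI) (auto simp del: One_nat_def)
  with that show thesis .
qed

lemma incidentD:
  assumes "incident cs g v \<psi>" "\<And>i. i < length cs \<Longrightarrow> invertible (g i)" "set cs \<subseteq> {2, 3, 4, 5}" "i < length cs"
  shows "v \<noteq> 0" "\<psi> \<noteq> 0" "\<psi> \<diamondop> v = 0"
    "cs ! i \<noteq> 3 \<Longrightarrow> \<psi> \<diamondop> column 1 (g i) = 0"
    "cs ! i = 5 \<Longrightarrow> \<psi> \<diamondop> column 2 (g i) = 0"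
    "cs ! i \<in> {3, 4} \<Longrightarrow> covector (g i) \<diamondop> v = 0"
    "cs ! i = 5 \<Longrightarrow> v \<in> vec.span {column 1 (g i), column 2 (g i)}"
proof -
  show "v \<noteq> 0" "\<psi> \<noteq> 0" "\<psi> \<diamondop> v = 0" using assms(1) by (simp_all add: incident_def)
  obtain W where W: "in_line v \<psi> W" "W \<in> schubert_translate (g i) (cs ! i)"
    using assms(1,4) unfolding incident_def by blast
  have c: "cs ! i \<in> {2, 3, 4, 5}" using assms(3) nth_mem[OF assms(4)] by (rule subsetD)
  note W' = W(2)[unfolded schubert_translate_iff[OF assms(2)[OF assms(4)] c]]
  have Wl: "W \<in> grassmannian 2" "v \<in> W" "\<And>w. w \<in> W \<Longrightarrow> \<psi> \<diamondop> w = 0"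
    using W(1) unfolding in_line_def by blast+
  have W1: "cs ! i \<noteq> 3 \<Longrightarrow> column 1 (g i) \<in> W" and W2: "cs ! i = 5 \<Longrightarrow> column 2 (g i) \<in> W"
    and W3: "cs ! i \<in> {3, 4} \<Longrightarrow> \<forall>x\<in>W. covector (g i) \<diamondop> x = 0"
    by (rule W'[THEN conjunct2, THEN conjunct1, THEN mp]
        W'[THEN conjunct2, THEN conjunct2, THEN conjunct1, THEN mp]
        W'[THEN conjunct2, THEN conjunct2, THEN conjunct2, THEN mp]; assumption)+
  show "cs ! i \<noteq> 3 \<Longrightarrow> \<psi> \<diamondop> column 1 (g i) = 0" by (rule Wl(3)) (rule W1)
  show "cs ! i = 5 \<Longrightarrow> \<psi> \<diamondop> column 2 (g i) = 0" by (rule Wl(3)) (rule W2)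
  show "cs ! i \<in> {3, 4} \<Longrightarrow> covector (g i) \<diamondop> v = 0" using W3 Wl(2) by (rule bspec)
  assume 5: "cs ! i = 5"
  have "W = vec.span {column 1 (g i), column 2 (g i)}"
    by (rule grassmannian_eq_span2)
      (use 5 W1 W2 Wl indep3D(1)[OF invertible_columns(1)[OF assms(2)[OF assms(4)]]] in \<open>simp_all\<close>)
  thus "v \<in> vec.span {column 1 (g i), column 2 (g i)}" using Wl(2) by simp
qed

text \<open>Each plane is forced: a point condition makes it the span of \<open>v\<close> and the
  point, an equation makes it the common kernel with \<open>\<psi>\<close>. Two equal planes would
  contain three independent vectors, satisfy three independent equations, or contain a point at
  which an equation is nonzero.\<close>

lemma sphere_classes_flag_config:
  assumes g: "\<And>i. i < length cs \<Longrightarrow> invertible (g i)" and cs: "set cs \<subseteq> {2, 3, 4}"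
    and A: "A = {i. i < length cs \<and> cs ! i \<noteq> 3}" and B: "B = {i. i < length cs \<and> cs ! i \<noteq> 2}"
    and conf: "flag_config A B (\<lambda>i. column 1 (g i)) (\<lambda>i. covector (g i)) v \<psi>"
  shows "finite (sphere_classes 1 cs g) \<and> card (sphere_classes 1 cs g) = 1"
proof -
  let ?p = "\<lambda>i. column 1 (g i)" and ?\<phi> = "\<lambda>i. covector (g i)"
  have cs': "set cs \<subseteq> {2, 3, 4, 5}" using cs by blast
  have c: "cs ! i \<in> {2, 3, 4, 5}" "cs ! i \<noteq> 5" if "i < length cs" for i
    using cs nth_mem[OF that] by auto
  have AB: "i \<in> A \<or> i \<in> B" if "i < length cs" for i using that by (auto simp: A B)
  note v = flag_configD(1-5)[OF conf] and i2 = flag_configD(6,7)[OF conf]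
    and i3 = flag_configD(8,9)[OF conf] and ne = flag_configD(10)[OF conf]
    and eq = flag_configD(11)[OF conf] and uniq = flag_configD(12)[OF conf]
  have tr: "W \<in> schubert_translate (g i) (cs ! i) \<longleftrightarrow> W \<in> grassmannian 2 \<and>
      (i \<in> A \<longrightarrow> ?p i \<in> W) \<and> (i \<in> B \<longrightarrow> (\<forall>x\<in>W. ?\<phi> i \<diamondop> x = 0))" if "i < length cs" for i W
  proof -
    have "(i \<in> A) = (cs ! i \<noteq> 3)" "(i \<in> B) = (cs ! i \<in> {3, 4})" "(cs ! i = 5) = False"
      using c[OF that] that by (auto simp: A B)
    thus ?thesis unfolding schubert_translate_iff[OF g[OF that] c(1)[OF that]] by (simp only: simp_thms)
  qed
  define W where "W i = (if i \<in> A then vec.span {v, ?p i} else {x. \<psi> \<diamondop> x = 0 \<and> ?\<phi> i \<diamondop> x = 0})" for i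
  have W: "in_line v \<psi> (W i) \<and> W i \<in> schubert_translate (g i) (cs ! i)" if i: "i < length cs" for i
  proof (cases "i \<in> A")
    case True
    have span0: "\<theta> \<diamondop> x = 0" if "\<theta> \<diamondop> v = 0" "\<theta> \<diamondop> ?p i = 0" "x \<in> vec.span {v, ?p i}" for x \<theta>
      using that unfolding in_span2 by (auto simp: scalar_product_add_right scalar_product_scale_right)
    have "in_line v \<psi> (vec.span {v, ?p i})"
      unfolding in_line_def using grassmannian_span2[OF i2(1)[OF True]] span0[OF v(3) v(4)[OF True]]
      by (simp add: vec.span_base)
    moreover have "\<forall>x\<in>vec.span {v, ?p i}. ?\<phi> i \<diamondop> x = 0" if "i \<in> B"
      using span0[OF v(5)[OF that] eq[OF True that]] by blast
    moreover have "?p i \<in> vec.span {v, ?p i}" by (rule vec.span_base) simp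
    moreover have "W i = vec.span {v, ?p i}" using True by (simp add: W_def)
    ultimately show ?thesis
      unfolding tr[OF i] using grassmannian_span2[OF i2(1)[OF True]] by simp
  next
    case False
    hence B: "i \<in> B" using AB[OF i] by blast
    have "W i = {x. \<psi> \<diamondop> x = 0 \<and> ?\<phi> i \<diamondop> x = 0}" using False by (simp add: W_def)
    thus ?thesis
      unfolding tr[OF i] in_line_def using False kernel2_grassmannian[OF i2(2)[OF B]] v(3) v(5)[OF B] by simp
  qed
  have W_uniq: "W' = W i" if i: "i < length cs" and W': "in_line v \<psi> W'" "W' \<in> schubert_translate (g i) (cs ! i)" for i W'
  proof (cases "i \<in> A")
    case True
    have "W' = vec.span {v, ?p i}"
      by (rule grassmannian_eq_span2[OF _ _ _ i2(1)[OF True]])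
        (use W'(1) W'(2)[unfolded tr[OF i]] True in \<open>auto simp: in_line_def\<close>)
    thus ?thesis using True by (simp add: W_def)
  next
    case False
    hence B: "i \<in> B" using AB[OF i] by blast
    have "W' = {x. \<psi> \<diamondop> x = 0 \<and> ?\<phi> i \<diamondop> x = 0}"
      by (rule grassmannian_eq_kernel2[OF _ i2(2)[OF B]])
        (use W'(1) W'(2)[unfolded tr[OF i]] B in \<open>auto simp: in_line_def\<close>)
    thus ?thesis using False by (simp add: W_def)
  qed
  have W_inj: "inj_on W {..<length cs}"
  proof (rule inj_onI, rule ccontr)
    fix i j assume ij: "i \<in> {..<length cs}" "j \<in> {..<length cs}" "W i = W j" "i \<noteq> j"
    have i: "i < length cs" and j: "j < length cs" using ij by auto
    have Wi: "W i \<in> grassmannian 2" "v \<in> W i" "\<forall>w\<in>W i. \<psi> \<diamondop> w = 0"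
      using W[OF i] by (simp_all add: in_line_def)
    have A': "h \<in> A \<Longrightarrow> ?p h \<in> W i" "h \<in> B \<Longrightarrow> \<forall>w\<in>W i. ?\<phi> h \<diamondop> w = 0" if "h \<in> {i, j}" for h
      using W[OF i] W[OF j] that ij(3) unfolding tr[OF i] tr[OF j] by auto
    consider "i \<in> A" "j \<in> A" | "i \<in> A" "j \<in> B" | "i \<in> B" "j \<in> A" | "i \<in> B" "j \<in> B"
      using AB[OF i] AB[OF j] by blast
    thus False
    proof cases
      case 1
      thus False using grassmannian_not_indep3[OF Wi(1,2) A'(1) A'(1)] i3(1) ij(4) by blast
    next
      case 2
      thus False using ne A' ij(4) by blast
    next
      case 3
      thus False using ne A' ij(4) by blast
    next
      case 4
      thus False using grassmannian_not_annihilated3[OF Wi(1,3) A'(2) A'(2)] i3(2) ij(4) by blast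
    qed
  qed
  have inc: "incident cs g v \<psi>" unfolding incident_def using v(1-3) W by blast
  have "v' \<in> vec.span {v} \<and> \<psi>' \<in> vec.span {\<psi>}" if i: "incident cs g v' \<psi>'" for v' \<psi>'
  proof (rule uniq)
    show "v' \<noteq> 0" "\<psi>' \<noteq> 0" "\<psi>' \<diamondop> v' = 0" using i by (simp_all add: incident_def)
    show "\<forall>i\<in>A. \<psi>' \<diamondop> ?p i = 0" using incidentD(4)[OF i g cs'] by (auto simp: A)
    show "\<forall>j\<in>B. ?\<phi> j \<diamondop> v' = 0" using incidentD(6)[OF i g cs'] c by (force simp: B)
  qed
  from sphere_classes_singleton[OF inc this W W_uniq W_inj] show ?thesis .
qed

section \<open>Polynomials expressing general position\<close>

lemma poly_vec_covector: "i < n \<Longrightarrow> poly_vec n (\<lambda>g. covector (g i))"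
  unfolding covector_def by (intro poly_vec_cross4 poly_vec_column)

lemmas poly_fun_intros = poly_fun_diff poly_fun.add poly_fun.mult poly_fun_det4 poly_fun_scalar_product
  poly_vec_const poly_vec_column poly_vec_covector

text \<open>Source of the witnesses: for distinct indices the columns are unit vectors, and the
  covector is, up to sign, the unit vector of index \<open>d\<close>.\<close>

definition basis_matrix :: "4 \<Rightarrow> 4 \<Rightarrow> 4 \<Rightarrow> 4 \<Rightarrow> complex^4^4" where
  "basis_matrix a b c d = (\<chi> r s. if r = (if s = 1 then a else if s = 2 then b else if s = 3 then c else d) then 1 else 0)"

lemma column_basis_matrix:
  "column 1 (basis_matrix a b c d) = axis a 1" "column 2 (basis_matrix a b c d) = axis b 1"
  "column 3 (basis_matrix a b c d) = axis c 1" "column 4 (basis_matrix a b c d) = axis d 1"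
  by (simp_all add: basis_matrix_def column_def axis_def)

lemma covector_basis_matrix_scalar_product:
  "covector (basis_matrix a b c d) \<diamondop> w = det4 (axis a 1) (axis b 1) (axis c 1) w"
  by (simp add: covector_def column_basis_matrix cross4_scalar_product)

lemma covector_basis_matrix_component:
  "covector (basis_matrix a b c d) $ k = det4 (axis a 1) (axis b 1) (axis c 1) (axis k 1)"
  by (simp add: covector_def column_basis_matrix cross4_def)

lemmas witness_simps = column_basis_matrix covector_basis_matrix_scalar_product
  covector_basis_matrix_component det4_def axis_4_components

text \<open>The vector \<open>axis 4 1\<close> fills the fourth place: one minor of the three points
  is a single polynomial, and its nonvanishing suffices for their independence.\<close>

lemma nonzero_poly_points3:
  assumes "i < n" "j < n" "k < n" "i \<noteq> j" "i \<noteq> k" "j \<noteq> k"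
  shows "nonzero_poly n (\<lambda>g. det4 (column 1 (g i)) (column 1 (g j)) (column 1 (g k)) (axis 4 1))"
  by (rule nonzero_polyI[where g = "\<lambda>x. if x = i then basis_matrix 1 2 3 4 else
       if x = j then basis_matrix 2 1 3 4 else basis_matrix 3 1 2 4"], intro poly_fun_intros assms)
    (use assms in \<open>simp_all add: witness_simps\<close>)

lemma nonzero_poly_points4:
  assumes "i < n" "j < n" "k < n" "l < n" "i \<noteq> j" "i \<noteq> k" "j \<noteq> k" "i \<noteq> l" "j \<noteq> l" "k \<noteq> l"
  shows "nonzero_poly n (\<lambda>g. det4 (column 1 (g i)) (column 1 (g j)) (column 1 (g k)) (column 1 (g l)))"
  by (rule nonzero_polyI[where g = "\<lambda>x. if x = i then basis_matrix 1 2 3 4 else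
       if x = j then basis_matrix 2 1 3 4 else if x = k then basis_matrix 3 1 2 4 else basis_matrix 4 1 2 3"], intro poly_fun_intros assms)
    (use assms in \<open>simp_all add: witness_simps\<close>)

lemma nonzero_poly_covectors3:
  assumes "i < n" "j < n" "k < n" "i \<noteq> j" "i \<noteq> k" "j \<noteq> k"
  shows "nonzero_poly n (\<lambda>g. det4 (covector (g i)) (covector (g j)) (covector (g k)) (axis 4 1))"
  by (rule nonzero_polyI[where g = "\<lambda>x. if x = i then basis_matrix 2 3 4 1 else
       if x = j then basis_matrix 1 3 4 2 else basis_matrix 1 2 4 3"], intro poly_fun_intros assms)
    (use assms in \<open>simp_all add: witness_simps\<close>)

lemma nonzero_poly_covectors4:
  assumes "i < n" "j < n" "k < n" "l < n" "i \<noteq> j" "i \<noteq> k" "j \<noteq> k" "i \<noteq> l" "j \<noteq> l" "k \<noteq> l"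
  shows "nonzero_poly n (\<lambda>g. det4 (covector (g i)) (covector (g j)) (covector (g k)) (covector (g l)))"
  by (rule nonzero_polyI[where g = "\<lambda>x. if x = i then basis_matrix 2 3 4 1 else
       if x = j then basis_matrix 1 3 4 2 else if x = k then basis_matrix 1 2 4 3 else basis_matrix 1 2 3 4"], intro poly_fun_intros assms)
    (use assms in \<open>simp_all add: witness_simps\<close>)

lemma nonzero_poly_pairing:
  assumes "i < n" "j < n" "i \<noteq> j"
  shows "nonzero_poly n (\<lambda>g. covector (g j) \<diamondop> column 1 (g i))"
  by (rule nonzero_polyI[where g = "\<lambda>x. if x = i then basis_matrix 4 1 2 3 else basis_matrix 1 2 3 4"], intro poly_fun_intros assms)
    (use assms in \<open>simp_all add: witness_simps\<close>)

lemma nonzero_poly_minor: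
  assumes "i < n" "j < n" "k < n" "l < n" "i \<noteq> j" "k \<noteq> l"
  shows "nonzero_poly n (\<lambda>g. pairing_minor (\<lambda>i. column 1 (g i)) (\<lambda>i. covector (g i)) k l i j)"
proof -
  have "\<exists>g. pairing_minor (\<lambda>i. column 1 (g i)) (\<lambda>i. covector (g i)) k l i j \<noteq> 0"
  \<comment> \<open>The indices may overlap, and a covector kills the first column of its own
    matrix. If \<open>k = j\<close> or \<open>l = i\<close>, the second product of the minor is
    identically zero and the witness makes the first one nonzero; otherwise it makes the second one
    nonzero.\<close>
  proof (cases "k = j \<or> l = i")
    case True
    thus ?thesis
      by (intro exI[of _ "\<lambda>x. if x = j \<or> x = k then basis_matrix 3 1 2 4 else basis_matrix 4 1 2 3"])
        (use assms in \<open>auto simp: pairing_minor_def witness_simps\<close>)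
  next
    case False
    thus ?thesis
      by (intro exI[of _ "\<lambda>x. if x = i \<or> x = k then basis_matrix 3 1 2 4 else basis_matrix 4 1 2 3"])
        (use assms in \<open>auto simp: pairing_minor_def witness_simps\<close>)
  qed
  moreover have "poly_fun n (\<lambda>g. pairing_minor (\<lambda>i. column 1 (g i)) (\<lambda>i. covector (g i)) k l i j)"
    unfolding pairing_minor_def using assms by (intro poly_fun_intros) simp_all
  ultimately show ?thesis unfolding nonzero_poly_def by blast
qed

lemma nonzero_poly_points_plane:
  assumes "i < n" "j < n" "m < n" "i \<noteq> j" "i \<noteq> m" "j \<noteq> m"
  shows "nonzero_poly n (\<lambda>g. det4 (column 1 (g i)) (column 1 (g j)) (column 1 (g m)) (column 2 (g m)))"
  by (rule nonzero_polyI[where g = "\<lambda>x. if x = i then basis_matrix 3 1 2 4 else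
       if x = j then basis_matrix 4 1 2 3 else basis_matrix 1 2 3 4"], intro poly_fun_intros assms)
    (use assms in \<open>simp_all add: witness_simps\<close>)

lemma nonzero_poly_point_plane:
  assumes "i < n" "m < n" "i \<noteq> m"
  shows "nonzero_poly n (\<lambda>g. det4 (column 1 (g i)) (column 1 (g m)) (column 2 (g m)) (axis 4 1))"
  by (rule nonzero_polyI[where g = "\<lambda>x. if x = i then basis_matrix 3 1 2 4 else basis_matrix 1 2 3 4"],
      intro poly_fun_intros assms)
    (use assms in \<open>simp_all add: witness_simps\<close>)

lemma nonzero_poly_covectors_plane:
  assumes "i < n" "j < n" "m < n" "i \<noteq> j" "i \<noteq> m" "j \<noteq> m"
  shows "nonzero_poly n (\<lambda>g. (covector (g i) \<diamondop> column 1 (g m)) * (covector (g j) \<diamondop> column 2 (g m))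
     - (covector (g i) \<diamondop> column 2 (g m)) * (covector (g j) \<diamondop> column 1 (g m)))"
  by (rule nonzero_polyI[where g = "\<lambda>x. if x = i then basis_matrix 2 3 4 1 else
       if x = j then basis_matrix 1 3 4 2 else basis_matrix 1 2 3 4"], intro poly_fun_intros assms)
    (use assms in \<open>simp_all add: witness_simps\<close>)

lemma filter_upt_eqD:
  assumes "filter P [0..<n] = xs" shows "{i. i < n \<and> P i} = set xs" "distinct xs"
  using assms by auto

text \<open>The disjunction covers a situation and its dual at once. The filter equations encode
  index set, size and distinctness in a form that evaluates for concrete constraint lists.\<close>

lemma generically_flag_config:
  fixes p \<phi> :: "complex^4^4 \<Rightarrow> complex^4"
  assumes p\<phi>: "p = column 1 \<and> \<phi> = covector \<or> p = covector \<and> \<phi> = column 1"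
    and P: "filter P [0..<n] = [i1, i2, i3]" and Q: "filter Q [0..<n] = [k, l]"
  shows "generically n (\<lambda>g. (\<forall>i<n. invertible (g i)) \<and>
    (\<exists>v \<psi>. flag_config {i. i < n \<and> P i} {i. i < n \<and> Q i} (\<lambda>i. p (g i)) (\<lambda>i. \<phi> (g i)) v \<psi>))"
proof -
  define I where "I = {i. i < n \<and> P i}"
  define J where "J = {i. i < n \<and> Q i}"
  have I: "I = {i1, i2, i3}" "i1 \<noteq> i2" "i1 \<noteq> i3" "i2 \<noteq> i3"
    using filter_upt_eqD[OF P] by (simp_all add: I_def)
  have J: "J = {k, l}" "k \<noteq> l"
    using filter_upt_eqD[OF Q] by (simp_all add: J_def)
  have len: "\<And>i. i \<in> I \<Longrightarrow> i < n" "\<And>i. i \<in> J \<Longrightarrow> i < n" by (auto simp: I_def J_def)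
  have mem: "i1 \<in> I" "i2 \<in> I" "i3 \<in> I" "k \<in> J" "l \<in> J" unfolding I(1) J(1) by simp_all
  \<comment> \<open>Diagonal pairs are left out, since for an index in both sets the pairing
    vanishes identically.\<close>
  define IJ where "IJ = {(i, j) \<in> I \<times> J. i \<noteq> j}"
  define II where "II = {(i, j) \<in> I \<times> I. i \<noteq> j}"
  have "finite I" "finite J" unfolding I(1) J(1) by simp_all
  hence fin: "finite IJ" "finite II"
    by (auto simp: IJ_def II_def intro: finite_subset[OF _ finite_cartesian_product])
  let ?D = "\<lambda>g. det4 (p (g i1)) (p (g i2)) (p (g i3)) (axis 4 1)"
  let ?m = "\<lambda>g i j. pairing_minor (\<lambda>i. p (g i)) (\<lambda>i. \<phi> (g i)) k l i j"
  have D: "nonzero_poly n ?D"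
    using p\<phi> I(2-4) len mem nonzero_poly_points3[of i1 n i2 i3] nonzero_poly_covectors3[of i1 n i2 i3] by blast
  have pairing: "nonzero_poly n (\<lambda>g. \<phi> (g j) \<diamondop> p (g i))" if "i < n" "j < n" "i \<noteq> j" for i j
    using p\<phi> nonzero_poly_pairing[OF that] nonzero_poly_pairing[OF that(2,1)] that(3)
    by (metis (no_types, lifting) ext scalar_product_commute)
  have minor: "nonzero_poly n (\<lambda>g. ?m g i j)" if "i < n" "j < n" "i \<noteq> j" for i j
  proof -
    have kl: "k < n" "l < n" using len mem by auto
    have "pairing_minor \<alpha> \<beta> k l i j = pairing_minor \<beta> \<alpha> i j k l" for \<alpha> \<beta>
      by (simp add: pairing_minor_def mult.commute scalar_product_commute[of "\<beta> k"] scalar_product_commute[of "\<beta> l"])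
    thus ?thesis
      using p\<phi> nonzero_poly_minor[OF that(1,2) kl that(3) J(2)] nonzero_poly_minor[OF kl that(1,2) J(2) that(3)]
      by auto
  qed
  have "nonzero_poly n (\<lambda>g. ?D g * ((\<Prod>(i, j)\<in>IJ. \<phi> (g j) \<diamondop> p (g i)) * (\<Prod>(i, j)\<in>II. ?m g i j)))"
    unfolding case_prod_unfold
    by (intro nonzero_poly_mult D nonzero_poly_prod pairing minor)
      (use len fin in \<open>auto simp: IJ_def II_def\<close>)
  thus ?thesis unfolding I_def[symmetric] J_def[symmetric]
  proof (rule generically_nonzero_poly)
    fix g :: "nat \<Rightarrow> complex^4^4"
    assume g: "\<And>i. i < n \<Longrightarrow> invertible (g i)"
    assume "?D g * ((\<Prod>(i, j)\<in>IJ. \<phi> (g j) \<diamondop> p (g i)) * (\<Prod>(i, j)\<in>II. ?m g i j)) \<noteq> 0"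
    hence n1: "?D g \<noteq> 0" and n2: "(\<Prod>(i, j)\<in>IJ. \<phi> (g j) \<diamondop> p (g i)) \<noteq> 0"
      and n3: "(\<Prod>(i, j)\<in>II. ?m g i j) \<noteq> 0" by auto
    have n2: "\<phi> (g j) \<diamondop> p (g i) \<noteq> 0" if "i \<in> I" "j \<in> J" "i \<noteq> j" for i j
      using n2 that unfolding prod_zero_iff[OF fin(1)] by (auto simp: IJ_def)
    have n3: "?m g i j \<noteq> 0" if "i \<in> I" "j \<in> I" "i \<noteq> j" for i j
      using n3 that unfolding prod_zero_iff[OF fin(2)] by (auto simp: II_def)
    have "covector A \<diamondop> column 1 A = 0" for A :: "complex^4^4" by (simp add: covector_def)
    hence n4: "\<phi> (g i) \<diamondop> p (g i) = 0" for i using p\<phi> by (metis scalar_product_commute)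
    obtain v \<psi> where "flag_config I J (\<lambda>i. p (g i)) (\<lambda>i. \<phi> (g i)) v \<psi>"
      using flag_config_exists[OF I J det4_nonzero_indep3[OF n1] n2 n4 n3] by blast
    with g show "(\<forall>i<n. invertible (g i)) \<and> (\<exists>v \<psi>. flag_config I J (\<lambda>i. p (g i)) (\<lambda>i. \<phi> (g i)) v \<psi>)" by blast
  qed
qed

lemma gw_number_one_points:
  assumes cs: "set cs \<subseteq> {2, 3, 4}"
    and "filter (\<lambda>i. cs ! i \<noteq> 3) [0..<length cs] = [i1, i2, i3]"
    and "filter (\<lambda>i. cs ! i \<noteq> 2) [0..<length cs] = [k, l]"
  shows "gw_number 1 cs = 1"
proof (rule gw_number_eqI, rule generically_mono[OF generically_flag_config[of "column 1" covector, OF _ assms(2,3)]])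
  fix g :: "nat \<Rightarrow> complex^4^4"
  assume *: "(\<forall>i<length cs. invertible (g i)) \<and> (\<exists>v \<psi>. flag_config {i. i < length cs \<and> cs ! i \<noteq> 3}
    {i. i < length cs \<and> cs ! i \<noteq> 2} (\<lambda>i. column 1 (g i)) (\<lambda>i. covector (g i)) v \<psi>)"
  thus "finite (sphere_classes 1 cs g) \<and> card (sphere_classes 1 cs g) = 1"
    using sphere_classes_flag_config[OF _ cs refl refl] by blast
qed simp

lemma gw_number_one_covectors:
  assumes cs: "set cs \<subseteq> {2, 3, 4}"
    and "filter (\<lambda>i. cs ! i \<noteq> 2) [0..<length cs] = [i1, i2, i3]"
    and "filter (\<lambda>i. cs ! i \<noteq> 3) [0..<length cs] = [k, l]"
  shows "gw_number 1 cs = 1"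
proof (rule gw_number_eqI, rule generically_mono[OF generically_flag_config[of covector "column 1", OF _ assms(2,3)]])
  fix g :: "nat \<Rightarrow> complex^4^4"
  assume *: "(\<forall>i<length cs. invertible (g i)) \<and> (\<exists>v \<psi>. flag_config {i. i < length cs \<and> cs ! i \<noteq> 2}
    {i. i < length cs \<and> cs ! i \<noteq> 3} (\<lambda>i. covector (g i)) (\<lambda>i. column 1 (g i)) v \<psi>)"
  thus "finite (sphere_classes 1 cs g) \<and> card (sphere_classes 1 cs g) = 1"
    using sphere_classes_flag_config[OF _ cs refl refl] flag_config_dual by blast
qed simp

section \<open>Vanishing numbers, and constraints to a fixed plane\<close>

lemma gw_number_zeroI:
  assumes "nonzero_poly (length cs) Q"
    and "\<And>g v \<psi>. (\<And>i. i < length cs \<Longrightarrow> invertible (g i)) \<Longrightarrow> Q g \<noteq> 0 \<Longrightarrow> \<not> incident cs g v \<psi>"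
  shows "gw_number 1 cs = 0"
  by (rule gw_number_eqI, rule generically_nonzero_poly[OF assms(1)], rule sphere_classes_empty, rule assms(2))

text \<open>No hyperplane contains four independent vectors. Index 5 may be among the chosen ones,
  as its plane also contains the first column.\<close>

lemma gw_number_zero_points:
  assumes cs: "set cs \<subseteq> {2, 3, 4, 5}" and d: "distinct [i, j, k, l]"
    and A: "\<And>h. h \<in> {i, j, k, l} \<Longrightarrow> h < length cs \<and> cs ! h \<noteq> 3"
  shows "gw_number 1 cs = 0"
proof (rule gw_number_zeroI[OF nonzero_poly_points4[of i _ j k l]], goal_cases)
  \<comment> \<open>The first ten cases are the index conditions of
    \<open>nonzero_poly_points4\<close>; the eleventh is the incidence.\<close>
  case (11 g v \<psi>)
  show ?case
  proof
    assume inc: "incident cs g v \<psi>"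
    have z: "column 1 (g h) \<diamondop> \<psi> = 0" if "h \<in> {i, j, k, l}" for h
      using incidentD(4)[OF inc 11(1) cs, of h] A[OF that] by (simp add: scalar_product_commute)
    have "\<psi> = 0" by (rule det4_nonzero_kernel[OF 11(2)]) (simp_all add: z)
    thus False using inc by (simp add: incident_def)
  qed
qed (use A d in auto)

lemma gw_number_zero_covectors:
  assumes cs: "set cs \<subseteq> {2, 3, 4, 5}" and d: "distinct [i, j, k, l]"
    and A: "\<And>h. h \<in> {i, j, k, l} \<Longrightarrow> h < length cs \<and> cs ! h \<in> {3, 4}"
  shows "gw_number 1 cs = 0"
proof (rule gw_number_zeroI[OF nonzero_poly_covectors4[of i _ j k l]], goal_cases)
  case (11 g v \<psi>)
  show ?case
  proof
    assume inc: "incident cs g v \<psi>"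
    have z: "covector (g h) \<diamondop> v = 0" if "h \<in> {i, j, k, l}" for h
      using incidentD(6)[OF inc 11(1) cs, of h] A[OF that] by blast
    have "v = 0" by (rule det4_nonzero_kernel[OF 11(2)]) (simp_all add: z)
    thus False using inc by (simp add: incident_def)
  qed
qed (use A d in auto)

text \<open>The hyperplane would have to contain the fixed plane and two more points, four
  independent vectors in all.\<close>

lemma gw_number_2_2_5: "gw_number 1 [2, 2, 5] = 0"
proof (rule gw_number_zeroI[OF nonzero_poly_points_plane[of 0 _ 1 2]], goal_cases)
  case (7 g v \<psi>)
  show ?case
  proof
    assume inc: "incident [2, 2, 5] g v \<psi>"
    note D = incidentD[OF inc 7(1)]
    have "column 1 (g h) \<diamondop> \<psi> = 0" if "h < 3" for h
      using D(4)[of h] that by (auto simp: scalar_product_commute less_Suc_eq numeral_3_eq_3)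
    moreover have "column 2 (g 2) \<diamondop> \<psi> = 0"
      using D(5)[of 2] by (simp add: scalar_product_commute)
    ultimately have "\<psi> = 0" by (intro det4_nonzero_kernel[OF 7(2)]) simp_all
    thus False using inc by (simp add: incident_def)
  qed
qed simp_all

text \<open>The line would have to lie in the fixed plane and in two hyperplanes, whose equations
  restrict to an invertible 2 x 2 system on that plane.\<close>

lemma gw_number_3_3_5: "gw_number 1 [3, 3, 5] = 0"
proof (rule gw_number_zeroI[OF nonzero_poly_covectors_plane[of 0 _ 1 2]], goal_cases)
  case (7 g v \<psi>)
  show ?case
  proof
    assume inc: "incident [3, 3, 5] g v \<psi>"
    note D = incidentD[OF inc 7(1)]
    have z: "covector (g 0) \<diamondop> v = 0" "covector (g 1) \<diamondop> v = 0" using D(6)[of 0] D(6)[of 1] by simp_all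
    have "v \<in> vec.span {column 1 (g 2), column 2 (g 2)}" using D(7)[of 2] by simp
    then obtain a b where v: "v = a *s column 1 (g 2) + b *s column 2 (g 2)" unfolding in_span2 by blast
    have "a = 0 \<and> b = 0"
      by (rule minor_nonzero_kernel[OF 7(2)])
        (use z in \<open>simp_all add: v scalar_product_add_right scalar_product_scale_right mult.commute\<close>)
    thus False using inc v by (simp add: incident_def)
  qed
qed simp_all

text \<open>With \<open>a = b\<close> one index carries both the point and the equation, so the
  constraints \<open>4, 5\<close> and \<open>2, 3, 5\<close> are treated together. The hyperplane is
  spanned by the point and the fixed plane; the line is cut out of the fixed plane by the
  equation.\<close>

lemma gw_number_one_plane:
  assumes cs: "set cs \<subseteq> {2, 3, 4, 5}" and n: "{..<length cs} = {a, b, m}" and m: "a \<noteq> m" "b \<noteq> m" "cs ! m = 5"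
    and ab: "a \<noteq> b \<and> cs ! a = 2 \<and> cs ! b = 3 \<or> a = b \<and> cs ! a = 4"
  shows "gw_number 1 cs = 1"
proof (rule gw_number_eqI)
  have len: "a < length cs" "b < length cs" "m < length cs" using n by auto
  let ?p = "\<lambda>g. column 1 (g a)" and ?\<phi> = "\<lambda>g. covector (g b)"
  let ?c = "\<lambda>g. column 1 (g m)" and ?d = "\<lambda>g. column 2 (g m)"
  \<comment> \<open>For \<open>a \<noteq> b\<close> this pairing separates the planes at
    \<open>a\<close> and \<open>b\<close>; for \<open>a = b\<close> it would be identically
    zero.\<close>
  define Q :: "(nat \<Rightarrow> complex^4^4) \<Rightarrow> complex" where "Q g = (if a = b then 1 else ?\<phi> g \<diamondop> ?p g)" for g
  have "nonzero_poly (length cs) Q"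
  proof (cases "a = b")
    case True
    hence "Q = (\<lambda>_. 1)" by (auto simp: Q_def)
    thus ?thesis using nonzero_polyI[OF poly_fun.const] by simp
  next
    case False
    hence "Q = (\<lambda>g. ?\<phi> g \<diamondop> ?p g)" by (auto simp: Q_def)
    thus ?thesis using nonzero_poly_pairing[OF len(1,2) False] by simp
  qed
  hence Q: "nonzero_poly (length cs) (\<lambda>g. Q g * (det4 (?p g) (?c g) (?d g) (axis 4 1) * (?\<phi> g \<diamondop> ?c g)))"
    by (intro nonzero_poly_mult nonzero_poly_point_plane nonzero_poly_pairing) (use len m in auto)
  show "generically (length cs) (\<lambda>g. finite (sphere_classes 1 cs g) \<and> card (sphere_classes 1 cs g) = 1)"
  proof (rule generically_nonzero_poly[OF Q])
    fix g :: "nat \<Rightarrow> complex^4^4"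
    assume g: "\<And>i. i < length cs \<Longrightarrow> invertible (g i)"
    define p \<phi> c d where "p = ?p g" and "\<phi> = ?\<phi> g" and "c = ?c g" and "d = ?d g"
    assume "Q g * (det4 (?p g) (?c g) (?d g) (axis 4 1) * (?\<phi> g \<diamondop> ?c g)) \<noteq> 0"
    hence i3: "indep3 p c d" and \<phi>c: "\<phi> \<diamondop> c \<noteq> 0" and \<phi>p: "a \<noteq> b \<Longrightarrow> \<phi> \<diamondop> p \<noteq> 0"
      using det4_nonzero_indep3 unfolding p_def \<phi>_def c_def d_def Q_def by (auto split: if_splits)
    have \<phi>p0: "\<phi> \<diamondop> p = 0" if "a = b" unfolding \<phi>_def p_def that covector_def by simp
    note i = indep3D[OF i3]
    obtain \<psi> where \<psi>: "\<psi> \<noteq> 0" "p \<diamondop> \<psi> = 0" "c \<diamondop> \<psi> = 0" "d \<diamondop> \<psi> = 0"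
      "\<And>x. p \<diamondop> x = 0 \<Longrightarrow> c \<diamondop> x = 0 \<Longrightarrow> d \<diamondop> x = 0 \<Longrightarrow> x \<in> vec.span {\<psi>}"
      using kernel3_line[OF i3] by blast
    have \<psi>': "\<psi> \<diamondop> p = 0" "\<psi> \<diamondop> c = 0" "\<psi> \<diamondop> d = 0" using \<psi>(2-4) by (simp_all add: scalar_product_commute)
    \<comment> \<open>The zero of \<open>\<phi>\<close> on the span of \<open>c\<close> and
      \<open>d\<close>, unique up to scale because
      \<open>\<phi> \<diamondop> c \<noteq> 0\<close>.\<close>
    define v where "v = (\<phi> \<diamondop> d) *s c + (- (\<phi> \<diamondop> c)) *s d"
    have v_in: "v \<in> vec.span {c, d}" unfolding v_def in_span2 by blast
    have "v \<noteq> 0"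
    proof
      assume "v = 0"
      hence "\<phi> \<diamondop> d = 0 \<and> - (\<phi> \<diamondop> c) = 0" using i(3) unfolding v_def indep2_def by blast
      thus False using \<phi>c by simp
    qed
    moreover have "\<psi> \<diamondop> v = 0" "\<phi> \<diamondop> v = 0"
      using \<psi>' by (simp_all add: v_def scalar_product_diff_right scalar_product_scale_right)
    ultimately have v: "v \<noteq> 0" "\<psi> \<diamondop> v = 0" "\<phi> \<diamondop> v = 0" .
    have vp: "indep2 v p"
    proof (rule indep2I[OF v(1)])
      have "vec.span {v} \<subseteq> vec.span {c, d}" using v_in by (intro vec.span_minimal) auto
      thus "p \<notin> vec.span {v}" using i(4) by blast
    qed
    have \<psi>\<phi>: "indep2 \<psi> \<phi>"
      unfolding indep2_def
    proof (intro allI impI)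
      fix x y assume 0: "x *s \<psi> + y *s \<phi> = 0"
      have "y * (\<phi> \<diamondop> c) = 0" using arg_cong[OF 0, of "\<lambda>z. z \<diamondop> c"] \<psi>'
        by (simp add: scalar_product_add_left scalar_product_scale_left)
      with \<phi>c 0 \<psi>(1) show "x = 0 \<and> y = 0" by simp
    qed
    have tr: "W \<in> schubert_translate (g m) (cs ! m) \<longleftrightarrow> W \<in> grassmannian 2 \<and> c \<in> W \<and> d \<in> W"
      "W \<in> schubert_translate (g a) (cs ! a) \<longleftrightarrow> W \<in> grassmannian 2 \<and> p \<in> W \<and> (a = b \<longrightarrow> (\<forall>x\<in>W. \<phi> \<diamondop> x = 0))"
      "a \<noteq> b \<Longrightarrow> W \<in> schubert_translate (g b) (cs ! b) \<longleftrightarrow> W \<in> grassmannian 2 \<and> (\<forall>x\<in>W. \<phi> \<diamondop> x = 0)" for W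
      unfolding p_def \<phi>_def c_def d_def
      by (subst schubert_translate_iff[OF g]; use len m ab in force)+
    define W where "W h = (if h = m then vec.span {c, d} else if h = a then vec.span {v, p}
      else {x. \<psi> \<diamondop> x = 0 \<and> \<phi> \<diamondop> x = 0})" for h
    have Wm: "W m = vec.span {c, d}" and Wa: "W a = vec.span {v, p}"
      and Wb: "a \<noteq> b \<Longrightarrow> W b = {x. \<psi> \<diamondop> x = 0 \<and> \<phi> \<diamondop> x = 0}" using m by (auto simp: W_def)
    have cases: "h = m \<or> h = a \<or> h = b \<and> a \<noteq> b" if "h < length cs" for h using n that by auto
    have span0: "\<theta> \<diamondop> x = 0" if "\<theta> \<diamondop> y = 0" "\<theta> \<diamondop> z = 0" "x \<in> vec.span {y, z}" for \<theta> x y z :: "complex^4"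
      using that unfolding in_span2 by (auto simp: scalar_product_add_right scalar_product_scale_right)
    have W: "in_line v \<psi> (W h) \<and> W h \<in> schubert_translate (g h) (cs ! h)" if h: "h < length cs" for h
      using cases[OF h]
    proof (elim disjE conjE)
      assume h: "h = m"
      show ?thesis unfolding h tr Wm in_line_def
        using grassmannian_span2[OF i(3)] v_in span0[OF \<psi>'(2,3)] by (simp add: vec.span_base)
    next
      assume h: "h = a"
      show ?thesis unfolding h tr Wa in_line_def
        using grassmannian_span2[OF vp] span0[OF v(2) \<psi>'(1)] span0[OF v(3) \<phi>p0] by (simp add: vec.span_base)
    next
      assume h: "h = b" and ne: "a \<noteq> b"
      show ?thesis unfolding h tr(3)[OF ne] Wb[OF ne] in_line_def
        using kernel2_grassmannian[OF \<psi>\<phi>] v by simp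
    qed
    have W_uniq: "W' = W h" if h: "h < length cs" and W': "in_line v \<psi> W'" "W' \<in> schubert_translate (g h) (cs ! h)"
      for h W'
      using cases[OF h]
    proof (elim disjE conjE)
      assume h: "h = m"
      show ?thesis unfolding h Wm
        by (rule grassmannian_eq_span2[OF _ _ _ i(3)]) (use W'(2)[unfolded h tr] in auto)
    next
      assume h: "h = a"
      show ?thesis unfolding h Wa
        by (rule grassmannian_eq_span2[OF _ _ _ vp]) (use W'(2)[unfolded h tr] W'(1) in \<open>auto simp: in_line_def\<close>)
    next
      assume h: "h = b" and ne: "a \<noteq> b"
      show ?thesis unfolding h Wb[OF ne]
        by (rule grassmannian_eq_kernel2[OF _ \<psi>\<phi>])
          (use W'(2)[unfolded h tr(3)[OF ne]] W'(1) in \<open>auto simp: in_line_def\<close>)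
    qed
    have pa: "p \<in> W a" and cm: "c \<in> W m" by (simp_all add: Wa Wm vec.span_base)
    have "W m \<noteq> W a" using pa i(4) unfolding Wm by metis
    moreover have "W m \<noteq> W b" if "a \<noteq> b" using cm \<phi>c unfolding Wb[OF that] by blast
    moreover have "W a \<noteq> W b" if "a \<noteq> b" using pa \<phi>p[OF that] unfolding Wb[OF that] by blast
    ultimately have W_inj: "inj_on W {..<length cs}" unfolding n inj_on_def by auto
    have inc: "incident cs g v \<psi>" unfolding incident_def using v(1,2) \<psi>(1) W by blast
    have uniq: "v' \<in> vec.span {v} \<and> \<psi>' \<in> vec.span {\<psi>}" if i: "incident cs g v' \<psi>'" for v' \<psi>'
    proof
      note D = incidentD[OF i g cs]
      have "p \<diamondop> \<psi>' = 0" "c \<diamondop> \<psi>' = 0" "d \<diamondop> \<psi>' = 0"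
        unfolding p_def c_def d_def scalar_product_commute[of _ \<psi>']
        using D(4)[OF _ len(1)] D(4,5)[OF _ len(3)] m ab by auto
      thus "\<psi>' \<in> vec.span {\<psi>}" by (rule \<psi>(5))
      have "v' \<in> vec.span {c, d}" unfolding c_def d_def using D(7)[OF _ len(3)] m by blast
      then obtain x y where v': "v' = x *s c + y *s d" unfolding in_span2 by blast
      have "\<phi> \<diamondop> v' = 0" unfolding \<phi>_def using D(6)[OF _ len(2)] ab by auto
      hence "x * (\<phi> \<diamondop> c) = - y * (\<phi> \<diamondop> d)"
        by (simp add: v' scalar_product_add_right scalar_product_scale_right eq_neg_iff_add_eq_0)
      hence x: "x = - y * (\<phi> \<diamondop> d) / (\<phi> \<diamondop> c)" using \<phi>c by (simp add: field_simps)
      have "v' = (- y / (\<phi> \<diamondop> c)) *s v"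
        using \<phi>c by (simp add: v' v_def x vec.scale_right_diff_distrib)
      thus "v' \<in> vec.span {v}" unfolding in_span1 by blast
    qed
    from sphere_classes_singleton[OF inc uniq W W_uniq W_inj]
    show "finite (sphere_classes 1 cs g) \<and> card (sphere_classes 1 cs g) = 1" .
  qed
qed

lemma gw_numbers_degree_1:
  "gw_number 1 [2, 2, 2, 3, 3] = 1" "gw_number 1 [2, 2, 3, 4] = 1" "gw_number 1 [2, 4, 4] = 1"
  "gw_number 1 [2, 2, 3, 3, 3] = 1" "gw_number 1 [2, 3, 3, 4] = 1" "gw_number 1 [3, 4, 4] = 1"
  "gw_number 1 [2, 3, 5] = 1" "gw_number 1 [4, 5] = 1"
  "gw_number 1 [2, 2, 2, 2, 2] = 0" "gw_number 1 [2, 2, 2, 2, 3] = 0" "gw_number 1 [2, 2, 2, 4] = 0"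
  "gw_number 1 [3, 3, 3, 3, 3] = 0" "gw_number 1 [2, 3, 3, 3, 3] = 0" "gw_number 1 [3, 3, 3, 4] = 0"
  "gw_number 1 [2, 2, 5] = 0" "gw_number 1 [3, 3, 5] = 0"
proof -
  show "gw_number 1 [2, 2, 2, 3, 3] = 1" by (rule gw_number_one_points) (simp_all add: upt_rec)
  show "gw_number 1 [2, 2, 3, 4] = 1" by (rule gw_number_one_points) (simp_all add: upt_rec)
  show "gw_number 1 [2, 4, 4] = 1" by (rule gw_number_one_points) (simp_all add: upt_rec)
  show "gw_number 1 [2, 2, 3, 3, 3] = 1" by (rule gw_number_one_covectors) (simp_all add: upt_rec)
  show "gw_number 1 [2, 3, 3, 4] = 1" by (rule gw_number_one_covectors) (simp_all add: upt_rec)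
  show "gw_number 1 [3, 4, 4] = 1" by (rule gw_number_one_covectors) (simp_all add: upt_rec)
  show "gw_number 1 [2, 3, 5] = 1" by (rule gw_number_one_plane[of _ 0 1 2]) auto
  show "gw_number 1 [4, 5] = 1" by (rule gw_number_one_plane[of _ 0 0 1]) auto
  show "gw_number 1 [2, 2, 2, 2, 2] = 0" by (rule gw_number_zero_points[of _ 0 1 2 3]) auto
  show "gw_number 1 [2, 2, 2, 2, 3] = 0" by (rule gw_number_zero_points[of _ 0 1 2 3]) auto
  show "gw_number 1 [2, 2, 2, 4] = 0" by (rule gw_number_zero_points[of _ 0 1 2 3]) auto
  show "gw_number 1 [3, 3, 3, 3, 3] = 0" by (rule gw_number_zero_covectors[of _ 0 1 2 3]) auto
  show "gw_number 1 [2, 3, 3, 3, 3] = 0" by (rule gw_number_zero_covectors[of _ 1 2 3 4]) auto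
  show "gw_number 1 [3, 3, 3, 4] = 0" by (rule gw_number_zero_covectors[of _ 0 1 2 3]) auto
qed (rule gw_number_2_2_5 gw_number_3_3_5)+

section \<open>The potential up to degree one\<close>

text \<open>A syntactic form of the potential: with integer coefficients and exponent lists,
  repeated differentiation becomes a computation that can be run. The exponential factor is common
  to all monomials and is recorded by \<open>d\<close> alone.\<close>

definition monomial_sum :: "nat \<Rightarrow> (int \<times> nat list) list \<Rightarrow> (nat \<Rightarrow> complex) \<Rightarrow> complex" where
  "monomial_sum d L t =
     (\<Sum>(c, es)\<leftarrow>L. of_int c * (\<Prod>i<6. t i ^ (es ! i)) * exp (of_nat d * t 1)) / 12"

text \<open>The product rule: for \<open>i = 1\<close> the exponential contributes a second
  monomial. At exponent 0 the truncated subtraction is harmless, since the new coefficient is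
  0.\<close>

definition monomial_diff :: "nat \<Rightarrow> nat \<Rightarrow> int \<times> nat list \<Rightarrow> (int \<times> nat list) list" where
  "monomial_diff d i = (\<lambda>(c, es). (if i = 1 then [(c * int d, es)] else []) @
     [(c * int (es ! i), es[i := es ! i - 1])])"

definition list_diff :: "nat \<Rightarrow> nat \<Rightarrow> (int \<times> nat list) list \<Rightarrow> (int \<times> nat list) list" where
  "list_diff d i L = concat (map (monomial_diff d i) L)"

definition valid_monomials :: "(int \<times> nat list) list \<Rightarrow> bool" where
  "valid_monomials L \<longleftrightarrow> (\<forall>m\<in>set L. length (snd m) = 6)"

lemma valid_list_diff: "valid_monomials L \<Longrightarrow> valid_monomials (list_diff d i L)"
  by (force simp: valid_monomials_def list_diff_def monomial_diff_def split: if_splits prod.splits)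

lemma monomial_derivative:
  assumes i: "i < 6" and es: "length es = 6"
  shows "((\<lambda>z. of_int c * (\<Prod>j<6. (t(i := z)) j ^ (es ! j)) * exp (of_nat d * (t(i := z)) 1)) has_field_derivative
     (\<Sum>(c, es)\<leftarrow>monomial_diff d i (c, es). of_int c * (\<Prod>j<6. t j ^ (es ! j)) * exp (of_nat d * t 1)))
     (at (t i :: complex))"
proof -
  define K where "K = (\<Prod>j\<in>{..<6} - {i}. t j ^ (es ! j))"
  have f: "finite {..<6::nat}" "i \<in> {..<6}" using i by auto
  have K: "(\<Prod>j\<in>{..<6} - {i}. (t(i := z)) j ^ (es ! j)) = K" for z
    unfolding K_def by (rule prod.cong) auto
  have 1: "(\<Prod>j<6. (t(i := z)) j ^ (es ! j)) = z ^ (es ! i) * K" for z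
    unfolding prod.remove[OF f] K by simp
  have K': "(\<Prod>j\<in>{..<6} - {i}. t j ^ (es[i := es ! i - 1] ! j)) = K"
    unfolding K_def by (rule prod.cong) auto
  have 2: "(\<Prod>j<6. t j ^ (es[i := es ! i - 1] ! j)) = t i ^ (es ! i - 1) * K"
    unfolding prod.remove[OF f] K' using i es by simp
  have 3: "(\<Prod>j<6. t j ^ (es ! j)) = t i ^ (es ! i) * K"
    unfolding prod.remove[OF f] K_def by simp
  show ?thesis
  proof (cases "i = 1")
    case True
    have "((\<lambda>z. of_int c * (z ^ (es ! i) * K) * exp (of_nat d * z)) has_field_derivative
      of_int c * (of_nat (es ! i) * t i ^ (es ! i - 1) * K) * exp (of_nat d * t i)
      + of_int c * (t i ^ (es ! i) * K) * (of_nat d * exp (of_nat d * t i))) (at (t i))"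
      by (auto intro!: derivative_eq_intros simp: algebra_simps)
    thus ?thesis unfolding 1 monomial_diff_def using True 2 3 by (simp add: algebra_simps)
  next
    case False
    have "((\<lambda>z. of_int c * (z ^ (es ! i) * K) * exp (of_nat d * t 1)) has_field_derivative
      of_int c * (of_nat (es ! i) * t i ^ (es ! i - 1) * K) * exp (of_nat d * t 1)) (at (t i))"
      by (auto intro!: derivative_eq_intros simp: algebra_simps)
    thus ?thesis unfolding 1 monomial_diff_def using False 2 by (simp add: algebra_simps)
  qed
qed

lemma monomial_sum_derivative:
  assumes i: "i < 6" and L: "valid_monomials L"
  shows "((\<lambda>z. monomial_sum d L (t(i := z))) has_field_derivative monomial_sum d (list_diff d i L) t) (at (t i))"
proof -
  have "((\<lambda>z. \<Sum>(c, es)\<leftarrow>L. of_int c * (\<Prod>j<6. (t(i := z)) j ^ (es ! j)) * exp (of_nat d * (t(i := z)) 1))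
    has_field_derivative
     (\<Sum>(c, es)\<leftarrow>list_diff d i L. of_int c * (\<Prod>j<6. t j ^ (es ! j)) * exp (of_nat d * t 1))) (at (t i))"
    using L
  proof (induction L)
    case Nil
    show ?case by (simp add: list_diff_def)
  next
    case (Cons m L)
    obtain c es where m: "m = (c, es)" by (cases m)
    have "length es = 6" "valid_monomials L" using Cons.prems by (simp_all add: m valid_monomials_def)
    from DERIV_add[OF monomial_derivative[OF i this(1), of c t d] Cons.IH[OF this(2)]]
    show ?case unfolding m by (simp add: list_diff_def del: fun_upd_apply)
  qed
  thus ?thesis unfolding monomial_sum_def by (rule DERIV_cdivide)
qed

lemma partial_deriv_monomial_sum:
  "i < 6 \<Longrightarrow> valid_monomials L \<Longrightarrow> partial_deriv i (monomial_sum d L) = monomial_sum d (list_diff d i L)"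
  unfolding partial_deriv_def by (rule ext) (rule DERIV_imp_deriv[OF monomial_sum_derivative])

text \<open>Twelve times the classical potential and twelve times the part of degree 1 of the quantum
  potential, as lists of coefficients and exponents; the factor makes all coefficients integers.\<close>

definition potential_list :: "nat \<Rightarrow> (int \<times> nat list) list" where
  "potential_list d =
    (if d = 0 then [(6, [0, 2, 0, 1, 0, 0]), (6, [0, 2, 1, 0, 0, 0]), (6, [1, 0, 0, 2, 0, 0]),
       (6, [1, 0, 2, 0, 0, 0]), (12, [1, 1, 0, 0, 1, 0]), (6, [2, 0, 0, 0, 0, 1])]
     else [(1, [0, 0, 3, 2, 0, 0]), (1, [0, 0, 2, 3, 0, 0]), (6, [0, 0, 2, 1, 1, 0]), (6, [0, 0, 1, 2, 1, 0]),
       (6, [0, 0, 1, 0, 2, 0]), (6, [0, 0, 0, 1, 2, 0]), (12, [0, 0, 1, 1, 0, 1]), (12, [0, 0, 0, 0, 1, 1])])"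

lemma valid_potential_list: "valid_monomials (potential_list d)"
  by (simp add: valid_monomials_def potential_list_def)

lemma degree_1_exponents:
  "{(n2, n3, n4, n5). n2 + n3 + 2 * n4 + 3 * n5 = (5::nat)} =
   {(5, 0, 0, 0), (4, 1, 0, 0), (3, 2, 0, 0), (2, 3, 0, 0), (1, 4, 0, 0), (0, 5, 0, 0),
    (3, 0, 1, 0), (2, 1, 1, 0), (1, 2, 1, 0), (0, 3, 1, 0), (1, 0, 2, 0), (0, 1, 2, 0),
    (2, 0, 0, 1), (1, 1, 0, 1), (0, 2, 0, 1), (0, 0, 1, 1)}"
  (is "?L = ?R")
proof
  show "?L \<subseteq> ?R"
  proof (rule subsetI)
    fix x assume "x \<in> ?L"
    then obtain a b c e where x: "x = (a, b, c, e)" and s: "a + b + 2 * c + 3 * e = 5" by blast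
    hence "e = 0 \<or> e = 1" "c = 0 \<or> c = 1 \<or> c = 2" "a = 0 \<or> a = 1 \<or> a = 2 \<or> a = 3 \<or> a = 4 \<or> a = 5"
      by arith+
    with s show "x \<in> ?R" unfolding x by (elim disjE) simp_all
  qed
qed auto

lemma gw_potential_quantum_1:
  "gw_potential_quantum 1 t = t 2 ^ 3 * t 3 ^ 2 / 12 + t 2 ^ 2 * t 3 ^ 3 / 12 + t 2 ^ 2 * t 3 * t 4 / 2
     + t 2 * t 3 ^ 2 * t 4 / 2 + t 2 * t 4 ^ 2 / 2 + t 3 * t 4 ^ 2 / 2 + t 2 * t 3 * t 5 + t 4 * t 5"
proof -
  have r: "replicate 2 x = [x, x]" "replicate 3 x = [x, x, x]" "replicate 4 x = [x, x, x, x]"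
    "replicate 5 x = [x, x, x, x, x]" for x :: nat
    by (simp_all add: numeral_eq_Suc)
  have f: "fact 2 = (2::complex)" "fact 3 = (6::complex)" by (simp_all add: fact_numeral)
  show ?thesis
    unfolding gw_potential_quantum_def
    \<comment> \<open>Simplification turns the degree \<open>1\<close> into \<open>Suc 0\<close>, so
      the table of numbers is simplified in the same way to match.\<close>
    by (simp add: degree_1_exponents r f gw_numbers_degree_1[simplified])
qed

lemma gw_potential_term_monomial_sum:
  assumes "d \<in> {0, 1}" shows "gw_potential_term d = monomial_sum d (potential_list d)"
proof
  fix t
  have p: "(\<Prod>i<6. x i) = x 0 * x 1 * x 2 * x 3 * x 4 * x 5" for x :: "nat \<Rightarrow> complex"
    by (simp add: eval_nat_numeral lessThan_Suc mult_ac)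
  from assms consider "d = 0" | "d = 1" by blast
  thus "gw_potential_term d t = monomial_sum d (potential_list d) t"
  proof cases
    case 1
    have "12 * gw_potential_classical t = 12 * monomial_sum 0 (potential_list 0) t"
      by (simp add: gw_potential_classical_def monomial_sum_def potential_list_def p distrib_left)
    thus ?thesis using 1 by (simp add: gw_potential_term_def)
  next
    case 2
    have "gw_potential_term 1 t = gw_potential_quantum 1 t * exp (t 1)" by (simp add: gw_potential_term_def)
    also have "\<dots> = monomial_sum 1 (potential_list 1) t"
    proof -
      have "12 * gw_potential_quantum 1 t * exp (t 1) = 12 * monomial_sum 1 (potential_list 1) t"
        unfolding gw_potential_quantum_1
        by (simp add: monomial_sum_def potential_list_def p distrib_left distrib_right)
      thus ?thesis by simp
    qed
    finally show ?thesis using 2 by simp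
  qed
qed

text \<open>Poincare duality on the Schubert classes: the permutation whose matrix is
  \<open>intersection_form\<close>.\<close>

definition dual_index :: "nat \<Rightarrow> nat" where
  "dual_index f = [5, 4, 2, 3, 1, 0] ! f"

text \<open>At a bulk class only the powers of one coordinate \<open>t\<close> survive. A list of pairs \<open>(c, k)\<close> stands
  for the sum of the \<open>c * t ^ k / 12\<close>. The factors in \<open>entry_list\<close> are the coefficients of
  \<^const>\<open>dubrovin_class\<close>.\<close>

definition power_list :: "nat \<Rightarrow> (int \<times> nat list) list \<Rightarrow> (int \<times> nat) list" where
  "power_list b L = concat (map (\<lambda>(c, es). if c \<noteq> 0 \<and> es[b := 0] = [0, 0, 0, 0, 0, 0] then [(c, es ! b)] else []) L)"

definition power_sum :: "complex \<Rightarrow> (int \<times> nat) list \<Rightarrow> complex" where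
  "power_sum t L = (\<Sum>(c, k)\<leftarrow>L. of_int c * t ^ k) / 12"

definition third_deriv_list :: "nat \<Rightarrow> nat \<Rightarrow> nat \<Rightarrow> nat \<Rightarrow> nat \<Rightarrow> (int \<times> nat) list" where
  "third_deriv_list d b i j f =
     power_list b (list_diff d i (list_diff d j (list_diff d (dual_index f) (potential_list d))))"

definition entry_list :: "nat \<Rightarrow> nat \<Rightarrow> nat \<Rightarrow> nat \<Rightarrow> (int \<times> nat) list" where
  "entry_list d b f j = map (\<lambda>(c, k). (4 * c, k)) (third_deriv_list d b 1 j f) @
     map (\<lambda>(c, k). (- ([0, 0, 1, 1, 2, 3] ! b) * c, Suc k)) (third_deriv_list d b b j f)"

lemma less_6_cases: "(i::nat) < 6 \<Longrightarrow> i = 0 \<or> i = 1 \<or> i = 2 \<or> i = 3 \<or> i = 4 \<or> i = 5"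
  by arith

text \<open>As \<open>b \<noteq> 1\<close>, the exponential has value 1 here. By
  \<open>0 ^ 0 = 1\<close> a monomial survives exactly if all its exponents away from
  \<open>b\<close> are zero.\<close>

lemma monomial_sum_bulk:
  assumes b: "b \<in> {2, 3, 4, 5}" and L: "valid_monomials L"
  shows "monomial_sum d L ((\<lambda>i. if i = b then t else 0)(1 := 0)) = power_sum t (power_list b L)"
proof -
  let ?u = "(\<lambda>i. if i = b then t else 0)(1 := 0) :: nat \<Rightarrow> complex"
  have e: "exp (of_nat d * ?u 1) = 1" by simp
  have "(\<Sum>(c, es)\<leftarrow>L. of_int c * (\<Prod>i<6. ?u i ^ (es ! i))) = (\<Sum>(c, k)\<leftarrow>power_list b L. of_int c * t ^ k)"
    using L
  proof (induction L)
    case Nil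
    show ?case by (simp add: power_list_def)
  next
    case (Cons m L)
    obtain c es where m: "m = (c, es)" by (cases m)
    have len: "length es = 6" "valid_monomials L" using Cons.prems by (simp_all add: m valid_monomials_def)
    have b6: "b \<in> {..<6}" "b \<noteq> 1" using b by auto
    have z: "es[b := 0] = [0, 0, 0, 0, 0, 0] \<longleftrightarrow> (\<forall>i<6. i \<noteq> b \<longrightarrow> es ! i = 0)"
    proof -
      have "es[b := 0] = [0, 0, 0, 0, 0, 0] \<longleftrightarrow> es[b := 0] = replicate 6 0" by (simp add: numeral_eq_Suc)
      also have "\<dots> \<longleftrightarrow> (\<forall>i<6. es[b := 0] ! i = 0)" using len(1) by (simp add: list_eq_iff_nth_eq)
      also have "\<dots> \<longleftrightarrow> (\<forall>i<6. i \<noteq> b \<longrightarrow> es ! i = 0)" using len(1) b6(1) by (auto simp: nth_list_update)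
      finally show ?thesis .
    qed
    have P: "(\<Prod>i<6. ?u i ^ (es ! i)) = (if es[b := 0] = [0, 0, 0, 0, 0, 0] then t ^ (es ! b) else 0)"
    proof (cases "\<forall>i<6. i \<noteq> b \<longrightarrow> es ! i = 0")
      case True
      hence "(\<Prod>i\<in>{..<6} - {b}. ?u i ^ (es ! i)) = 1" by (intro prod.neutral) auto
      thus ?thesis using True b6 unfolding z by (subst prod.remove[OF _ b6(1)]) auto
    next
      case False
      then obtain i where i: "i < 6" "i \<noteq> b" "es ! i \<noteq> 0" by blast
      have z0: "?u i ^ (es ! i) = 0" using i by simp
      have "\<exists>k\<in>{..<6}. ?u k ^ (es ! k) = 0" by (intro bexI[of _ i]) (rule z0, simp add: i(1))
      hence "(\<Prod>i<6. ?u i ^ (es ! i)) = 0" by (rule prod_zero[OF finite_lessThan])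
      thus ?thesis unfolding z if_not_P[OF False] .
    qed
    show ?case using Cons.IH[OF len(2)] unfolding m by (simp add: P power_list_def del: fun_upd_apply One_nat_def prod_zero_iff)
  qed
  thus ?thesis unfolding monomial_sum_def power_sum_def e by simp
qed

lemma gw_third_deriv_bulk:
  assumes "d \<in> {0, 1}" "b \<in> {2, 3, 4, 5}" "i < 6" "j < 6" "f < 6"
  shows "gw_third_deriv d i j (dual_index f) (\<lambda>i. if i = b then t else 0) = power_sum t (third_deriv_list d b i j f)"
proof -
  have "dual_index f < 6" using less_6_cases[OF assms(5)] by (auto simp: dual_index_def)
  thus ?thesis
    unfolding gw_third_deriv_def third_deriv_list_def gw_potential_term_monomial_sum[OF assms(1)]
    using assms by (simp add: partial_deriv_monomial_sum valid_potential_list valid_list_diff monomial_sum_bulk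
        del: fun_upd_apply One_nat_def)
qed

lemma quantum_product_dual:
  assumes "f < 6" shows "quantum_product t d i j f = gw_third_deriv d i j (dual_index f) t"
proof -
  have s: "(\<Sum>e<6. x e) = x 0 + x 1 + x 2 + x 3 + x 4 + x 5" for x :: "nat \<Rightarrow> complex"
    by (simp add: eval_nat_numeral lessThan_Suc add_ac)
  show ?thesis
    using less_6_cases[OF assms]
    by (elim disjE) (simp_all add: quantum_product_def s intersection_form_def dual_index_def)
qed

lemma power_sum_append: "power_sum t (L @ L') = power_sum t L + power_sum t L'"
  by (simp add: power_sum_def add_divide_distrib)

lemma power_sum_scale: "power_sum t (map (\<lambda>(c, k). (a * c, k)) L) = of_int a * power_sum t L"
  unfolding power_sum_def by (induction L) (auto simp: algebra_simps add_divide_distrib)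

lemma power_sum_shift: "power_sum t (map (\<lambda>(c, k). (a * c, Suc k)) L) = of_int a * t * power_sum t L"
  unfolding power_sum_def by (induction L) (auto simp: algebra_simps add_divide_distrib)

lemma dubrovin_matrix_entry:
  assumes "d \<in> {0, 1}" "b \<in> {2, 3, 4, 5}" "f < 6" "j < 6"
  shows "dubrovin_matrix (\<lambda>i. if i = b then t else 0) d $$ (f, j) = power_sum t (entry_list d b f j)"
proof -
  let ?u = "\<lambda>i. if i = b then t else 0"
  have s: "(\<Sum>e<6. x e) = x 0 + x 1 + x 2 + x 3 + x 4 + x 5" for x :: "nat \<Rightarrow> complex"
    by (simp add: eval_nat_numeral lessThan_Suc add_ac)
  have q: "quantum_product ?u d i j f = power_sum t (third_deriv_list d b i j f)" if "i < 6" for i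
    using assms that by (simp add: quantum_product_dual gw_third_deriv_bulk)
  have "dubrovin_matrix ?u d $$ (f, j) = (\<Sum>i<6. dubrovin_class ?u i * quantum_product ?u d i j f)"
    using assms by (simp add: dubrovin_matrix_def)
  also have "\<dots> = 4 * quantum_product ?u d 1 j f - of_int ([0, 0, 1, 1, 2, 3] ! b) * t * quantum_product ?u d b j f"
    using assms(2) by (auto simp: s dubrovin_class_def)
  also have "\<dots> = power_sum t (entry_list d b f j)"
    unfolding entry_list_def power_sum_append power_sum_scale power_sum_shift
    using assms(2) by (subst (1 2) q) auto
  finally show ?thesis .
qed

definition entry_table :: "nat \<Rightarrow> nat \<Rightarrow> (int \<times> nat) list list list" where
  "entry_table d b = map (\<lambda>f. map (entry_list d b f) [0, 1, 2, 3, 4, 5]) [0, 1, 2, 3, 4, 5]"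

text \<open>Two pairs in one entry stay unmerged: the first comes from 4 sigma_1, the second from
  the bulk term. Thus \<open>[(48, 1), (-12, 1)]\<close> stands for \<open>3 * t\<close> and
  \<open>[(8, 3), (-6, 3)]\<close> for \<open>t ^ 3 / 6\<close>.\<close>

lemma entry_tables:
  "entry_table 0 2 =
    [[[], [], [], [], [], []],
     [[(48, 0)], [], [], [], [], []],
     [[(-12, 1)], [(48, 0)], [], [], [], []],
     [[], [(48, 0)], [], [], [], []],
     [[], [(-12, 1)], [(48, 0)], [(48, 0)], [], []],
     [[], [], [(-12, 1)], [], [(48, 0)], []]]"
  "entry_table 1 2 =
    [[[], [], [], [(48, 1), (-12, 1)], [(48, 0)], []],
     [[], [], [], [(24, 2), (-12, 2)], [(48, 1), (-12, 1)], [(48, 0)]],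
     [[], [], [], [], [], []],
     [[], [], [], [(8, 3), (-6, 3)], [(24, 2), (-12, 2)], [(48, 1), (-12, 1)]],
     [[], [], [], [], [], []],
     [[], [], [], [], [], []]]"
  "entry_table 0 3 =
    [[[], [], [], [], [], []],
     [[(48, 0)], [], [], [], [], []],
     [[], [(48, 0)], [], [], [], []],
     [[(-12, 1)], [(48, 0)], [], [], [], []],
     [[], [(-12, 1)], [(48, 0)], [(48, 0)], [], []],
     [[], [], [], [(-12, 1)], [(48, 0)], []]]"
  "entry_table 1 3 =
    [[[], [], [(48, 1), (-12, 1)], [], [(48, 0)], []],
     [[], [], [(24, 2), (-12, 2)], [], [(48, 1), (-12, 1)], [(48, 0)]],
     [[], [], [(8, 3), (-6, 3)], [], [(24, 2), (-12, 2)], [(48, 1), (-12, 1)]],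
     [[], [], [], [], [], []],
     [[], [], [], [], [], []],
     [[], [], [], [], [], []]]"
  "entry_table 0 4 =
    [[[], [], [], [], [], []],
     [[(48, 0)], [], [], [], [], []],
     [[], [(48, 0)], [], [], [], []],
     [[], [(48, 0)], [], [], [], []],
     [[(-24, 1)], [], [(48, 0)], [(48, 0)], [], []],
     [[], [(-24, 1)], [], [], [(48, 0)], []]]"
  "entry_table 1 4 =
    [[[], [(48, 1), (-24, 1)], [], [], [(48, 0)], []],
     [[], [], [(48, 1), (-24, 1)], [(48, 1), (-24, 1)], [], [(48, 0)]],
     [[], [(24, 2), (-24, 2)], [], [], [(48, 1), (-24, 1)], []],
     [[], [(24, 2), (-24, 2)], [], [], [(48, 1), (-24, 1)], []],
     [[], [], [(24, 2), (-24, 2)], [(24, 2), (-24, 2)], [], [(48, 1), (-24, 1)]],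
     [[], [], [], [], [], []]]"
  "entry_table 0 5 =
    [[[], [], [], [], [], []],
     [[(48, 0)], [], [], [], [], []],
     [[], [(48, 0)], [], [], [], []],
     [[], [(48, 0)], [], [], [], []],
     [[], [], [(48, 0)], [(48, 0)], [], []],
     [[(-36, 1)], [], [], [], [(48, 0)], []]]"
  "entry_table 1 5 =
    [[[], [], [], [], [(48, 0)], []],
     [[], [(48, 1), (-36, 1)], [], [], [], [(48, 0)]],
     [[], [], [], [(48, 1), (-36, 1)], [], []],
     [[], [], [(48, 1), (-36, 1)], [], [], []],
     [[], [], [], [], [(48, 1), (-36, 1)], []],
     [[], [], [], [], [], []]]"
  by code_simp+

section \<open>Characteristic polynomials\<close>

text \<open>The entry \<^const>\<open>None\<close> stands for zero: rewriting then does not expand the corresponding minor,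
  and zero entries need not be recognized in an abstract ring.\<close>

fun laplace_det :: "nat \<Rightarrow> 'a::comm_ring_1 option list list \<Rightarrow> 'a" where
  "laplace_det 0 rs = 1"
| "laplace_det (Suc n) rs = (\<Sum>i<Suc n. case hd (rs ! i) of None \<Rightarrow> 0 | Some a \<Rightarrow>
     (- 1) ^ i * a * laplace_det n (map tl (take i rs @ drop (Suc i) rs)))"

definition option_mat :: "nat \<Rightarrow> 'a::zero option list list \<Rightarrow> 'a mat" where
  "option_mat n rs = Matrix.mat n n (\<lambda>(i, j). case rs ! i ! j of None \<Rightarrow> 0 | Some a \<Rightarrow> a)"

text \<open>Laplace expansion along the first column: removing row \<open>i\<close> and taking the
  tails of the others gives the minor.\<close>

lemma det_option_mat:
  "length rs = n \<Longrightarrow> (\<And>r. r \<in> set rs \<Longrightarrow> length r = n) \<Longrightarrow>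
   Determinant.det (option_mat n rs) = laplace_det n rs"
proof (induction n arbitrary: rs)
  case 0
  show ?case by (simp add: option_mat_def)
next
  case (Suc n)
  let ?A = "option_mat (Suc n) rs"
  have A: "?A \<in> carrier_mat (Suc n) (Suc n)" by (simp add: option_mat_def)
  have "?A $$ (i, 0) * cofactor ?A i 0 = (case hd (rs ! i) of None \<Rightarrow> 0 | Some a \<Rightarrow>
     (- 1) ^ i * a * laplace_det n (map tl (take i rs @ drop (Suc i) rs)))" if i: "i < Suc n" for i
  proof -
    let ?rs = "map tl (take i rs @ drop (Suc i) rs)"
    have len: "length (rs ! k) = Suc n" if "k < Suc n" for k
      using Suc.prems that by simp
    have nth: "?rs ! k ! j = rs ! (if k < i then k else Suc k) ! Suc j" if k: "k < n" "j < n" for k j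
    proof -
      have "(take i rs @ drop (Suc i) rs) ! k = rs ! (if k < i then k else Suc k)"
        using Suc.prems(1) i k by (auto simp: nth_append min_def)
      moreover have "length (take i rs @ drop (Suc i) rs) = n" using Suc.prems(1) i by simp
      ultimately have "?rs ! k = tl (rs ! (if k < i then k else Suc k))"
        using k(1) nth_map[of k "take i rs @ drop (Suc i) rs" tl] by (simp only:)
      moreover have "length (rs ! (if k < i then k else Suc k)) = Suc n" using k by (intro len) auto
      ultimately show ?thesis using k by (simp add: nth_tl)
    qed
    have "mat_delete ?A i 0 = option_mat n ?rs"
      by (rule eq_matI) (use nth i in \<open>auto simp: mat_delete_def option_mat_def\<close>)
    moreover have "Determinant.det (option_mat n ?rs) = laplace_det n ?rs"
    proof (rule Suc.IH)
      show "length ?rs = n" using Suc.prems(1) i by simp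
      show "length r = n" if "r \<in> set ?rs" for r
        using that Suc.prems(2) by (auto dest!: in_set_takeD in_set_dropD)
    qed
    moreover have "?A $$ (i, 0) = (case hd (rs ! i) of None \<Rightarrow> 0 | Some a \<Rightarrow> a)"
      using i len[OF i] by (simp add: option_mat_def hd_conv_nth length_0_conv[symmetric] del: length_0_conv)
    ultimately show ?thesis
      by (simp add: Determinant.cofactor_def mult_ac split: option.split)
  qed
  thus ?case unfolding laplace_expansion_column[OF A, of 0, simplified] by simp
qed

lemma char_poly_laplace_det:
  assumes "A \<in> carrier_mat n n" "length rs = n" "\<And>r. r \<in> set rs \<Longrightarrow> length r = n"
    and "\<And>i j. i < n \<Longrightarrow> j < n \<Longrightarrow> char_poly_matrix A $$ (i, j) = (case rs ! i ! j of None \<Rightarrow> 0 | Some a \<Rightarrow> a)"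
  shows "char_poly A = laplace_det n rs"
proof -
  have "char_poly_matrix A \<in> carrier_mat n n" using assms(1) by simp
  hence "char_poly_matrix A = option_mat n rs"
    by (intro eq_matI) (use assms(4) in \<open>auto simp: option_mat_def\<close>)
  thus ?thesis unfolding char_poly_def by (simp only: det_option_mat[OF assms(2,3)])
qed

text \<open>The truncated matrices over an arbitrary ring, without denominators: \<open>u\<close> stands for \<open>t ^ 3 / 6\<close>.\<close>

definition dubrovin_2 :: "'a::comm_ring_1 \<Rightarrow> 'a \<Rightarrow> 'a \<Rightarrow> 'a mat" where
  "dubrovin_2 t q u = mat_of_rows_list 6
    [[0, 0, 0, 3 * t * q, 4 * q, 0],
     [4, 0, 0, t^2 * q, 3 * t * q, 4 * q],
     [- t, 4, 0, 0, 0, 0],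
     [0, 4, 0, u * q, t^2 * q, 3 * t * q],
     [0, - t, 4, 4, 0, 0],
     [0, 0, - t, 0, 4, 0]]"

definition dubrovin_3 :: "'a::comm_ring_1 \<Rightarrow> 'a \<Rightarrow> 'a \<Rightarrow> 'a mat" where
  "dubrovin_3 t q u = mat_of_rows_list 6
    [[0, 0, 3 * t * q, 0, 4 * q, 0],
     [4, 0, t^2 * q, 0, 3 * t * q, 4 * q],
     [0, 4, u * q, 0, t^2 * q, 3 * t * q],
     [- t, 4, 0, 0, 0, 0],
     [0, - t, 4, 4, 0, 0],
     [0, 0, 0, - t, 4, 0]]"

definition dubrovin_4 :: "'a::comm_ring_1 \<Rightarrow> 'a \<Rightarrow> 'a mat" where
  "dubrovin_4 t q = mat_of_rows_list 6
    [[0, 2 * t * q, 0, 0, 4 * q, 0],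
     [4, 0, 2 * t * q, 2 * t * q, 0, 4 * q],
     [0, 4, 0, 0, 2 * t * q, 0],
     [0, 4, 0, 0, 2 * t * q, 0],
     [- (2 * t), 0, 4, 4, 0, 2 * t * q],
     [0, - (2 * t), 0, 0, 4, 0]]"

definition dubrovin_5 :: "'a::comm_ring_1 \<Rightarrow> 'a \<Rightarrow> 'a mat" where
  "dubrovin_5 t q = mat_of_rows_list 6
    [[0, 0, 0, 0, 4 * q, 0],
     [4, t * q, 0, 0, 0, 4 * q],
     [0, 4, 0, t * q, 0, 0],
     [0, 4, t * q, 0, 0, 0],
     [0, 0, 4, 4, t * q, 0],
     [- (3 * t), 0, 0, 0, 4, 0]]"

lemma dubrovin_carrier:
  "dubrovin_2 t q u \<in> carrier_mat 6 6" "dubrovin_3 t q u \<in> carrier_mat 6 6"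
  "dubrovin_4 t q \<in> carrier_mat 6 6" "dubrovin_5 t q \<in> carrier_mat 6 6"
  unfolding dubrovin_2_def dubrovin_3_def dubrovin_4_def dubrovin_5_def mat_of_rows_list_def
  by (rule carrier_matI; simp)+

text \<open>The characteristic matrix over an abstract ring. The determinant is expanded there, with
  \<open>x\<close>, \<open>t\<close>, \<open>q\<close>, \<open>u\<close> as atoms, and then
  instantiated with \<open>x\<close> as the polynomial variable and constant polynomials for the
  rest.\<close>

definition char_entries_2 :: "'a::comm_ring_1 \<Rightarrow> 'a \<Rightarrow> 'a \<Rightarrow> 'a \<Rightarrow> 'a option list list" where
  "char_entries_2 x t q u =
    [[Some x, None, None, Some (- (3 * t * q)), Some (- (4 * q)), None],
     [Some (- 4), Some x, None, Some (- (t^2 * q)), Some (- (3 * t * q)), Some (- (4 * q))],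
     [Some t, Some (- 4), Some x, None, None, None],
     [None, Some (- 4), None, Some (x - u * q), Some (- (t^2 * q)), Some (- (3 * t * q))],
     [None, Some t, Some (- 4), Some (- 4), Some x, None],
     [None, None, Some t, None, Some (- 4), Some x]]"

lemma laplace_det_2:
  "laplace_det 6 (char_entries_2 x t q u) =
     x^6 - u * q * x^5 - 5 * t^2 * q * x^4 + (q^2 * (t^5 - 3 * u * t^2) - 128 * q * t) * x^3
     + (q^2 * (23 * t^4 - 16 * u * t) - 1024 * q) * x^2 + q^2 * (128 * t^3 + 512 * u) * x
     - (1024 * q^2 * t^2 + q^3 * (3 * t^6 + 16 * u * t^3))"
  \<comment> \<open>The instance is the numeral 6, which as a successor drives the recursion of
    \<open>laplace_det\<close>.\<close>
  unfolding numeral_eq_Suc[of "Num.Bit0 (Num.Bit1 Num.One)"] char_entries_2_def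
  by simp (simp add: algebra_simps numeral_eq_Suc)

lemma char_poly_dubrovin_2:
  "char_poly (dubrovin_2 t q u) =
    [:- (1024 * q^2 * t^2 + q^3 * (3 * t^6 + 16 * u * t^3)),
      q^2 * (128 * t^3 + 512 * u),
      q^2 * (23 * t^4 - 16 * u * t) - 1024 * q,
      q^2 * (t^5 - 3 * u * t^2) - 128 * q * t,
      - (5 * t^2 * q),
      - (u * q),
      1:]"
proof -
  have "char_poly (dubrovin_2 t q u) = laplace_det 6 (char_entries_2 [:0, 1:] [:t:] [:q:] [:u:])"
  proof (rule char_poly_laplace_det)
    fix i j :: nat assume "i < 6" "j < 6"
    from less_6_cases[OF this(1)] less_6_cases[OF this(2)]
    show "char_poly_matrix (dubrovin_2 t q u) $$ (i, j)
        = (case char_entries_2 [:0, 1:] [:t:] [:q:] [:u:] ! i ! j of None \<Rightarrow> 0 | Some a \<Rightarrow> a)"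
      by (elim disjE; simp add: char_poly_matrix_def dubrovin_2_def mat_of_rows_list_def
          char_entries_2_def numeral_poly power2_eq_square)
  qed (rule dubrovin_carrier, auto simp: char_entries_2_def)
  thus ?thesis
    unfolding laplace_det_2 by (simp add: numeral_poly numeral_eq_Suc algebra_simps)
qed

definition char_entries_3 :: "'a::comm_ring_1 \<Rightarrow> 'a \<Rightarrow> 'a \<Rightarrow> 'a \<Rightarrow> 'a option list list" where
  "char_entries_3 x t q u =
    [[Some x, None, Some (- (3 * t * q)), None, Some (- (4 * q)), None],
     [Some (- 4), Some x, Some (- (t^2 * q)), None, Some (- (3 * t * q)), Some (- (4 * q))],
     [None, Some (- 4), Some (x - u * q), None, Some (- (t^2 * q)), Some (- (3 * t * q))],
     [Some t, Some (- 4), None, Some x, None, None],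
     [None, Some t, Some (- 4), Some (- 4), Some x, None],
     [None, None, None, Some t, Some (- 4), Some x]]"

text \<open>The same polynomial as in \<open>laplace_det_2\<close>: exchanging the basis vectors 2
  and 3 carries one matrix to the other, as projective duality exchanges the two Schubert
  classes.\<close>

lemma laplace_det_3:
  "laplace_det 6 (char_entries_3 x t q u) =
     x^6 - u * q * x^5 - 5 * t^2 * q * x^4 + (q^2 * (t^5 - 3 * u * t^2) - 128 * q * t) * x^3
     + (q^2 * (23 * t^4 - 16 * u * t) - 1024 * q) * x^2 + q^2 * (128 * t^3 + 512 * u) * x
     - (1024 * q^2 * t^2 + q^3 * (3 * t^6 + 16 * u * t^3))"
  unfolding numeral_eq_Suc[of "Num.Bit0 (Num.Bit1 Num.One)"] char_entries_3_def
  by simp (simp add: algebra_simps numeral_eq_Suc)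

lemma char_poly_dubrovin_3:
  "char_poly (dubrovin_3 t q u) =
    [:- (1024 * q^2 * t^2 + q^3 * (3 * t^6 + 16 * u * t^3)),
      q^2 * (128 * t^3 + 512 * u),
      q^2 * (23 * t^4 - 16 * u * t) - 1024 * q,
      q^2 * (t^5 - 3 * u * t^2) - 128 * q * t,
      - (5 * t^2 * q),
      - (u * q),
      1:]"
proof -
  have "char_poly (dubrovin_3 t q u) = laplace_det 6 (char_entries_3 [:0, 1:] [:t:] [:q:] [:u:])"
  proof (rule char_poly_laplace_det)
    fix i j :: nat assume "i < 6" "j < 6"
    from less_6_cases[OF this(1)] less_6_cases[OF this(2)]
    show "char_poly_matrix (dubrovin_3 t q u) $$ (i, j)
        = (case char_entries_3 [:0, 1:] [:t:] [:q:] [:u:] ! i ! j of None \<Rightarrow> 0 | Some a \<Rightarrow> a)"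
      by (elim disjE; simp add: char_poly_matrix_def dubrovin_3_def mat_of_rows_list_def
          char_entries_3_def numeral_poly power2_eq_square)
  qed (rule dubrovin_carrier, auto simp: char_entries_3_def)
  thus ?thesis
    unfolding laplace_det_3 by (simp add: numeral_poly numeral_eq_Suc algebra_simps)
qed

definition char_entries_4 :: "'a::comm_ring_1 \<Rightarrow> 'a \<Rightarrow> 'a \<Rightarrow> 'a option list list" where
  "char_entries_4 x t q =
    [[Some x, Some (- (2 * t * q)), None, None, Some (- (4 * q)), None],
     [Some (- 4), Some x, Some (- (2 * t * q)), Some (- (2 * t * q)), None, Some (- (4 * q))],
     [None, Some (- 4), Some x, None, Some (- (2 * t * q)), None],
     [None, Some (- 4), None, Some x, Some (- (2 * t * q)), None],
     [Some (2 * t), None, Some (- 4), Some (- 4), Some x, Some (- (2 * t * q))],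
     [None, Some (2 * t), None, None, Some (- 4), Some x]]"

text \<open>The bulk coordinate has even degree here, so the operator exchanges the spans of the
  basis vectors 0, 2, 3, 5 and of 1, 4. Hence the polynomial is even and the kernel has dimension at
  least two, which explains the factor \<open>x^2\<close>.\<close>

lemma laplace_det_4:
  "laplace_det 6 (char_entries_4 x t q) =
     x^6 - 32 * t * q * x^4 + (64 * t^4 * q^3 + 256 * t^2 * q^2 - 1024 * q) * x^2"
  unfolding numeral_eq_Suc[of "Num.Bit0 (Num.Bit1 Num.One)"] char_entries_4_def
  by simp (simp add: algebra_simps numeral_eq_Suc)

lemma char_poly_dubrovin_4:
  "char_poly (dubrovin_4 t q) =
    [:0,
      0,
      64 * t^4 * q^3 + 256 * t^2 * q^2 - 1024 * q,
      0,
      - (32 * t * q),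
      0,
      1:]"
proof -
  have "char_poly (dubrovin_4 t q) = laplace_det 6 (char_entries_4 [:0, 1:] [:t:] [:q:])"
  proof (rule char_poly_laplace_det)
    fix i j :: nat assume "i < 6" "j < 6"
    from less_6_cases[OF this(1)] less_6_cases[OF this(2)]
    show "char_poly_matrix (dubrovin_4 t q) $$ (i, j)
        = (case char_entries_4 [:0, 1:] [:t:] [:q:] ! i ! j of None \<Rightarrow> 0 | Some a \<Rightarrow> a)"
      by (elim disjE; simp add: char_poly_matrix_def dubrovin_4_def mat_of_rows_list_def
          char_entries_4_def numeral_poly power2_eq_square)
  qed (rule dubrovin_carrier, auto simp: char_entries_4_def)
  thus ?thesis
    unfolding laplace_det_4 by (simp add: numeral_poly numeral_eq_Suc algebra_simps)
qed

definition char_entries_5 :: "'a::comm_ring_1 \<Rightarrow> 'a \<Rightarrow> 'a \<Rightarrow> 'a option list list" where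
  "char_entries_5 x t q =
    [[Some x, None, None, None, Some (- (4 * q)), None],
     [Some (- 4), Some (x - t * q), None, None, None, Some (- (4 * q))],
     [None, Some (- 4), Some x, Some (- (t * q)), None, None],
     [None, Some (- 4), Some (- (t * q)), Some x, None, None],
     [None, None, Some (- 4), Some (- 4), Some (x - t * q), None],
     [Some (3 * t), None, None, None, Some (- 4), Some x]]"

lemma laplace_det_5:
  "laplace_det 6 (char_entries_5 x t q) =
     x^6 - 2 * t * q * x^5 + 2 * t^3 * q^3 * x^3 - (1024 * q + q^4 * t^4) * x^2 + 512 * q^2 * t * x + 1536 * q^3 * t^2"
  unfolding numeral_eq_Suc[of "Num.Bit0 (Num.Bit1 Num.One)"] char_entries_5_def
  by simp (simp add: algebra_simps numeral_eq_Suc)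

lemma char_poly_dubrovin_5:
  "char_poly (dubrovin_5 t q) =
    [:1536 * q^3 * t^2,
      512 * q^2 * t,
      - (1024 * q + q^4 * t^4),
      2 * t^3 * q^3,
      0,
      - (2 * t * q),
      1:]"
proof -
  have "char_poly (dubrovin_5 t q) = laplace_det 6 (char_entries_5 [:0, 1:] [:t:] [:q:])"
  proof (rule char_poly_laplace_det)
    fix i j :: nat assume "i < 6" "j < 6"
    from less_6_cases[OF this(1)] less_6_cases[OF this(2)]
    show "char_poly_matrix (dubrovin_5 t q) $$ (i, j)
        = (case char_entries_5 [:0, 1:] [:t:] [:q:] ! i ! j of None \<Rightarrow> 0 | Some a \<Rightarrow> a)"
      by (elim disjE; simp add: char_poly_matrix_def dubrovin_5_def mat_of_rows_list_def
          char_entries_5_def numeral_poly power2_eq_square)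
  qed (rule dubrovin_carrier, auto simp: char_entries_5_def)
  thus ?thesis
    unfolding laplace_det_5 by (simp add: numeral_poly numeral_eq_Suc algebra_simps)
qed

section \<open>Specialization of the Novikov parameter\<close>

lemma nov_coeff_monom: "nov_coeff (nov_monom c y) x = (if x = y then c else 0)"
  by (simp add: nov_monom.rep_eq)

lemma nov_coeff_monom_mult: "nov_coeff (nov_monom c a * f) x = c * nov_coeff f (x - (a :: real))"
proof -
  have "nov_coeff (nov_monom c a * f) x = (\<Sum>b\<in>{a}. nov_coeff (nov_monom c a) b * nov_coeff f (x - b))"
    unfolding nov_coeff_times by (rule nov_conv_superset) (auto simp: nov_coeff_monom split: if_splits)
  thus ?thesis by (simp add: nov_coeff_monom)
qed

lemma nov_coeff_add: "nov_coeff (f + g) x = nov_coeff f x + nov_coeff g x"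
  by (rule plus_novikov.rep_eq[THEN fun_cong])

lemma comm_ring_hom_nov_const: "comm_ring_hom (\<lambda>c :: 'a::comm_ring_1. nov_monom c 0)"
proof
  show "nov_monom (x + y) 0 = nov_monom x 0 + nov_monom y 0" for x y :: 'a
    by (rule novikov_eqI) (simp add: nov_coeff_monom nov_coeff_add)
  show "nov_monom (x * y) 0 = nov_monom x 0 * nov_monom y 0" for x y :: 'a
    by (rule novikov_eqI) (simp add: nov_coeff_monom nov_coeff_monom_mult)
  show "nov_monom (1 :: 'a) 0 = 1" by (simp add: one_novikov_def)
qed (rule novikov_eqI, simp add: nov_coeff_monom zero_novikov.rep_eq)

text \<open>Evaluation at \<open>q = nov_monom 1 1\<close>, with constants placed at exponent 0: the
  copy of the polynomial ring in \<open>q\<close> inside the Novikov field, from which the truncated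
  matrices come.\<close>

definition nov_poly :: "'a::comm_ring_1 poly \<Rightarrow> 'a novikov" where
  "nov_poly p = poly (map_poly (\<lambda>c. nov_monom c 0) p) (nov_monom 1 1)"

lemma nov_poly_0: "nov_poly 0 = 0"
  by (simp add: nov_poly_def)

lemma nov_poly_pCons: "nov_poly (pCons a p) = nov_monom a 0 + nov_monom 1 1 * nov_poly p"
proof -
  interpret comm_ring_hom "\<lambda>c :: 'a. nov_monom c 0" by (rule comm_ring_hom_nov_const)
  show ?thesis by (simp add: nov_poly_def map_poly_pCons_hom)
qed

text \<open>The clause on negative exponents carries the induction: the coefficient of
  \<open>q * p\<close> at 0 is that of \<open>p\<close> at -1.\<close>

lemma nov_coeff_nov_poly:
  "nov_coeff (nov_poly p) (real n) = coeff p n" "x < 0 \<Longrightarrow> nov_coeff (nov_poly p) x = 0"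
proof -
  have "(\<forall>n. nov_coeff (nov_poly p) (real n) = coeff p n) \<and> (\<forall>x<0. nov_coeff (nov_poly p) x = 0)"
  proof (induction p)
    case 0
    show ?case by (simp add: nov_poly_0 zero_novikov.rep_eq)
  next
    case (pCons a p)
    have "nov_coeff (nov_poly (pCons a p)) (real n) = coeff (pCons a p) n" for n
    proof (cases n)
      case 0
      thus ?thesis using pCons.IH by (simp add: nov_poly_pCons nov_coeff_add nov_coeff_monom nov_coeff_monom_mult)
    next
      case (Suc m)
      have "nov_coeff (nov_poly p) (real m) = coeff p m" using pCons.IH by blast
      thus ?thesis unfolding Suc
        by (simp add: nov_poly_pCons nov_coeff_add nov_coeff_monom nov_coeff_monom_mult)
    qed
    thus ?case using pCons.IH by (simp add: nov_poly_pCons nov_coeff_add nov_coeff_monom nov_coeff_monom_mult)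
  qed
  thus "nov_coeff (nov_poly p) (real n) = coeff p n" "x < 0 \<Longrightarrow> nov_coeff (nov_poly p) x = 0" by blast+
qed

lemma inj_idom_hom_nov_poly: "inj_idom_hom (nov_poly :: 'a::field poly \<Rightarrow> 'a novikov)"
proof
  interpret c: comm_ring_hom "\<lambda>c :: 'a. nov_monom c 0" by (rule comm_ring_hom_nov_const)
  interpret m: map_poly_comm_ring_hom "\<lambda>c :: 'a. nov_monom c 0" ..
  show "nov_poly (p + q) = nov_poly p + nov_poly q" for p q :: "'a poly"
    by (simp add: nov_poly_def m.hom_add)
  show "nov_poly (p * q) = nov_poly p * nov_poly q" for p q :: "'a poly"
    by (simp add: nov_poly_def m.hom_mult)
  show "nov_poly (1 :: 'a poly) = 1" by (simp add: nov_poly_def m.hom_one)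
  show "nov_poly (0 :: 'a poly) = 0" by (rule nov_poly_0)
  show "p = 0" if "nov_poly p = 0" for p :: "'a poly"
  proof (rule poly_eqI)
    fix n
    have "coeff p n = nov_coeff (nov_poly p) (real n)" by (simp add: nov_coeff_nov_poly)
    also have "\<dots> = 0" by (simp add: that zero_novikov.rep_eq)
    finally show "coeff p n = coeff 0 n" by simp
  qed
qed

text \<open>The powers of a common root are a kernel vector of the Sylvester matrix.\<close>

lemma common_root_resultant_0:
  fixes p q :: "'a::field poly"
  assumes "poly p x = 0" "poly q x = 0" "degree p > 0"
  shows "resultant p q = 0"
proof -
  define m n where "m = degree p" and "n = degree q"
  define w where "w = Matrix.vec (m + n) (\<lambda>j. x ^ (m + n - 1 - j))"
  have S: "sylvester_mat p q \<in> carrier_mat (m + n) (m + n)" unfolding m_def n_def by (rule sylvester_carrier_mat)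
  have sum0: "(\<Sum>j<m + n. coeff r (m + n - 1 - j) * x ^ (m + n - 1 - j)) = poly r x" if "degree r < m + n" for r
  proof -
    have "(\<Sum>j<m + n. coeff r (m + n - 1 - j) * x ^ (m + n - 1 - j)) = (\<Sum>k<m + n. coeff r k * x ^ k)"
      using sum.nat_diff_reindex[of "\<lambda>k. coeff r k * x ^ k" "m + n"] by simp
    also have "\<dots> = (\<Sum>k\<le>degree r. coeff r k * x ^ k)"
      by (rule sum.mono_neutral_right) (use that in \<open>auto simp: coeff_eq_0\<close>)
    finally show ?thesis by (simp add: poly_altdef)
  qed
  have monom_Suc: "coeff (monom 1 (Suc k) * r) (Suc l) = coeff (monom 1 k * r) l" for k l and r :: "'a poly"
    by (simp add: coeff_monom_mult)
  have deg: "degree (monom 1 k * r) < m + n" if "k + degree r < m + n" for k and r :: "'a poly"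
    using degree_mult_le[of "monom 1 k" r] degree_monom_le[of "1 :: 'a" k] that by linarith
  \<comment> \<open>Row \<open>i\<close> of the Sylvester matrix lists the coefficients of a shift
    of \<open>p\<close> or \<open>q\<close>, so its product with \<open>w\<close> is the value of
    that shift at \<open>x\<close>.\<close>
  define r where "r i = (if i < n then monom 1 (n - 1 - i) * p else monom 1 (m + n - 1 - i) * q)" for i
  have S_r: "sylvester_mat p q $$ (i, j) = coeff (r i) (m + n - 1 - j)" if "i < m + n" "j < m + n" for i j
  proof -
    have j: "m + n - j = Suc (m + n - 1 - j)" using that by simp
    note index = sylvester_index_mat2[of i p q j, folded m_def n_def, OF that]
    show ?thesis
    proof (cases "i < n")
      case True
      hence "n - i = Suc (n - 1 - i)" by simp
      thus ?thesis using True unfolding index j r_def by (simp only: monom_Suc if_True)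
    next
      case False
      have "m + n - i = Suc (m + n - 1 - i)" using that by simp
      thus ?thesis using False unfolding index j r_def by (simp only: monom_Suc if_False)
    qed
  qed
  have r: "degree (r i) < m + n" "poly (r i) x = 0" if "i < m + n" for i
    using that assms(1,2) by (auto simp: r_def m_def n_def intro!: deg[unfolded m_def n_def])
  have "sylvester_mat p q *\<^sub>v w = 0\<^sub>v (m + n)"
  proof (rule eq_vecI)
    fix i assume "i < dim_vec (0\<^sub>v (m + n) :: 'a Matrix.vec)"
    hence i: "i < m + n" by simp
    have "vec_index (sylvester_mat p q *\<^sub>v w) i = scalar_prod (Matrix.row (sylvester_mat p q) i) w"
      by (rule index_mult_mat_vec) (simp add: i m_def[symmetric] n_def[symmetric])
    also have "\<dots> = (\<Sum>j<m + n. coeff (r i) (m + n - 1 - j) * x ^ (m + n - 1 - j))"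
      unfolding scalar_prod_def lessThan_atLeast0
      by (rule sum.cong) (simp_all add: w_def i m_def[symmetric] n_def[symmetric] S_r)
    also have "\<dots> = 0" unfolding sum0[OF r(1)[OF i]] by (rule r(2)[OF i])
    finally show "vec_index (sylvester_mat p q *\<^sub>v w) i = vec_index (0\<^sub>v (m + n)) i" using i by simp
  qed (simp add: m_def n_def)
  moreover have "w \<in> carrier_vec (m + n)" by (simp add: w_def)
  \<comment> \<open>The last entry of \<open>w\<close> is \<open>x ^ 0 = 1\<close>, also for
    \<open>x = 0\<close>.\<close>
  moreover have "w \<noteq> 0\<^sub>v (m + n)"
  proof
    assume "w = 0\<^sub>v (m + n)"
    hence "vec_index w (m + n - 1) = 0" using assms(3) by (simp add: m_def)
    thus False using assms(3) by (simp add: w_def m_def)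
  qed
  ultimately have "Determinant.det (sylvester_mat p q) = 0"
    using det_0_iff_vec_prod_zero_field[OF S] by blast
  thus ?thesis by (simp add: resultant_def)
qed

text \<open>A nonconstant gcd has a root over the complex numbers. This is the direction needed
  after \<open>q\<close> has been given a complex value.\<close>

lemma resultant_0_common_root:
  fixes p q :: "complex poly"
  assumes "resultant p q = 0"
  obtains x where "poly p x = 0" "poly q x = 0"
proof -
  have "degree (gcd p q) \<noteq> 0" using assms by (simp add: resultant_0_gcd)
  then obtain x where x: "poly (gcd p q) x = 0"
    using fundamental_theorem_of_algebra[of "gcd p q"] by (auto simp: constant_degree)
  have "poly p x = 0" "poly q x = 0"
    using x unfolding poly_eq_0_iff_dvd by (meson dvd_trans gcd_dvd1 gcd_dvd2)+
  thus thesis by (rule that)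
qed

lemma multiple_root_pderiv:
  fixes p :: "'a::field poly"
  assumes "order x p \<noteq> 1" "poly p x = 0" "p \<noteq> 0"
  shows "poly (pderiv p) x = 0"
proof -
  have "order x p \<noteq> 0" using assms(2,3) by (simp add: order_root)
  hence "2 \<le> order x p" using assms(1) by linarith
  hence "[:- x, 1:] ^ 2 dvd p" using order_divides by blast
  then obtain r where "p = [:- x, 1:] ^ 2 * r" by (elim dvdE)
  thus ?thesis by (simp add: power2_eq_square pderiv_mult del: mult_pCons_left mult_pCons_right)
qed

text \<open>If the discriminant of the characteristic polynomial vanished, it would do so for every
  complex value of the Novikov parameter.\<close>

lemma simple_spectrum_specialization:
  fixes M :: "complex poly mat"
  assumes M: "M \<in> carrier_mat n n" and n: "n > 0"
    and simple: "\<And>x. poly (char_poly (map_mat (\<lambda>p. poly p s) M)) x = 0 \<Longrightarrow>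
      poly (pderiv (char_poly (map_mat (\<lambda>p. poly p s) M))) x \<noteq> 0"
  shows "simple_spectrum (map_mat nov_poly M)"
  unfolding simple_spectrum_def
proof (intro allI impI, rule ccontr)
  interpret nov: inj_idom_hom "nov_poly :: complex poly \<Rightarrow> complex novikov" by (rule inj_idom_hom_nov_poly)
  have ev: "idom_hom (\<lambda>p :: complex poly. poly p s)" "comm_ring_hom (\<lambda>p :: complex poly. poly p s)"
    by unfold_locales simp_all
  note ev_pderiv = idom_hom.map_poly_pderiv[OF ev(1)]
  let ?P = "char_poly M" and ?A = "map_mat nov_poly M"
  let ?Q = "char_poly (map_mat (\<lambda>p. poly p s) M)"
  fix x assume eig: "eigenvalue ?A x" and ord: "order x (char_poly ?A) \<noteq> 1"
  have A: "?A \<in> carrier_mat n n" using M by simp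
  have N: "map_mat (\<lambda>p. poly p s) M \<in> carrier_mat n n" using M by simp
  have PA: "char_poly ?A = map_poly nov_poly ?P" by (rule nov.char_poly_hom[OF M])
  have PQ: "?Q = map_poly (\<lambda>p. poly p s) ?P" by (rule comm_ring_hom.char_poly_hom[OF ev(2) M])
  have x: "poly (char_poly ?A) x = 0" using eig eigenvalue_root_char_poly[OF A] by blast
  have d: "degree (char_poly ?A) = n" "degree ?P = n" "degree ?Q = n"
    using degree_monic_char_poly[OF A] degree_monic_char_poly[OF M] degree_monic_char_poly[OF N] by simp_all
  hence "char_poly ?A \<noteq> 0" using n by auto
  from multiple_root_pderiv[OF ord x this] have "resultant (char_poly ?A) (pderiv (char_poly ?A)) = 0"
    using x d n by (intro common_root_resultant_0) simp_all
  hence "nov_poly (resultant ?P (pderiv ?P)) = 0"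
    unfolding PA nov.map_poly_pderiv[symmetric] nov.resultant_hom .
  hence 0: "resultant ?P (pderiv ?P) = 0" by simp
  have "resultant ?Q (pderiv ?Q) = poly (resultant ?P (pderiv ?P)) s"
    unfolding PQ ev_pderiv[symmetric]
  proof (rule comm_ring_hom.resultant_map_poly[OF ev(2)])
    \<comment> \<open>Specialization commutes with the resultant when it keeps both degrees: the
      characteristic polynomial is monic, and in characteristic 0 its derivative drops the degree by
      exactly one.\<close>
    show "degree (map_poly (\<lambda>p. poly p s) ?P) = degree ?P" using d by (simp add: PQ[symmetric])
    show "degree (map_poly (\<lambda>p. poly p s) (pderiv ?P)) = degree (pderiv ?P)"
      unfolding ev_pderiv PQ[symmetric] degree_pderiv d ..
  qed
  then obtain y where "poly ?Q y = 0" "poly (pderiv ?Q) y = 0" using resultant_0_common_root 0 by auto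
  thus False using simple by blast
qed

section \<open>Simple spectra\<close>

lemma nov_poly_linear: "nov_poly [:a, b:] = nov_monom a 0 + nov_monom b 1"
  by (rule novikov_eqI)
    (simp add: nov_poly_pCons nov_poly_0 nov_coeff_add nov_coeff_monom nov_coeff_monom_mult zero_novikov.rep_eq)

lemma entry_list_table:
  assumes "f < 6" "j < 6" shows "entry_list d b f j = entry_table d b ! f ! j"
  using less_6_cases[OF assms(1)] less_6_cases[OF assms(2)]
  by (elim disjE) (simp_all add: entry_table_def)

lemma bulk_class_young_diagram:
  "bulk_class t (2, 0) = (\<lambda>i. if i = 2 then t else 0)"
  "bulk_class t (1, 1) = (\<lambda>i. if i = 3 then t else 0)"
  "bulk_class t (2, 1) = (\<lambda>i. if i = 4 then t else 0)"
  "bulk_class t (2, 2) = (\<lambda>i. if i = 5 then t else 0)"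
proof -
  have *: "bulk_class t l = (\<lambda>i. if i = b then t else 0)"
    if "b < 6" "\<And>i. i < 6 \<Longrightarrow> young_diagram i = l \<longleftrightarrow> i = b" for l b
  proof (rule ext)
    fix i show "bulk_class t l i = (if i = b then t else 0)"
      by (cases "i < 6") (use that in \<open>auto simp: bulk_class_def\<close>)
  qed
  show "bulk_class t (2, 0) = (\<lambda>i. if i = 2 then t else 0)" "bulk_class t (1, 1) = (\<lambda>i. if i = 3 then t else 0)"
    "bulk_class t (2, 1) = (\<lambda>i. if i = 4 then t else 0)" "bulk_class t (2, 2) = (\<lambda>i. if i = 5 then t else 0)"
    by (rule *; force simp: young_diagram_def dest!: less_6_cases)+
qed

lemma eq_mat_6I:
  assumes "A \<in> carrier_mat 6 6" "B \<in> carrier_mat 6 6" "\<And>i j. i < 6 \<Longrightarrow> j < 6 \<Longrightarrow> A $$ (i, j) = B $$ (i, j)"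
  shows "A = B"
  by (rule eq_matI) (use assms in auto)

lemma truncated_dubrovin_table:
  assumes "b \<in> {2, 3, 4, 5}"
  shows "truncated_dubrovin 2 (\<lambda>i. if i = b then t else 0) = map_mat nov_poly
    (Matrix.mat 6 6 (\<lambda>(f, j). [:power_sum t (entry_table 0 b ! f ! j), power_sum t (entry_table 1 b ! f ! j):]))"
proof (rule eq_mat_6I)
  fix f j :: nat assume fj: "f < 6" "j < 6"
  have d: "{d :: nat. d < 2} = {0, 1}" by auto
  have "dubrovin_matrix (\<lambda>i. if i = b then t else 0) d $$ (f, j) = power_sum t (entry_table d b ! f ! j)"
    if "d \<in> {0, 1}" for d
    using dubrovin_matrix_entry[OF that assms fj] entry_list_table[OF fj] by simp
  thus "truncated_dubrovin 2 (\<lambda>i. if i = b then t else 0) $$ (f, j) = map_mat nov_poly (Matrix.mat 6 6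
      (\<lambda>(f, j). [:power_sum t (entry_table 0 b ! f ! j), power_sum t (entry_table 1 b ! f ! j):])) $$ (f, j)"
    using fj by (simp add: truncated_dubrovin_def d nov_poly_linear)
qed (simp_all add: truncated_dubrovin_def)

lemma truncated_dubrovin_bulk:
  "truncated_dubrovin 2 (bulk_class t (2, 0)) = map_mat nov_poly (dubrovin_2 [:t:] [:0, 1:] [:t ^ 3 / 6:])" (is "?A2")
  "truncated_dubrovin 2 (bulk_class t (1, 1)) = map_mat nov_poly (dubrovin_3 [:t:] [:0, 1:] [:t ^ 3 / 6:])" (is "?A3")
  "truncated_dubrovin 2 (bulk_class t (2, 1)) = map_mat nov_poly (dubrovin_4 [:t:] [:0, 1:])" (is "?A4")
  "truncated_dubrovin 2 (bulk_class t (2, 2)) = map_mat nov_poly (dubrovin_5 [:t:] [:0, 1:])" (is "?A5")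
proof -
  have b: "2 \<in> {2, 3, 4, 5::nat}" "3 \<in> {2, 3, 4, 5::nat}" "4 \<in> {2, 3, 4, 5::nat}" "5 \<in> {2, 3, 4, 5::nat}"
    by simp_all
  note defs = power_sum_def mat_of_rows_list_def numeral_poly power2_eq_square
    dubrovin_2_def dubrovin_3_def dubrovin_4_def dubrovin_5_def
  show ?A2 ?A3 ?A4 ?A5
    unfolding bulk_class_young_diagram truncated_dubrovin_table[OF b(1)] truncated_dubrovin_table[OF b(2)]
      truncated_dubrovin_table[OF b(3)] truncated_dubrovin_table[OF b(4)] entry_tables
    by (rule arg_cong[of _ _ "map_mat nov_poly"], rule eq_mat_6I[OF mat_carrier], rule dubrovin_carrier,
        (drule less_6_cases)+, (elim disjE; simp add: defs))+
qed

lemma dubrovin_specialization: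
  "map_mat (\<lambda>p. poly p s) (dubrovin_2 [:t:] [:0, 1:] [:u:]) = dubrovin_2 t s (u :: complex)"
  "map_mat (\<lambda>p. poly p s) (dubrovin_3 [:t:] [:0, 1:] [:u:]) = dubrovin_3 t s (u :: complex)"
  "map_mat (\<lambda>p. poly p s) (dubrovin_5 [:t:] [:0, 1:]) = dubrovin_5 t (s :: complex)"
  by (rule eq_mat_6I, simp add: dubrovin_carrier, rule dubrovin_carrier, (drule less_6_cases)+,
      (elim disjE; simp add: mat_of_rows_list_def dubrovin_2_def dubrovin_3_def dubrovin_5_def))+

text \<open>By homogeneity, only \<open>s * t ^ 4\<close> and \<open>s * r ^ 4\<close> with \<open>t = r ^ 3\<close> matter. The values \<open>- 48\<close> and
  \<open>8\<close> are chosen for the small coefficients in the Bezout identity of the polynomial and its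
  derivative, which ends both proofs.\<close>

lemma simple_roots_2:
  fixes t x s u :: complex
  assumes t: "t \<noteq> 0" and s: "s * t ^ 4 = - 48" and u: "u = t ^ 3 / 6"
    and P: "P = [:- (1024 * s^2 * t^2 + s^3 * (3 * t^6 + 16 * u * t^3)), s^2 * (128 * t^3 + 512 * u),
      s^2 * (23 * t^4 - 16 * u * t) - 1024 * s, s^2 * (t^5 - 3 * u * t^2) - 128 * s * t,
      - (5 * t^2 * s), - (u * s), 1:]"
    and 0: "poly P x = 0"
  shows "poly (pderiv P) x \<noteq> 0"
proof
  assume 1: "poly (pderiv P) x = 0"
  \<comment> \<open>With \<open>x\<close> of degree 1, \<open>s\<close> of degree 4 and
    \<open>t\<close> of degree -1 the polynomial is homogeneous, so \<open>t^6 * poly P x\<close>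
    depends only on the degree 0 quantities \<open>y\<close> and \<open>w\<close>. The extra factor
    6 clears the denominator of \<open>u\<close>.\<close>
  define y where "y = x * t"
  define w where "w = s * t ^ 4"
  have six: "z = 0" if "6 * z = 0" for z :: complex using that by simp
  have e: "6 * t^6 * poly P x = 6 * y^6 - w * y^5 - 30 * w * y^4 + (3 * w^2 - 768 * w) * y^3
      + (122 * w^2 - 6144 * w) * y^2 + 1280 * w^2 * y - (6144 * w^2 + 34 * w^3)"
    unfolding P y_def w_def u by (simp add: numeral_eq_Suc algebra_simps)
  have "6 * (y^6 + 8 * y^5 + 240 * y^4 + 7296 * y^3 + 96000 * y^2 + 491520 * y - 1732608) = 6 * t^6 * poly P x"
    unfolding e w_def s by (simp add: algebra_simps)
  also have "\<dots> = 0" using 0 by simp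
  finally have p: "y^6 + 8 * y^5 + 240 * y^4 + 7296 * y^3 + 96000 * y^2 + 491520 * y - 1732608 = 0"
    by (rule six)
  have e': "6 * t^5 * poly (pderiv P) x = 36 * y^5 - 5 * w * y^4 - 120 * w * y^3 + 3 * (3 * w^2 - 768 * w) * y^2
      + 2 * (122 * w^2 - 6144 * w) * y + 1280 * w^2"
    unfolding P y_def w_def u by (simp add: pderiv_pCons numeral_eq_Suc algebra_simps)
  have "6 * (6 * y^5 + 40 * y^4 + 960 * y^3 + 21888 * y^2 + 192000 * y + 491520) = 6 * t^5 * poly (pderiv P) x"
    unfolding e' w_def s by (simp add: algebra_simps)
  also have "\<dots> = 0" using 1 by simp
  finally have p': "6 * y^5 + 40 * y^4 + 960 * y^3 + 21888 * y^2 + 192000 * y + 491520 = 0"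
    by (rule six)
  have "(586551214794 * y^4 + 4977635303672 * y^3 + 183643181671008 * y^2 + 1036721749747200 * y + 52800439912937472)
      * (y^6 + 8 * y^5 + 240 * y^4 + 7296 * y^3 + 96000 * y^2 + 491520 * y - 1732608)
    + (- 97758535799 * y^5 - 959950598344 * y^4 - 38665056225024 * y^3 - 562013947358976 * y^2 - 16402378644571392 * y
      - 83823659777298432) * (6 * y^5 + 40 * y^4 + 960 * y^3 + 21888 * y^2 + 192000 * y + 491520)
    = - 132683469850412492783616"
    by (simp add: algebra_simps numeral_eq_Suc)
  thus False unfolding p p' by simp
qed

lemma simple_roots_5:
  fixes r t x s :: complex
  assumes r: "r \<noteq> 0" and t: "t = r ^ 3" and s: "s * r ^ 4 = 8"
    and P: "P = [:1536 * s^3 * t^2, 512 * s^2 * t, - (1024 * s + s^4 * t^4), 2 * t^3 * s^3, 0, - (2 * t * s), 1:]"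
    and 0: "poly P x = 0"
  shows "poly (pderiv P) x \<noteq> 0"
proof
  assume 1: "poly (pderiv P) x = 0"
  \<comment> \<open>Here \<open>t\<close> has degree -3, so its cube root \<open>r\<close>, of
    degree -1, scales \<open>x\<close> and \<open>s\<close> to degree 0.\<close>
  define y where "y = x * r"
  define w where "w = s * r ^ 4"
  have "r^6 * poly P x = y^6 - 2 * w * y^5 + 2 * w^3 * y^3 - (1024 * w + w^4) * y^2 + 512 * w^2 * y + 1536 * w^3"
    unfolding P y_def w_def t by (simp add: numeral_eq_Suc algebra_simps)
  hence p: "y^6 - 16 * y^5 + 1024 * y^3 - 12288 * y^2 + 32768 * y + 786432 = 0"
    using 0 unfolding w_def s by simp
  have "r^5 * poly (pderiv P) x = 6 * y^5 - 10 * w * y^4 + 6 * w^3 * y^2 - 2 * (1024 * w + w^4) * y + 512 * w^2"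
    unfolding P y_def w_def t by (simp add: pderiv_pCons numeral_eq_Suc algebra_simps)
  hence p': "6 * y^5 - 80 * y^4 + 3072 * y^2 - 24576 * y + 32768 = 0"
    using 1 unfolding w_def s by simp
  have "(11454 * y^4 - 269696 * y^3 + 2017408 * y^2 - 8867840 * y + 237568)
      * (y^6 - 16 * y^5 + 1024 * y^3 - 12288 * y^2 + 32768 * y + 786432)
    + (- 1909 * y^5 + 50040 * y^4 - 388224 * y^3 + 704000 * y^2 + 21745664 * y - 254459904)
      * (6 * y^5 - 80 * y^4 + 3072 * y^2 - 24576 * y + 32768) = - 8151311056896"
    by (simp add: algebra_simps numeral_eq_Suc)
  thus False unfolding p p' by simp
qed

lemma not_simple_spectrum_4: "\<not> simple_spectrum (map_mat nov_poly (dubrovin_4 [:t:] [:0, 1:] :: complex poly mat))"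
proof
  let ?M = "dubrovin_4 [:t:] [:0, 1:] :: complex poly mat"
  interpret nov: inj_idom_hom "nov_poly :: complex poly \<Rightarrow> complex novikov" by (rule inj_idom_hom_nov_poly)
  assume simple: "simple_spectrum (map_mat nov_poly ?M)"
  have A: "map_mat nov_poly ?M \<in> carrier_mat 6 6" by (simp add: dubrovin_carrier)
  have P: "char_poly (map_mat nov_poly ?M) = map_poly nov_poly (char_poly ?M)"
    by (rule nov.char_poly_hom[OF dubrovin_carrier(3)])
  obtain r where "char_poly ?M = pCons 0 (pCons 0 r)" unfolding char_poly_dubrovin_4 by blast
  \<comment> \<open>The factor is written with \<open>- 0\<close> to match the form in
    \<open>order_divides\<close>.\<close>
  hence P': "char_poly (map_mat nov_poly ?M) = [:- 0, 1:] ^ 2 * map_poly nov_poly r"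
    unfolding P by (simp add: nov.map_poly_pCons_hom power2_eq_square)
  have "char_poly (map_mat nov_poly ?M) \<noteq> 0" using degree_monic_char_poly[OF A] by auto
  hence "2 \<le> order 0 (char_poly (map_mat nov_poly ?M))"
    using P' order_divides[of 0 2] by (metis dvd_triv_left)
  moreover have "eigenvalue (map_mat nov_poly ?M) 0"
    unfolding eigenvalue_root_char_poly[OF A] P' by simp
  ultimately show False using simple unfolding simple_spectrum_def by fastforce
qed

theorem theorem1p3:
  fixes t :: complex
  assumes "t \<noteq> 0"
  shows "(\<forall>l \<in> {(2, 0), (1, 1), (2, 2)}.
            simple_spectrum (truncated_dubrovin 2 (bulk_class t l)))
       \<and> \<not> simple_spectrum (truncated_dubrovin 2 (bulk_class t (2, 1)))"
proof -
  have s: "(- 48 / t ^ 4) * t ^ 4 = - 48" using assms by simp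
  have "simple_spectrum (truncated_dubrovin 2 (bulk_class t (2, 0)))"
    unfolding truncated_dubrovin_bulk
    by (rule simple_spectrum_specialization[OF dubrovin_carrier(1), of "- 48 / t ^ 4"], simp,
        unfold dubrovin_specialization, rule simple_roots_2[OF assms s refl char_poly_dubrovin_2])
  moreover have "simple_spectrum (truncated_dubrovin 2 (bulk_class t (1, 1)))"
    unfolding truncated_dubrovin_bulk
    by (rule simple_spectrum_specialization[OF dubrovin_carrier(2), of "- 48 / t ^ 4"], simp,
        unfold dubrovin_specialization, rule simple_roots_2[OF assms s refl char_poly_dubrovin_3])
  moreover have "simple_spectrum (truncated_dubrovin 2 (bulk_class t (2, 2)))"
  proof -
    \<comment> \<open>A cube root of \<open>t\<close> from the principal logarithm, as
      \<open>t\<close> is nonzero.\<close>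
    define r where "r = exp (Ln t / 3)"
    have r: "r \<noteq> 0" "t = r ^ 3" using assms by (simp_all add: r_def exp_of_nat_mult[symmetric])
    have s: "(8 / r ^ 4) * r ^ 4 = 8" using r by simp
    show ?thesis
      unfolding truncated_dubrovin_bulk
      by (rule simple_spectrum_specialization[OF dubrovin_carrier(4), of "8 / r ^ 4"], simp,
          unfold dubrovin_specialization, rule simple_roots_5[OF r s char_poly_dubrovin_5])
  qed
  moreover have "\<not> simple_spectrum (truncated_dubrovin 2 (bulk_class t (2, 1)))"
    unfolding truncated_dubrovin_bulk by (rule not_simple_spectrum_4)
  ultimately show ?thesis by blast
qed

end
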